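(* Let $(D_1,\rho_1,\mathbf a_1)$ and $(D_2,\rho_2,\mathbf a_2)$ be two triples such that each $(D_j,\rho_j)$ is admissible (in the sense of the context) and each $\mathbf a_j\in\mathbb R^2$ is a non-zero constant vector. For $j=1,2$ let $F_j=\nabla\cdot\{\rho_j\chi_{D_j}\mathbf a_j\}$ and let $u_j\in H^1(\Omega)$ be a weak solution of $\Delta u_j+k^2u_j=F_j$ in $\Omega$. If $$\left(u_1|_{\partial\Omega},\frac{\partial u_1}{\partial\nu}\Big|_{\partial\Omega}\right)=\left(u_2|_{\partial\Omega},\frac{\partial u_2}{\partial\nu}\Big|_{\partial\Omega}\right),$$ then $[D_1]=[D_2]$, where $[D]$ denotes the convex hull of $D$.
   Context: $\Omega\subset\mathbb R^2$ is a bounded domain with Lipschitz boundary and unit outward normal $\nu$; $k\ge 0$ is fixed. Function spaces are complex valued, and all pairings and the dot product are bilinear. A pair $(D,\rho)$ is admissible if: $D$ is an open polygon (interior of a simple closed polygonal curve) with $\overline D\subset\Omega$; $\rho\in L^2(D)$; for each vertex $p$ of $D$ there exist an open disk $B(p,\eta)$ centred at $p$ with radius $\eta>0$, a number $0<\alpha\le1$ and a function $\tilde\rho\in C^{0,\alpha}(\overline{B(p,\eta)})$ such that $\rho=\tilde\rho$ on $B(p,\eta)\cap\overline D$ (a.e.) and $\tilde\rho(p)\ne0$. $\chi_D$ is the characteristic function of $D$. $F=\nabla\cdot\{\rho\chi_D\mathbf a\}$ acts by $F(\varphi)=-\int_D\rho\,\mathbf a\cdot\nabla\varphi\,dx$ for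 $\varphi\in H^1_0(\Omega)$. Weak solution of $\Delta u+k^2u=F$: $u\in H^1(\Omega)$ with $\int_\Omega\nabla u\cdot\nabla\varphi\,dx-k^2\int_\Omega u\varphi\,dx=-F(\varphi)$ for all $\varphi\in H^1_0(\Omega)$. Since $\operatorname{supp}F$ is a compact subset of $\Omega$, put $\tilde F(w)=F(\psi w)$ for $w\in H^1(\Omega)$, where $\psi\in C_0^\infty(\Omega)$ equals $1$ near $\operatorname{supp}F$ (independent of the choice of $\psi$). The Neumann derivative $\partial u/\partial\nu|_{\partial\Omega}$ is the element of the dual of $H^{1/2}(\partial\Omega)$ given by $\langle\partial u/\partial\nu|_{\partial\Omega},g\rangle=\int_\Omega\nabla u\cdot\nabla w\,dx-k^2\int_\Omega uw\,dx+\tilde F(w)$, where $w\in H^1(\Omega)$ is any lifting of $g$. *)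

theory Defs
  imports "HOL-Analysis.Analysis"
begin

text \<open>
  Functions on a subset of the plane are modelled as total functions; only their values on
  that subset (up to null sets for $L^2$ functions) are relevant.
\<close>

section \<open>Domains and polygons\<close>

definition lipschitz_domain :: "(real^2) set \<Rightarrow> bool" where
  "lipschitz_domain \<Omega> \<longleftrightarrow>
     open \<Omega> \<and> connected \<Omega> \<and> bounded \<Omega> \<and> \<Omega> \<noteq> {} \<and>
     (\<forall>p\<in>frontier \<Omega>. \<exists>e n \<gamma> L r.
        norm e = 1 \<and> norm n = 1 \<and> e \<bullet> n = 0 \<and> L-lipschitz_on UNIV (\<gamma> :: real \<Rightarrow> real) \<and> r > 0 \<and>
        (\<forall>x\<in>ball p r. x \<in> \<Omega> \<longleftrightarrow> \<gamma> (x \<bullet> e) < x \<bullet> n))"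

fun polyline :: "(real^2) list \<Rightarrow> real \<Rightarrow> real^2" where
  "polyline [] = (\<lambda>t. 0)"
| "polyline [p] = linepath p p"
| "polyline [p, q] = linepath p q"
| "polyline (p # q # r # ps) = linepath p q +++ polyline (q # r # ps)"

definition closed_polyline :: "(real^2) list \<Rightarrow> real \<Rightarrow> real^2" where
  "closed_polyline ps = polyline (ps @ [hd ps])"

text \<open>
  Consecutive vertices are not collinear, so the listed points are the genuine corners:
  the set of vertices is determined by the polygon.
\<close>
definition open_polygon :: "(real^2) list \<Rightarrow> (real^2) set \<Rightarrow> bool" where
  "open_polygon ps D \<longleftrightarrow>
     3 \<le> length ps \<and> simple_path (closed_polyline ps) \<and>
     (\<forall>i<length ps. \<not> collinear {ps ! i, ps ! (Suc i mod length ps), ps ! (Suc (Suc i) mod length ps)}) \<and>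
     D = inside (path_image (closed_polyline ps))"

section \<open>Square integrable functions and arc length on the boundary\<close>

definition L2_sq :: "'a measure \<Rightarrow> ('a \<Rightarrow> complex) \<Rightarrow> ennreal" where
  "L2_sq M f = (\<integral>\<^sup>+x. ennreal ((cmod (f x))\<^sup>2) \<partial>M)"

definition square_integrable :: "'a measure \<Rightarrow> ('a \<Rightarrow> complex) \<Rightarrow> bool" where
  "square_integrable M f \<longleftrightarrow> f \<in> borel_measurable M \<and> L2_sq M f < \<infinity>"

text \<open>One-dimensional Hausdorff measure, normalised so that a segment gets its length.\<close>

definition hausdorff1_outer :: "(real^2) set \<Rightarrow> ennreal" where
  "hausdorff1_outer A =
     (SUP \<delta>\<in>{0<..}. INF C\<in>{C :: nat \<Rightarrow> (real^2) set.
          A \<subseteq> (\<Union>i. C i) \<and> (\<forall>i. bounded (C i) \<and> diameter (C i) \<le> \<delta>)}.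
        (\<Sum>i. ennreal (diameter (C i))))"

definition arc_measure :: "(real^2) set \<Rightarrow> (real^2) measure" where
  "arc_measure \<Gamma> = restrict_space (measure_of UNIV (sets borel) hausdorff1_outer) \<Gamma>"

section \<open>Smooth functions and Sobolev spaces\<close>

definition pderiv2 :: "2 \<Rightarrow> (real^2 \<Rightarrow> complex) \<Rightarrow> real^2 \<Rightarrow> complex" where
  "pderiv2 i f x = frechet_derivative f (at x) (axis i 1)"

primrec C_k :: "nat \<Rightarrow> (real^2 \<Rightarrow> complex) \<Rightarrow> bool" where
  "C_k 0 f \<longleftrightarrow> continuous_on UNIV f"
| "C_k (Suc m) f \<longleftrightarrow> (\<forall>x. f differentiable (at x)) \<and> (\<forall>i. C_k m (pderiv2 i f))"

definition smooth :: "(real^2 \<Rightarrow> complex) \<Rightarrow> bool" where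
  "smooth f \<longleftrightarrow> (\<forall>m. C_k m f)"

definition test_function :: "(real^2) set \<Rightarrow> (real^2 \<Rightarrow> complex) \<Rightarrow> bool" where
  "test_function \<Omega> \<phi> \<longleftrightarrow>
     smooth \<phi> \<and> compact (closure {x. \<phi> x \<noteq> 0}) \<and> closure {x. \<phi> x \<noteq> 0} \<subseteq> \<Omega>"

definition is_weak_gradient ::
  "(real^2) set \<Rightarrow> (real^2 \<Rightarrow> complex) \<Rightarrow> (real^2 \<Rightarrow> complex^2) \<Rightarrow> bool" where
  "is_weak_gradient \<Omega> u g \<longleftrightarrow>
     (\<forall>i. square_integrable (lebesgue_on \<Omega>) (\<lambda>x. g x $ i)) \<and>
     (\<forall>i \<phi>. test_function \<Omega> \<phi> \<longrightarrow>
        (LINT x|lebesgue_on \<Omega>. u x * pderiv2 i \<phi> x) = - (LINT x|lebesgue_on \<Omega>. g x $ i * \<phi> x))"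

definition H1 :: "(real^2) set \<Rightarrow> (real^2 \<Rightarrow> complex) set" where
  "H1 \<Omega> = {u. square_integrable (lebesgue_on \<Omega>) u \<and> (\<exists>g. is_weak_gradient \<Omega> u g)}"

text \<open>For functions in \<^term>\<open>H1 \<Omega>\<close> the choice is unique up to a null set.\<close>
definition grad :: "(real^2) set \<Rightarrow> (real^2 \<Rightarrow> complex) \<Rightarrow> real^2 \<Rightarrow> complex^2" where
  "grad \<Omega> u = (SOME g. is_weak_gradient \<Omega> u g)"

definition H1_sq :: "(real^2) set \<Rightarrow> (real^2 \<Rightarrow> complex) \<Rightarrow> ennreal" where
  "H1_sq \<Omega> u = L2_sq (lebesgue_on \<Omega>) u + (\<Sum>i\<in>UNIV. L2_sq (lebesgue_on \<Omega>) (\<lambda>x. grad \<Omega> u x $ i))"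

definition H1_0 :: "(real^2) set \<Rightarrow> (real^2 \<Rightarrow> complex) set" where
  "H1_0 \<Omega> = {u \<in> H1 \<Omega>. \<exists>\<phi> :: nat \<Rightarrow> real^2 \<Rightarrow> complex. (\<forall>m. test_function \<Omega> (\<phi> m)) \<and>
     (\<lambda>m. H1_sq \<Omega> (\<lambda>x. u x - \<phi> m x)) \<longlonglongrightarrow> 0}"

text \<open>
  The trace operator is the continuous extension of the restriction of functions smooth up to
  the boundary: \<open>g\<close> represents the trace of \<open>u\<close> if \<open>(u, g)\<close> lies in the closure of
  its graph in $H^1(\Omega) \times L^2(\partial\Omega)$. The $g$ arising in this way form
  $H^{1/2}(\partial\Omega)$, and \<open>u\<close> is then a lifting of \<open>g\<close>.
\<close>
definition has_trace :: "(real^2) set \<Rightarrow> (real^2 \<Rightarrow> complex) \<Rightarrow> (real^2 \<Rightarrow> complex) \<Rightarrow> bool" where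
  "has_trace \<Omega> u g \<longleftrightarrow>
     u \<in> H1 \<Omega> \<and> square_integrable (arc_measure (frontier \<Omega>)) g \<and>
     (\<exists>v :: nat \<Rightarrow> real^2 \<Rightarrow> complex. (\<forall>m. smooth (v m)) \<and>
        (\<lambda>m. H1_sq \<Omega> (\<lambda>x. u x - v m x)) \<longlonglongrightarrow> 0 \<and>
        (\<lambda>m. L2_sq (arc_measure (frontier \<Omega>)) (\<lambda>x. g x - v m x)) \<longlonglongrightarrow> 0)"

section \<open>Admissible sources, weak solutions and Cauchy data\<close>

definition holder_on :: "real \<Rightarrow> (real^2) set \<Rightarrow> (real^2 \<Rightarrow> complex) \<Rightarrow> bool" where
  "holder_on \<alpha> S f \<longleftrightarrow> (\<exists>C. \<forall>x\<in>S. \<forall>y\<in>S. cmod (f x - f y) \<le> C * dist x y powr \<alpha>)"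

definition admissible :: "(real^2) set \<Rightarrow> (real^2) set \<Rightarrow> (real^2 \<Rightarrow> complex) \<Rightarrow> bool" where
  "admissible \<Omega> D \<rho> \<longleftrightarrow>
     (\<exists>ps. open_polygon ps D \<and> closure D \<subseteq> \<Omega> \<and> square_integrable (lebesgue_on D) \<rho> \<and>
       (\<forall>p\<in>set ps. \<exists>\<eta> \<alpha> \<rho>'. \<eta> > 0 \<and> 0 < \<alpha> \<and> \<alpha> \<le> 1 \<and> holder_on \<alpha> (cball p \<eta>) \<rho>' \<and>
          (AE x in lebesgue. x \<in> ball p \<eta> \<inter> closure D \<longrightarrow> \<rho> x = \<rho>' x) \<and> \<rho>' p \<noteq> 0))"

text \<open>Bilinear, without complex conjugation.\<close>
definition bdot :: "complex^2 \<Rightarrow> complex^2 \<Rightarrow> complex" where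
  "bdot v w = (\<Sum>i\<in>UNIV. v $ i * w $ i)"

definition div_source ::
  "(real^2) set \<Rightarrow> (real^2) set \<Rightarrow> (real^2 \<Rightarrow> complex) \<Rightarrow> real^2 \<Rightarrow> (real^2 \<Rightarrow> complex) \<Rightarrow> complex" where
  "div_source \<Omega> D \<rho> a \<phi> =
     - (LINT x|lebesgue_on D. \<rho> x * bdot (\<chi> i. complex_of_real (a $ i)) (grad \<Omega> \<phi> x))"

definition helmholtz_form ::
  "(real^2) set \<Rightarrow> real \<Rightarrow> (real^2 \<Rightarrow> complex) \<Rightarrow> (real^2 \<Rightarrow> complex) \<Rightarrow> complex" where
  "helmholtz_form \<Omega> k u w =
     (LINT x|lebesgue_on \<Omega>. bdot (grad \<Omega> u x) (grad \<Omega> w x))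
     - complex_of_real (k\<^sup>2) * (LINT x|lebesgue_on \<Omega>. u x * w x)"

definition weak_solution ::
  "(real^2) set \<Rightarrow> real \<Rightarrow> ((real^2 \<Rightarrow> complex) \<Rightarrow> complex) \<Rightarrow> (real^2 \<Rightarrow> complex) \<Rightarrow> bool" where
  "weak_solution \<Omega> k F u \<longleftrightarrow>
     u \<in> H1 \<Omega> \<and> (\<forall>\<phi>\<in>H1_0 \<Omega>. helmholtz_form \<Omega> k u \<phi> = - F \<phi>)"

definition source_support :: "(real^2) set \<Rightarrow> ((real^2 \<Rightarrow> complex) \<Rightarrow> complex) \<Rightarrow> (real^2) set" where
  "source_support \<Omega> F = \<Omega> - \<Union>{V. open V \<and> V \<subseteq> \<Omega> \<and> (\<forall>\<phi>. test_function V \<phi> \<longrightarrow> F \<phi> = 0)}"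

definition cutoff ::
  "(real^2) set \<Rightarrow> ((real^2 \<Rightarrow> complex) \<Rightarrow> complex) \<Rightarrow> (real^2 \<Rightarrow> complex) \<Rightarrow> bool" where
  "cutoff \<Omega> F \<psi> \<longleftrightarrow>
     test_function \<Omega> \<psi> \<and> (\<exists>U. open U \<and> source_support \<Omega> F \<subseteq> U \<and> (\<forall>x\<in>U. \<psi> x = 1))"

text \<open>
  \<open>h\<close> is the Neumann derivative of \<open>u\<close> as a functional on $H^{1/2}(\partial\Omega)$: its value
  at \<open>g\<close> is given by every lifting \<open>w\<close> of \<open>g\<close> and every cutoff \<open>\<psi>\<close>. This determines
  \<open>h\<close> on all traces, and for weak solutions it makes \<open>h\<close> linear and bounded there.
\<close>
definition has_neumann_derivative ::
  "(real^2) set \<Rightarrow> real \<Rightarrow> ((real^2 \<Rightarrow> complex) \<Rightarrow> complex) \<Rightarrow> (real^2 \<Rightarrow> complex)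
     \<Rightarrow> ((real^2 \<Rightarrow> complex) \<Rightarrow> complex) \<Rightarrow> bool" where
  "has_neumann_derivative \<Omega> k F u h \<longleftrightarrow>
     (\<forall>g w \<psi>. has_trace \<Omega> w g \<longrightarrow> cutoff \<Omega> F \<psi> \<longrightarrow>
        h g = helmholtz_form \<Omega> k u w + F (\<lambda>x. \<psi> x * w x))"

definition has_cauchy_data ::
  "(real^2) set \<Rightarrow> real \<Rightarrow> ((real^2 \<Rightarrow> complex) \<Rightarrow> complex) \<Rightarrow> (real^2 \<Rightarrow> complex)
     \<Rightarrow> (real^2 \<Rightarrow> complex) \<Rightarrow> ((real^2 \<Rightarrow> complex) \<Rightarrow> complex) \<Rightarrow> bool" where
  "has_cauchy_data \<Omega> k F u g h \<longleftrightarrow> has_trace \<Omega> u g \<and> has_neumann_derivative \<Omega> k F u h"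

end

theory Submission
  imports Defs
begin

text \<open>
  Green's formula tests the equation against $w = e^{\zeta\cdot x}$ with
  $\zeta\cdot\zeta = -k^2$. The Neumann data of \<open>u1\<close> and \<open>u2\<close> agree on \<open>w\<close>, and \<open>u1 - u2\<close> has
  vanishing trace, so all boundary terms cancel and
  $\zeta\cdot a_1 \int_{D_1}\rho_1 e^{\zeta\cdot x}\,dx = \zeta\cdot a_2 \int_{D_2}\rho_2 e^{\zeta\cdot x}\,dx$;
  no unique continuation is needed.
  If the convex hulls differ, say that of \<open>D1\<close> is not contained in that of \<open>D2\<close>, a generic direction \<open>d\<close>
  is maximised over \<open>D1\<close> only near a vertex \<open>p\<close> and stays below \<open>d \<bullet> p\<close> by a fixed amount on \<open>D2\<close>.
  Choose $\zeta$ with real part $\tau d$. After division by $e^{\zeta\cdot p}$, the left-hand side decays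
  like $1/\tau$, because the integral of $e^{\zeta\cdot(x-p)}$ over a sector is of exact order $\tau^{-2}$ and
  $\rho_1$ is continuous and nonzero at \<open>p\<close>, whereas the right-hand side decays exponentially.
\<close>

section \<open>Hausdorff measure\<close>

text \<open>Traces exist here only as limits in the square norm of one-dimensional Hausdorff measure
  on the boundary. So neither a normal nor an integration formula on the boundary is developed: of
  the divergence theorem one only needs that, for C^1 functions f, the integral of a partial
  derivative over \<Omega> is at most a constant times the boundary integral of |f|. This requires
  that the Hausdorff outer measure is a measure on the Borel sets and that the boundary has finite
  length. The comparison at the corner tolerates every pair of vectors with a non-zero
  \<open>a1\<close>, because real and imaginary part of \<zeta> . x are, up to the factors \<tau>
  and sqrt (\<tau>^2 + k^2), orthonormal coordinates of x. Hence |\<zeta> . a| lies between \<tau>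
  |a| and 2 \<tau> |a| once \<tau> \<ge> k, and no exponential gap can be offset by these factors.
  The direction must be generic because two vertices on the same top level would contribute terms of
  the same order, which might cancel.\<close>

definition hausdorff1_pre :: "real \<Rightarrow> (real^2) set \<Rightarrow> ennreal" where
  "hausdorff1_pre \<delta> A = (INF C\<in>{C :: nat \<Rightarrow> (real^2) set.
          A \<subseteq> (\<Union>i. C i) \<and> (\<forall>i. bounded (C i) \<and> diameter (C i) \<le> \<delta>)}.
        (\<Sum>i. ennreal (diameter (C i))))"

lemma hausdorff1_outer_eq: "hausdorff1_outer A = (SUP \<delta>\<in>{0<..}. hausdorff1_pre \<delta> A)"
  by (simp add: hausdorff1_outer_def hausdorff1_pre_def)

lemma hausdorff1_pre_le_hausdorff1_outer: "\<delta> > 0 \<Longrightarrow> hausdorff1_pre \<delta> A \<le> hausdorff1_outer A"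
  unfolding hausdorff1_outer_eq by (rule SUP_upper) auto

lemma hausdorff1_pre_le_cover:
  assumes "A \<subseteq> (\<Union>i. C i)" "\<And>i. bounded (C i)" "\<And>i. diameter (C i) \<le> \<delta>"
  shows "hausdorff1_pre \<delta> A \<le> (\<Sum>i. ennreal (diameter (C i)))"
  unfolding hausdorff1_pre_def by (rule INF_lower) (use assms in auto)

lemma hausdorff1_outer_mono: "A \<subseteq> B \<Longrightarrow> hausdorff1_outer A \<le> hausdorff1_outer B"
  unfolding hausdorff1_outer_def
  by (intro SUP_mono' INF_superset_mono) auto

lemma hausdorff1_pre_cover_approx:
  assumes "hausdorff1_pre \<delta> A < \<infinity>" "(e::real) > 0"
  obtains C where "A \<subseteq> (\<Union>i. C i)" "\<And>i. bounded (C i)" "\<And>i. diameter (C i) \<le> \<delta>"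
    "(\<Sum>i. ennreal (diameter (C i))) \<le> hausdorff1_pre \<delta> A + e"
proof -
  have "hausdorff1_pre \<delta> A < hausdorff1_pre \<delta> A + e"
    using assms by (metis add.right_neutral ennreal_add_left_cancel_less ennreal_less_zero_iff infinity_ennreal_def)
  then show ?thesis
    using that unfolding hausdorff1_pre_def INF_less_iff by (fastforce simp: less_imp_le)
qed

text \<open>Near-optimal covers of the \<open>A i\<close>, with errors
  \<open>e * (1/2)^Suc i\<close> that add up to \<open>e\<close>, are merged into one sequence
  through \<open>prod_decode\<close>. Such covers are available only where the content is finite, so
  an infinite summand is treated beforehand.\<close>

lemma hausdorff1_pre_countably_subadditive:
  "hausdorff1_pre \<delta> (\<Union>i. A i) \<le> (\<Sum>i. hausdorff1_pre \<delta> (A i))"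
proof (cases "\<exists>i. hausdorff1_pre \<delta> (A i) = \<infinity>")
  case True
  then obtain i where "hausdorff1_pre \<delta> (A i) = top" by auto
  then have "(\<Sum>i. hausdorff1_pre \<delta> (A i)) = top"
    by (metis ennreal_suminf_lessD less_top)
  then show ?thesis by simp
next
  case False
  show ?thesis
  proof (rule ennreal_le_epsilon)
    fix e :: real assume e: "e > 0"
    have "\<exists>C. A i \<subseteq> (\<Union>j. C j) \<and> (\<forall>j. bounded (C j)) \<and> (\<forall>j. diameter (C j) \<le> \<delta>) \<and>
       (\<Sum>j. ennreal (diameter (C j))) \<le> hausdorff1_pre \<delta> (A i) + e * (1/2)^Suc i" for i
      by (rule hausdorff1_pre_cover_approx[of \<delta> "A i" "e * (1/2)^Suc i"]) (use e False in \<open>auto simp: less_top\<close>)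
    then obtain C where C: "\<And>i. A i \<subseteq> (\<Union>j. C i j)" "\<And>i j. bounded (C i j)" "\<And>i j. diameter (C i j) \<le> \<delta>"
       "\<And>i. (\<Sum>j. ennreal (diameter (C i j))) \<le> hausdorff1_pre \<delta> (A i) + e * (1/2)^Suc i"
      by metis
    define C' where "C' n = case_prod C (prod_decode n)" for n
    have "(\<Union>i. A i) \<subseteq> (\<Union>n. C' n)"
    proof
      fix x assume "x \<in> (\<Union>i. A i)"
      then obtain i j where "x \<in> C i j" using C(1) by blast
      then show "x \<in> (\<Union>n. C' n)"
        unfolding C'_def by (auto intro!: exI[of _ "prod_encode (i,j)"])
    qed
    then have "hausdorff1_pre \<delta> (\<Union>i. A i) \<le> (\<Sum>n. ennreal (diameter (C' n)))"
      by (rule hausdorff1_pre_le_cover) (auto simp: C'_def C split: prod.splits)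
    also have "\<dots> = (\<Sum>i. \<Sum>j. ennreal (diameter (C i j)))"
      using suminf_ennreal_2dimen[where f="\<lambda>(i,j). ennreal (diameter (C i j))" and g="\<lambda>i. \<Sum>j. ennreal (diameter (C i j))"]
      by (simp add: C'_def case_prod_beta)
    also have "\<dots> \<le> (\<Sum>i. hausdorff1_pre \<delta> (A i) + e * (1/2)^Suc i)"
      by (intro suminf_le C) auto
    also have "\<dots> = (\<Sum>i. hausdorff1_pre \<delta> (A i)) + (\<Sum>i. ennreal (e * (1/2)^Suc i))"
      by (rule suminf_add[symmetric]) auto
    also have "(\<Sum>i. ennreal (e * (1/2)^Suc i)) = ennreal (\<Sum>i. e * (1/2)^Suc i)"
      using e sums_mult[OF power_half_series, of e] by (intro suminf_ennreal2) (auto dest: sums_summable)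
    also have "(\<Sum>i. e * (1/2)^Suc i) = e"
      using sums_mult[OF power_half_series, of e] by (simp add: sums_unique[symmetric])
    finally show "hausdorff1_pre \<delta> (\<Union>i. A i) \<le> (\<Sum>i. hausdorff1_pre \<delta> (A i)) + e" .
  qed
qed

lemma hausdorff1_outer_countably_subadditive:
  "hausdorff1_outer (\<Union>i. A i) \<le> (\<Sum>i. hausdorff1_outer (A i))"
  unfolding hausdorff1_outer_eq[of "\<Union>i. A i"]
proof (rule SUP_least)
  fix \<delta> :: real assume "\<delta> \<in> {0<..}"
  then show "hausdorff1_pre \<delta> (\<Union> (range A)) \<le> (\<Sum>i. hausdorff1_outer (A i))"
    by (intro order_trans[OF hausdorff1_pre_countably_subadditive] suminf_le hausdorff1_pre_le_hausdorff1_outer) auto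
qed

lemma hausdorff1_outer_empty [simp]: "hausdorff1_outer {} = 0"
proof -
  have "hausdorff1_pre \<delta> {} \<le> (\<Sum>i. ennreal (diameter ({} :: (real^2) set)))" if "\<delta> > 0" for \<delta>
    by (rule hausdorff1_pre_le_cover) (use that in auto)
  then have "hausdorff1_pre \<delta> {} = 0" if "\<delta> > 0" for \<delta> using that by simp
  then show ?thesis unfolding hausdorff1_outer_eq by (auto intro!: SUP_eqI)
qed

lemma hausdorff1_outer_Un:
  "hausdorff1_outer (A \<union> B) \<le> hausdorff1_outer A + hausdorff1_outer B"
proof -
  define F where "F i = (if i = 0 then A else if i = (1::nat) then B else {})" for i
  have "A \<union> B = (\<Union>i. F i)"
    by (force simp: F_def split: if_splits)
  moreover have "(\<Sum>i. hausdorff1_outer (F i)) = hausdorff1_outer A + hausdorff1_outer B"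
    by (subst suminf_finite[of "{0,1}"]) (auto simp: F_def)
  ultimately show ?thesis using hausdorff1_outer_countably_subadditive[of F] by simp
qed

lemma hausdorff1_pre_antimono: "\<delta> \<le> \<delta>' \<Longrightarrow> hausdorff1_pre \<delta>' A \<le> hausdorff1_pre \<delta> A"
  unfolding hausdorff1_pre_def by (rule INF_superset_mono) (auto intro: order_trans)

text \<open>The metric property behind the Caratheodory criterion: a set of diameter below
  \<open>r\<close> meets at most one of \<open>A\<close> and \<open>B\<close>, so every fine cover
  of the union separates into a cover of \<open>A\<close> and a cover of \<open>B\<close>.\<close>

lemma hausdorff1_outer_separated:
  assumes r: "r > 0" and sep: "\<And>x y. x \<in> A \<Longrightarrow> y \<in> B \<Longrightarrow> dist x y \<ge> r"
  shows "hausdorff1_outer A + hausdorff1_outer B \<le> hausdorff1_outer (A \<union> B)"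
proof -
  have fine: "hausdorff1_pre \<delta> A + hausdorff1_pre \<delta> B \<le> hausdorff1_pre \<delta> (A \<union> B)" if \<delta>: "\<delta> < r" for \<delta>
    unfolding hausdorff1_pre_def[of _ "A \<union> B"]
  proof (rule INF_greatest, clarify)
    fix C :: "nat \<Rightarrow> (real^2) set" assume C: "A \<union> B \<subseteq> (\<Union> (range C))" "\<forall>i. bounded (C i) \<and> diameter (C i) \<le> \<delta>"
    \<comment> \<open>Irrelevant sets are replaced by the empty set, of diameter 0, so that both
      covers stay indexed by \<open>nat\<close>.\<close>
    define CA where "CA i = (if C i \<inter> A = {} then {} else C i)" for i :: nat
    define CB where "CB i = (if C i \<inter> B = {} then {} else C i)" for i :: nat
    have "C i \<inter> A = {} \<or> C i \<inter> B = {}" for i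
    proof (rule ccontr)
      assume "\<not> ?thesis"
      then obtain x y where "x \<in> C i" "x \<in> A" "y \<in> C i" "y \<in> B" by blast
      then have "dist x y \<le> diameter (C i)" "r \<le> dist x y" using C(2) sep
        by (auto intro: diameter_bounded_bound)
      then show False using C(2) \<delta> by (meson not_le order_trans)
    qed
    then have *: "ennreal (diameter (CA i)) + ennreal (diameter (CB i)) \<le> ennreal (diameter (C i))" for i
      by (auto simp: CA_def CB_def)
    have "diameter (CA i) \<le> \<delta>" "diameter (CB i) \<le> \<delta>" for i
      using C(2) diameter_ge_0[of "C i"] by (auto simp: CA_def CB_def intro: order_trans)
    then have "hausdorff1_pre \<delta> A \<le> (\<Sum>i. ennreal (diameter (CA i)))" "hausdorff1_pre \<delta> B \<le> (\<Sum>i. ennreal (diameter (CB i)))"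
    proof -
      have "A \<subseteq> (\<Union>i. CA i)" "B \<subseteq> (\<Union>i. CB i)"
        using C(1) unfolding CA_def CB_def by (auto split: if_splits, blast+)
      moreover have "bounded (CA i)" "bounded (CB i)" for i
        using C(2) by (auto simp: CA_def CB_def)
      ultimately show "hausdorff1_pre \<delta> A \<le> (\<Sum>i. ennreal (diameter (CA i)))" "hausdorff1_pre \<delta> B \<le> (\<Sum>i. ennreal (diameter (CB i)))"
        using \<open>\<And>i. diameter (CA i) \<le> \<delta>\<close> \<open>\<And>i. diameter (CB i) \<le> \<delta>\<close>
        by (auto intro!: hausdorff1_pre_le_cover)
    qed
    then have "hausdorff1_pre \<delta> A + hausdorff1_pre \<delta> B \<le> (\<Sum>i. ennreal (diameter (CA i)) + ennreal (diameter (CB i)))"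
      by (simp add: suminf_add[symmetric] add_mono)
    also have "\<dots> \<le> (\<Sum>i. ennreal (diameter (C i)))"
      by (intro suminf_le *) auto
    finally show "hausdorff1_pre \<delta> A + hausdorff1_pre \<delta> B \<le> (\<Sum>i. ennreal (diameter (C i)))" .
  qed
  \<comment> \<open>As the content grows when \<delta> shrinks, the supremum may be taken over
    \<delta> < r, where the splitting applies. The same monotonicity makes the family directed, so
    the sum of two suprema becomes one supremum.\<close>
  have dir: "hausdorff1_outer X = (SUP \<delta>\<in>{0<..<r}. hausdorff1_pre \<delta> X)" for X
    unfolding hausdorff1_outer_eq
  proof (rule antisym)
    show "(SUP \<delta>\<in>{0<..}. hausdorff1_pre \<delta> X) \<le> (SUP \<delta>\<in>{0<..<r}. hausdorff1_pre \<delta> X)"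
    proof (rule SUP_mono)
      fix \<delta> :: real assume "\<delta> \<in> {0<..}"
      then show "\<exists>m\<in>{0<..<r}. hausdorff1_pre \<delta> X \<le> hausdorff1_pre m X"
        using r by (intro bexI[of _ "min \<delta> (r/2)"]) (auto intro!: hausdorff1_pre_antimono)
    qed
  qed (rule SUP_subset_mono, auto)
  have "hausdorff1_outer A + hausdorff1_outer B = (SUP \<delta>\<in>{0<..<r}. hausdorff1_pre \<delta> A + hausdorff1_pre \<delta> B)"
    unfolding dir[of A] dir[of B]
  proof (rule SUP_add_directed_ennreal[symmetric])
    fix i j assume "i \<in> {0<..<r}" "j \<in> {0<..<r}"
    then show "\<exists>k\<in>{0<..<r}. hausdorff1_pre i A + hausdorff1_pre j B \<le> hausdorff1_pre k A + hausdorff1_pre k B"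
      by (intro bexI[of _ "min i j"] add_mono hausdorff1_pre_antimono) auto
  qed
  also have "\<dots> \<le> hausdorff1_outer (A \<union> B)"
    by (rule SUP_least) (use fine hausdorff1_pre_le_hausdorff1_outer in \<open>auto intro: order_trans\<close>)
  finally show ?thesis .
qed

text \<open>
  The annuli \<open>R n\<close> around \<open>F\<close> with indices of equal parity have positive distance from each other, so their
  measures are summable and the points of \<open>A\<close> close to \<open>F\<close> but outside it do not count in the limit.
\<close>
lemma hausdorff1_outer_closed_split:
  assumes F: "closed F" "F \<noteq> {}"
  shows "hausdorff1_outer (A \<inter> F) + hausdorff1_outer (A - F) \<le> hausdorff1_outer A"
proof (cases "hausdorff1_outer A = \<infinity>")
  case False
  let ?\<mu> = hausdorff1_outer
  \<comment> \<open>Outside \<open>F\<close>, the points of \<open>A\<close> missed by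
    \<open>An n\<close> are exactly those in the annuli \<open>R k\<close> with k \<ge> n.\<close>
  define An where "An n = {x\<in>A. infdist x F \<ge> 1 / real (n+1)}" for n
  define R where "R n = {x\<in>A. 1 / real (n+2) \<le> infdist x F \<and> infdist x F < 1 / real (n+1)}" for n
  have Rsep: "?\<mu> (\<Union>k<N. R (2*k+b)) \<le> ?\<mu> A \<and> (\<Sum>k<N. ?\<mu> (R (2*k+b))) \<le> ?\<mu> (\<Union>k<N. R (2*k+b))" for N b
  proof (induction N)
    case (Suc N)
    have "?\<mu> (\<Union>k<Suc N. R (2*k+b)) \<le> ?\<mu> A"
      by (rule hausdorff1_outer_mono) (auto simp: R_def)
    moreover have s: "(\<Sum>k<Suc N. ?\<mu> (R (2*k+b))) \<le> ?\<mu> (\<Union>k<N. R (2*k+b)) + ?\<mu> (R (2*N+b))"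
      using Suc by (simp add: add_right_mono)
    moreover have t: "?\<mu> (\<Union>k<N. R (2*k+b)) + ?\<mu> (R (2*N+b)) \<le> ?\<mu> ((\<Union>k<N. R (2*k+b)) \<union> R (2*N+b))"
    proof (cases N)
      case (Suc M)
      \<comment> \<open>The width of the annulus with index \<open>2*M+b+1\<close>, which separates
        the last one collected, \<open>2*M+b\<close>, from the new one,
        \<open>2*N+b\<close>.\<close>
      define r where "r = 1 / real (2*M+b+2) - 1 / real (2*N+b+1)"
      show ?thesis
      proof (rule hausdorff1_outer_separated)
        show "r > 0" by (simp add: r_def Suc frac_less2)
        fix x y assume "x \<in> (\<Union>k<N. R (2*k+b))" and y: "y \<in> R (2*N+b)"
        then obtain k where k: "k < N" "x \<in> R (2*k+b)" by auto
        have "1 / real (2*M+b+2) \<le> 1 / real (2*k+b+2)"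
          using k Suc by (intro divide_left_mono) auto
        also have "\<dots> \<le> infdist x F" using k by (simp add: R_def)
        also have "\<dots> \<le> infdist y F + dist x y" by (rule infdist_triangle)
        also have "infdist y F < 1 / real (2*N+b+1)" using y by (simp add: R_def)
        finally show "r \<le> dist x y" by (simp add: r_def)
      qed
    qed auto
    moreover have u: "(\<Union>k<N. R (2*k+b)) \<union> R (2*N+b) = (\<Union>k<Suc N. R (2*k+b))"
      by (auto simp: less_Suc_eq)
    ultimately show ?case using order_trans[OF s t] by simp
  qed auto
  have "(\<Sum>k<n. ?\<mu> (R k)) \<le> 2 * ?\<mu> A" for n
  proof -
    have "(\<Sum>k<n. ?\<mu> (R k)) \<le> (\<Sum>k<2*n. ?\<mu> (R k))"
      by (rule sum_mono2) auto
    also have "\<dots> = (\<Sum>k<n. ?\<mu> (R (2*k))) + (\<Sum>k<n. ?\<mu> (R (2*k+1)))"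
      by (induction n) (auto simp: algebra_simps)
    also have "\<dots> \<le> ?\<mu> A + ?\<mu> A"
    proof (rule add_mono)
      show "(\<Sum>k<n. ?\<mu> (R (2*k))) \<le> ?\<mu> A"
        using order_trans[OF conjunct2[OF Rsep[where N=n and b=0]] conjunct1[OF Rsep[where N=n and b=0]]] by simp
      show "(\<Sum>k<n. ?\<mu> (R (2*k+1))) \<le> ?\<mu> A"
        using order_trans[OF conjunct2[OF Rsep[where N=n and b=1]] conjunct1[OF Rsep[where N=n and b=1]]] by simp
    qed
    finally show ?thesis by (simp add: mult_2)
  qed
  then have "(\<Sum>k. ?\<mu> (R k)) \<le> 2 * ?\<mu> A"
    by (intro suminf_le_const) auto
  also have "\<dots> < \<infinity>" using False by (simp add: ennreal_mult_less_top less_top)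
  finally have fin: "(\<Sum>k. ?\<mu> (R k)) < \<infinity>" .
  have main: "?\<mu> (A \<inter> F) + ?\<mu> (A - F) \<le> ?\<mu> A + (\<Sum>k. ?\<mu> (R (k+n)))" for n
  proof -
    have "A - F \<subseteq> An n \<union> (\<Union>k. R (k+n))"
    proof
      fix x assume x: "x \<in> A - F"
      then have pos: "infdist x F > 0"
        using F by (metis DiffD2 in_closed_iff_infdist_zero infdist_nonneg less_eq_real_def)
      show "x \<in> An n \<union> (\<Union>k. R (k+n))"
      proof (cases "infdist x F \<ge> 1 / real (n+1)")
        case lt: False
        \<comment> \<open>With \<open>m\<close> the first index for which \<open>An m\<close>
          contains the point, the point lies in the annulus with index \<open>m - 1\<close>.\<close>
        define m where "m = (LEAST m. 1 / real (m+1) \<le> infdist x F)"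
        obtain m0 where "1 / real (m0+1) \<le> infdist x F"
          using reals_Archimedean[OF pos] by (metis inverse_eq_divide Suc_eq_plus1 less_imp_le)
        then have m1: "1 / real (m+1) \<le> infdist x F"
          unfolding m_def by (rule LeastI)
        have "m > n"
        proof (rule ccontr)
          assume "\<not> m > n"
          then have "1 / real (n+1) \<le> 1 / real (m+1)" by (auto simp: field_simps)
          then show False using m1 lt by linarith
        qed
        then have "\<not> 1 / real ((m-1)+1) \<le> infdist x F"
          unfolding m_def by (intro not_less_Least) auto
        then have "x \<in> R ((m-1-n) + n)"
          using m1 \<open>m > n\<close> x by (simp add: R_def of_nat_diff)
        then show ?thesis by blast
      qed (use x in \<open>auto simp: An_def\<close>)
    qed
    then have "?\<mu> (A - F) \<le> ?\<mu> (An n \<union> (\<Union>k. R (k+n)))" by (rule hausdorff1_outer_mono)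
    also have "\<dots> \<le> ?\<mu> (An n) + (\<Sum>k. ?\<mu> (R (k+n)))"
      by (intro order_trans[OF hausdorff1_outer_Un] add_left_mono hausdorff1_outer_countably_subadditive)
    finally have "?\<mu> (A \<inter> F) + ?\<mu> (A - F) \<le> ?\<mu> (A \<inter> F) + (?\<mu> (An n) + (\<Sum>k. ?\<mu> (R (k+n))))"
      by (rule add_left_mono)
    also have "\<dots> = (?\<mu> (A \<inter> F) + ?\<mu> (An n)) + (\<Sum>k. ?\<mu> (R (k+n)))" by (simp add: add.assoc)
    also have "?\<mu> (A \<inter> F) + ?\<mu> (An n) \<le> ?\<mu> ((A \<inter> F) \<union> An n)"
    proof (rule hausdorff1_outer_separated[of "1 / real (n+1)"])
      fix x y assume "x \<in> A \<inter> F" "y \<in> An n"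
      then show "1 / real (n+1) \<le> dist x y"
        using infdist_le[of x F y] by (auto simp: An_def dist_commute)
    qed simp
    also have "\<dots> \<le> ?\<mu> A" by (rule hausdorff1_outer_mono) (auto simp: An_def)
    finally show ?thesis by (simp add: add_right_mono)
  qed
  show ?thesis
  proof (rule ennreal_le_epsilon)
    fix e :: real assume e: "e > 0"
    have S: "(\<Sum>k. ?\<mu> (R k)) \<noteq> top" using fin by simp
    \<comment> \<open>Finite partial sums and a finite total permit the subtraction in
      \<open>ennreal\<close> by which the tails are seen to vanish.\<close>
    have part: "(\<Sum>k<n. ?\<mu> (R k)) \<noteq> top" for n
    proof -
      have "(\<Sum>k<n. ?\<mu> (R k)) \<le> (\<Sum>k. ?\<mu> (R k))" by (rule sum_le_suminf) auto
      then show ?thesis using S top_unique by metis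
    qed
    have "(\<Sum>k. ?\<mu> (R (k+n))) = (\<Sum>k. ?\<mu> (R k)) - (\<Sum>k<n. ?\<mu> (R k))" for n
      using part by (subst suminf_offset[of _ n]) auto
    moreover have "(\<lambda>n. (\<Sum>k. ?\<mu> (R k)) - (\<Sum>k<n. ?\<mu> (R k))) \<longlonglongrightarrow> (\<Sum>k. ?\<mu> (R k)) - (\<Sum>k. ?\<mu> (R k))"
      using S by (intro tendsto_diff_ennreal tendsto_const summable_LIMSEQ) auto
    ultimately have "(\<lambda>n. (\<Sum>k. ?\<mu> (R (k+n)))) \<longlonglongrightarrow> 0" using S by simp
    then have "\<exists>n. (\<Sum>k. ?\<mu> (R (k+n))) < e"
      using e order_tendstoD(2)[of _ 0 sequentially "ennreal e"] by (auto simp: eventually_sequentially)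
    then obtain n where "(\<Sum>k. ?\<mu> (R (k+n))) < e" ..
    then show "?\<mu> (A \<inter> F) + ?\<mu> (A - F) \<le> ?\<mu> A + e"
      using main[of n] by (meson add_left_mono less_imp_le order_trans)
  qed
qed auto

text \<open>Caratheodory's construction: the sets that split every test set additively form a
  sigma-algebra, and it contains the closed sets. Without this fact \<open>measure_of\<close> would
  by convention assign 0 to every set, and integrals over the boundary would carry no
  information.\<close>

lemma measure_space_hausdorff1: "measure_space UNIV (sets borel) hausdorff1_outer"
proof -
  interpret P: sigma_algebra "UNIV :: (real^2) set" "Pow UNIV" by (rule sigma_algebra_Pow)
  let ?L = "lambda_system UNIV (Pow UNIV) hausdorff1_outer"
  have "outer_measure_space (Pow UNIV) hausdorff1_outer"
    by (auto simp: outer_measure_space_def positive_def increasing_def countably_subadditive_def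
        hausdorff1_outer_mono hausdorff1_outer_countably_subadditive)
  then have ms: "measure_space UNIV ?L hausdorff1_outer"
    by (rule P.caratheodory_lemma)
  have "F \<in> ?L" if "closed F" for F
  proof (cases "F = {}")
    case True
    then show ?thesis by (auto simp: lambda_system_def)
  next
    case False
    have "hausdorff1_outer (A \<inter> F) + hausdorff1_outer (A - F) = hausdorff1_outer A" for A
      using hausdorff1_outer_closed_split[OF that False, of A] hausdorff1_outer_Un[of "A \<inter> F" "A - F"]
      by (simp add: Int_Diff_Un antisym)
    then show ?thesis by (auto simp: lambda_system_def Int_commute Diff_eq)
  qed
  then have "sigma_sets UNIV (Collect closed) \<subseteq> ?L"
    using ms by (intro sigma_algebra.sigma_sets_subset) (auto simp: measure_space_def)
  then have "sets borel \<subseteq> ?L" unfolding borel_eq_closed by simp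
  then show ?thesis
    by (intro measure_down[OF ms _]) (use sets.sigma_algebra_axioms[of "borel :: (real^2) measure"] in simp)
qed

abbreviation hausdorff1 :: "(real^2) measure" where
  "hausdorff1 \<equiv> measure_of UNIV (sets borel) hausdorff1_outer"

lemma sets_hausdorff1 [simp, measurable_cong]: "sets hausdorff1 = sets borel"
  using sets.sigma_sets_eq[of "borel :: (real^2) measure"] by simp

lemma space_hausdorff1 [simp]: "space hausdorff1 = UNIV" by simp

lemma emeasure_hausdorff1: "A \<in> sets borel \<Longrightarrow> emeasure hausdorff1 A = hausdorff1_outer A"
  using measure_space_hausdorff1 
  by (intro emeasure_measure_of_sigma) (auto simp: measure_space_def)

text \<open>Cutting the interval into pieces of length \<open>w\<close> with \<open>L * w\<close> at
  most \<delta> gives covers whose diameters sum to at most \<open>L * (b - a)\<close>, whatever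
  \<delta> is. This will give the finite length of a Lipschitz boundary.\<close>

lemma hausdorff1_outer_lipschitz_image:
  fixes G :: "real \<Rightarrow> real^2"
  assumes G: "L-lipschitz_on {a..b} G" and "a < b"
  shows "hausdorff1_outer (G ` {a..b}) \<le> ennreal (L * (b - a))"
  unfolding hausdorff1_outer_eq
proof (rule SUP_least)
  fix \<delta> :: real assume "\<delta> \<in> {0<..}"
  then have \<delta>: "\<delta> > 0" by simp
  have L: "L \<ge> 0" using G by (rule lipschitz_on_nonneg)
  obtain N :: nat where N: "L * (b - a) / \<delta> < N" using reals_Archimedean2 by blast
  then have N0: "N > 0" using L \<open>a < b\<close> \<delta>
    by (metis diff_gt_0_iff_gt divide_nonneg_pos mult_nonneg_nonneg not_less of_nat_0 gr0I less_imp_le)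
  define w where "w = (b - a) / N"
  have w: "w > 0" using \<open>a < b\<close> N0 by (simp add: w_def)
  have Lw: "L * w \<le> \<delta>" using N N0 \<delta> by (simp add: w_def field_simps)
  define C where "C i = (if i < N then G ` ({a..b} \<inter> {a + i * w .. a + (i+1) * w}) else {})" for i :: nat
  have dC: "diameter (C i) \<le> (if i < N then L * w else 0)" "bounded (C i)" for i
  proof -
    have *: "dist x y \<le> L * w" if xy: "x \<in> C i" "y \<in> C i" for x y
    proof -
      from xy obtain s t where st: "s \<in> {a..b} \<inter> {a + i * w .. a + (i+1) * w}" "t \<in> {a..b} \<inter> {a + i * w .. a + (i+1) * w}"
         "x = G s" "y = G t"
        by (auto simp: C_def split: if_splits)
      have "dist x y \<le> L * dist s t" using st G by (auto simp: lipschitz_on_def)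
      also have "\<dots> \<le> L * w" using st L by (intro mult_left_mono) (auto simp: dist_real_def algebra_simps)
      finally show ?thesis .
    qed
    show "bounded (C i)"
    proof (cases "C i = {}")
      case False
      then obtain x where "x \<in> C i" by auto
      then show ?thesis using * unfolding bounded_def by blast
    qed auto
    show "diameter (C i) \<le> (if i < N then L * w else 0)"
    proof (cases "i < N")
      case True
      have "diameter (C i) \<le> L * w"
        by (rule diameter_le) (use * w L in \<open>auto simp: dist_norm\<close>)
      then show ?thesis using True by simp
    qed (auto simp: C_def)
  qed
  have "hausdorff1_pre \<delta> (G ` {a..b}) \<le> (\<Sum>i. ennreal (diameter (C i)))"
  proof (rule hausdorff1_pre_le_cover)
    show "G ` {a..b} \<subseteq> (\<Union>i. C i)"
    proof clarify
      fix t assume t: "t \<in> {a..b}"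
      show "G t \<in> (\<Union>i. C i)"
      \<comment> \<open>The right end point is put into the last piece; the floor would give it the
        index \<open>N\<close>, beyond the cover.\<close>
      proof (cases "t = b")
        case True
        have "real (N - 1) * w \<le> b - a" "real (N - 1 + 1) * w = b - a"
          using N0 w by (auto simp: w_def field_simps of_nat_diff)
        then have "G t \<in> C (N - 1)" using N0 True t by (auto simp: C_def algebra_simps)
        then show ?thesis by blast
      next
        case False
        define i where "i = nat \<lfloor>(t - a) / w\<rfloor>"
        have i: "real i \<le> (t - a) / w" "(t - a) / w < real i + 1"
          using t w unfolding i_def by (auto simp: of_nat_nat)
        have "(t - a) / w < N" using t False N0 \<open>a < b\<close> by (simp add: w_def field_simps)
        then have "i < N" using i by linarith
        moreover have "a + i * w \<le> t" "t \<le> a + (i+1) * w" using i w by (auto simp: field_simps)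
        ultimately have "G t \<in> C i" using t by (auto simp: C_def)
        then show ?thesis by blast
      qed
    qed
    fix i show "diameter (C i) \<le> \<delta>" using dC(1)[of i] Lw \<delta> by (auto split: if_splits)
  qed (fact dC)
  also have "\<dots> = (\<Sum>i<N. ennreal (diameter (C i)))"
    by (rule suminf_finite) (auto simp: C_def)
  also have "\<dots> \<le> (\<Sum>i<N. ennreal (L * w))"
  proof (intro sum_mono ennreal_leI)
    fix i assume "i \<in> {..<N}"
    then show "diameter (C i) \<le> L * w" using dC(1)[of i] by simp
  qed
  also have "\<dots> = ennreal (N * (L * w))" 
    using L w by (simp add: ennreal_mult ennreal_of_nat_eq_real_of_nat)
  also have "N * (L * w) = L * (b - a)" using N0 by (simp add: w_def)
  finally show "hausdorff1_pre \<delta> (G ` {a..b}) \<le> ennreal (L * (b - a))" .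
qed

text \<open>
  The factor \<open>2 * L\<close> would do; the summand 1 keeps $0 \cdot \infty = 0$ out of the proof.
\<close>
lemma emeasure_projection_le_hausdorff1:
  fixes f :: "real^2 \<Rightarrow> real"
  assumes f: "L-lipschitz_on UNIV f" and "S \<in> sets borel" "S \<subseteq> f ` A"
  shows "emeasure lborel S \<le> ennreal (2 * L + 1) * hausdorff1_outer A"
proof -
  have L: "L \<ge> 0" using f by (rule lipschitz_on_nonneg)
  have "emeasure lborel S / ennreal (2 * L + 1) \<le> hausdorff1_pre 1 A"
    unfolding hausdorff1_pre_def
  proof (rule INF_greatest, clarify)
    fix C :: "nat \<Rightarrow> (real^2) set"
    assume C: "A \<subseteq> (\<Union> (range C))" "\<forall>i. bounded (C i) \<and> diameter (C i) \<le> 1"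
    define c where "c i = f (SOME x. x \<in> C i)" for i :: nat
    \<comment> \<open>All of \<open>C i\<close> is mapped into this interval, as its points are
      within \<open>diameter (C i)\<close> of the chosen one. For empty \<open>C i\<close> the
      choice is arbitrary, and the interval is replaced by the empty set.\<close>
    define J where "J i = (if C i = {} then {} else {c i - L * diameter (C i) .. c i + L * diameter (C i)})" for i
    have "S \<subseteq> (\<Union>i. J i)"
    proof
      fix s assume "s \<in> S"
      then obtain x where x: "x \<in> A" "s = f x" using assms by auto
      then obtain i where i: "x \<in> C i" using C by auto
      then have "(SOME x. x \<in> C i) \<in> C i" by (metis someI)
      then have "dist x (SOME x. x \<in> C i) \<le> diameter (C i)"
        using i C by (auto intro: diameter_bounded_bound)
      moreover have "dist s (c i) \<le> L * dist x (SOME x. x \<in> C i)"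
        using f by (auto simp: x c_def lipschitz_on_def)
      ultimately have "dist s (c i) \<le> L * diameter (C i)"
        using L by (meson mult_left_mono order_trans)
      then have "s \<in> J i" using i by (auto simp: J_def dist_real_def)
      then show "s \<in> (\<Union>i. J i)" by blast
    qed
    then have "emeasure lborel S \<le> emeasure lborel (\<Union>i. J i)"
      by (intro emeasure_mono) (auto simp: J_def)
    also have "\<dots> \<le> (\<Sum>i. emeasure lborel (J i))"
      by (intro emeasure_subadditive_countably) (auto simp: J_def)
    also have "\<dots> \<le> (\<Sum>i. ennreal (2 * L + 1) * ennreal (diameter (C i)))"
    proof (intro suminf_le)
      fix i
      have d: "diameter (C i) \<ge> 0" using C by (auto intro: diameter_ge_0)
      have "emeasure lborel (J i) \<le> ennreal (2 * (L * diameter (C i)))"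
        using L d by (simp add: J_def)
      also have "\<dots> \<le> ennreal ((2 * L + 1) * diameter (C i))"
        using d by (intro ennreal_leI) (simp add: distrib_right)
      also have "\<dots> = ennreal (2 * L + 1) * ennreal (diameter (C i))"
        using d L by (intro ennreal_mult) auto
      finally show "emeasure lborel (J i) \<le> ennreal (2 * L + 1) * ennreal (diameter (C i))" .
    qed auto
    also have "\<dots> = ennreal (2 * L + 1) * (\<Sum>i. ennreal (diameter (C i)))" by simp
    finally show "emeasure lborel S / ennreal (2 * L + 1) \<le> (\<Sum>i. ennreal (diameter (C i)))"
      using L by (intro divide_le_posI_ennreal) (simp_all add: mult.commute del: ennreal_plus)
  qed
  also have "\<dots> \<le> hausdorff1_outer A"
    by (intro hausdorff1_pre_le_hausdorff1_outer) auto
  finally have "emeasure lborel S / ennreal (2 * L + 1) * ennreal (2 * L + 1) \<le> hausdorff1_outer A * ennreal (2 * L + 1)"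
    by (rule mult_right_mono) simp
  also have "emeasure lborel S / ennreal (2 * L + 1) * ennreal (2 * L + 1) = emeasure lborel S"
    using L by (subst ennreal_divide_times, subst ennreal_divide_self) auto
  finally show ?thesis by (simp add: mult.commute)
qed

section \<open>Smooth functions\<close>

lemma pderiv2_eqI: "(f has_derivative f') (at x) \<Longrightarrow> pderiv2 i f x = f' (axis i 1)"
  unfolding pderiv2_def by (metis frechet_derivative_at)

lemma differentiable_pderiv2:
  assumes "f differentiable (at x)"
  obtains f' where "(f has_derivative f') (at x)" "\<And>i. pderiv2 i f x = f' (axis i 1)"
  using assms pderiv2_eqI unfolding differentiable_def by blast

text \<open>\<open>C_k (Suc m)\<close> demands differentiability but not continuity, so the base
  case has to derive the latter.\<close>

lemma C_k_Suc_imp: "C_k (Suc m) f \<Longrightarrow> C_k m f"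
proof (induction m arbitrary: f)
  case 0
  then show ?case
    by (auto intro: differentiable_imp_continuous_on simp: differentiable_on_def differentiable_at_withinI)
next
  case (Suc m)
  then show ?case by (metis C_k.simps(2))
qed

lemma C_k_const: "C_k m (\<lambda>x. c)"
proof (induction m arbitrary: c)
  case (Suc m)
  have "pderiv2 i (\<lambda>x. c) = (\<lambda>x. 0)" for i
    by (auto simp: fun_eq_iff intro!: pderiv2_eqI[THEN trans] derivative_eq_intros)
  then show ?case using Suc by auto
qed auto

lemma pderiv2_add:
  "f differentiable (at x) \<Longrightarrow> g differentiable (at x) \<Longrightarrow>
    pderiv2 i (\<lambda>x. f x + g x) x = pderiv2 i f x + pderiv2 i g x"
  by (elim differentiable_pderiv2) (auto intro!: pderiv2_eqI[THEN trans] derivative_intros)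

lemma pderiv2_mult:
  "f differentiable (at x) \<Longrightarrow> g differentiable (at x) \<Longrightarrow>
    pderiv2 i (\<lambda>x. f x * g x) x = f x * pderiv2 i g x + pderiv2 i f x * g x"
  by (elim differentiable_pderiv2) (auto intro!: pderiv2_eqI[THEN trans] has_derivative_mult)

lemma C_k_add: "C_k m f \<Longrightarrow> C_k m g \<Longrightarrow> C_k m (\<lambda>x. f x + g x)"
proof (induction m arbitrary: f g)
  case (Suc m)
  then have "pderiv2 i (\<lambda>x. f x + g x) = (\<lambda>x. pderiv2 i f x + pderiv2 i g x)" for i
    by (auto simp: pderiv2_add)
  with Suc show ?case by auto
qed (auto intro: continuous_intros)

lemma C_k_mult: "C_k m f \<Longrightarrow> C_k m g \<Longrightarrow> C_k m (\<lambda>x. f x * g x)"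
proof (induction m arbitrary: f g)
  case (Suc m)
  then have "pderiv2 i (\<lambda>x. f x * g x) = (\<lambda>x. f x * pderiv2 i g x + pderiv2 i f x * g x)" for i
    by (auto simp: pderiv2_mult)
  moreover have "C_k m f" "C_k m g" using Suc.prems C_k_Suc_imp by blast+
  ultimately show ?case using Suc by (auto intro!: C_k_add)
qed (auto intro: continuous_intros)

text \<open>The derivative is a product of copies of the inverse with a derivative of
  \<open>f\<close>, so the induction hypothesis applies to the same \<open>f\<close>.\<close>

lemma C_k_inverse: "C_k m f \<Longrightarrow> (\<And>x. f x \<noteq> 0) \<Longrightarrow> C_k m (\<lambda>x. inverse (f x))"
proof (induction m)
  case (Suc m)
  have *: "((\<lambda>x. inverse (f x)) has_derivative (\<lambda>h. - (inverse (f x) * f' h * inverse (f x)))) (at x)"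
    if "(f has_derivative f') (at x)" for x f'
    using Suc.prems that by (intro Deriv.has_derivative_inverse) auto
  have "pderiv2 i (\<lambda>x. inverse (f x)) x = (-1) * (inverse (f x) * pderiv2 i f x * inverse (f x))" for i x
  proof -
    have "f differentiable (at x)" using Suc.prems by simp
    then obtain f' where f': "(f has_derivative f') (at x)" "\<And>i. pderiv2 i f x = f' (axis i 1)"
      by (rule differentiable_pderiv2) blast
    show ?thesis using pderiv2_eqI[OF *[OF f'(1)]] by (simp add: f'(2))
  qed
  then have pd: "pderiv2 i (\<lambda>x. inverse (f x)) = (\<lambda>x. (-1) * (inverse (f x) * pderiv2 i f x * inverse (f x)))" for i
    by (rule ext)
  moreover have "(\<lambda>x. inverse (f x)) differentiable (at x)" for x
    using * Suc.prems unfolding differentiable_def by (metis C_k.simps(2) differentiable_def)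
  moreover have "C_k m (\<lambda>x. inverse (f x))" using Suc C_k_Suc_imp by blast
  moreover have "C_k m (pderiv2 i f)" for i using Suc.prems by simp
  ultimately show ?case unfolding C_k.simps(2) pd by (intro conjI allI C_k_mult C_k_const)
qed (auto intro!: continuous_intros)

lemma C_k_coord: "C_k m (\<lambda>x. complex_of_real (x $ j))"
proof (cases m)
  case (Suc n)
  have d: "((\<lambda>x. complex_of_real (x $ j)) has_derivative (\<lambda>h. complex_of_real (h $ j))) (at x)" for x
    by (intro has_derivative_of_real bounded_linear_imp_has_derivative bounded_linear_vec_nth)
  then have "pderiv2 i (\<lambda>x. complex_of_real (x $ j)) = (\<lambda>x. complex_of_real (axis i 1 $ j))" for i
    by (auto dest: pderiv2_eqI)
  then show ?thesis using d by (auto simp: Suc C_k_const differentiable_def)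
qed (auto intro!: continuous_intros)

lemma smooth_const: "smooth (\<lambda>x. c)"
  and smooth_add: "smooth f \<Longrightarrow> smooth g \<Longrightarrow> smooth (\<lambda>x. f x + g x)"
  and smooth_mult: "smooth f \<Longrightarrow> smooth g \<Longrightarrow> smooth (\<lambda>x. f x * g x)"
  and smooth_inverse: "smooth f \<Longrightarrow> (\<And>x. f x \<noteq> 0) \<Longrightarrow> smooth (\<lambda>x. inverse (f x))"
  and smooth_coord: "smooth (\<lambda>x. complex_of_real (x $ j))"
  by (auto simp: smooth_def C_k_const C_k_add C_k_mult C_k_inverse C_k_coord)

lemma smooth_uminus: "smooth f \<Longrightarrow> smooth (\<lambda>x. - f x)"
  using smooth_mult[OF smooth_const, of f "-1"] by simp

lemma smooth_diff: "smooth f \<Longrightarrow> smooth g \<Longrightarrow> smooth (\<lambda>x. f x - g x)"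
  using smooth_add[OF _ smooth_uminus, of f g] by simp

lemma smooth_sum: "(\<And>i. i \<in> I \<Longrightarrow> smooth (f i)) \<Longrightarrow> smooth (\<lambda>x. \<Sum>i\<in>I. f i x)"
  by (induction I rule: infinite_finite_induct) (auto simp: smooth_const smooth_add)

lemma smooth_prod: "(\<And>i. i \<in> I \<Longrightarrow> smooth (f i)) \<Longrightarrow> smooth (\<lambda>x. \<Prod>i\<in>I. f i x)"
  by (induction I rule: infinite_finite_induct) (auto simp: smooth_const smooth_mult)

lemma smooth_pderiv2: "smooth f \<Longrightarrow> smooth (pderiv2 i f)"
  unfolding smooth_def by (metis C_k.simps(2))

lemma smooth_imp_C1: "smooth f \<Longrightarrow> C_k 1 f"
  by (simp add: smooth_def)

lemma C1_differentiable: "C_k 1 f \<Longrightarrow> f differentiable (at x)"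
  by simp

lemma C1_continuous_pderiv2: "C_k 1 f \<Longrightarrow> continuous_on UNIV (pderiv2 i f)"
  by simp

lemma C1_continuous: "C_k 1 f \<Longrightarrow> continuous_on UNIV f"
  using C_k_Suc_imp[of 0 f] by simp

text \<open>Each partial derivative is a constant multiple of the function itself, so a single
  derivative formula carries the induction on the order.\<close>

lemma smooth_exp_linear:
  fixes \<zeta> :: "complex^2"
  defines "w \<equiv> \<lambda>x :: real^2. exp (\<Sum>i\<in>UNIV. \<zeta> $ i * complex_of_real (x $ i))"
  shows "smooth w" and "pderiv2 i w = (\<lambda>x. \<zeta> $ i * w x)"
proof -
  have d: "(w has_derivative (\<lambda>h. w x * (\<Sum>i\<in>UNIV. \<zeta> $ i * complex_of_real (h $ i)))) (at x)" for x
  proof -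
    have "((\<lambda>x. \<Sum>i\<in>UNIV. \<zeta> $ i * complex_of_real (x $ i)) has_derivative
        (\<lambda>h. \<Sum>i\<in>UNIV. \<zeta> $ i * complex_of_real (h $ i))) (at x)"
      by (intro has_derivative_sum has_derivative_mult_right has_derivative_of_real
          bounded_linear_imp_has_derivative bounded_linear_vec_nth)
    from has_derivative_compose[OF this DERIV_exp[unfolded has_field_derivative_def]]
    show ?thesis unfolding w_def by simp
  qed
  show *: "pderiv2 i w = (\<lambda>x. \<zeta> $ i * w x)" for i
    using pderiv2_eqI[OF d] by (auto simp: fun_eq_iff axis_def if_distrib sum.delta cong: if_cong)
  have "C_k m w" for m
  proof (induction m)
    case 0
    then show ?case unfolding w_def by (auto intro!: continuous_intros)
  next
    case (Suc m)
    then show ?case using d by (auto simp: differentiable_def * intro!: C_k_mult C_k_const)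
  qed
  then show "smooth w" by (simp add: smooth_def)
qed

section \<open>A flat function, smooth cutoffs and smooth approximation of boxes\<close>

text \<open>The powers of \<open>1 / t\<close> make the linear span of the family closed under differentiation.\<close>
definition flat :: "nat \<Rightarrow> real \<Rightarrow> real" where
  "flat n t = (if t > 0 then (1 / t) ^ n * exp (- (1 / t)) else 0)"

lemma flat_nonneg: "flat n t \<ge> 0" by (simp add: flat_def)

lemma flat_pos: "t > 0 \<Longrightarrow> flat n t > 0" by (simp add: flat_def)

lemma flat_eq_0: "t \<le> 0 \<Longrightarrow> flat n t = 0" by (simp add: flat_def)

text \<open>From the right, substituting the inverse of t turns the claim into the decay of t^n /
  exp t at infinity; on the left the function is 0.\<close>

lemma flat_tendsto_0: "(flat n \<longlongrightarrow> 0) (at 0)"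
proof -
  have "((\<lambda>t::real. (1/t)^n * exp (- (1/t))) \<longlongrightarrow> 0) (at_right 0)"
  proof -
    have "((\<lambda>t::real. t ^ n / exp t) \<longlongrightarrow> 0) at_top" by (rule tendsto_power_div_exp_0)
    then have "((\<lambda>t::real. (inverse t) ^ n / exp (inverse t)) \<longlongrightarrow> 0) (at_right 0)"
      by (rule filterlim_compose) (rule filterlim_inverse_at_top_right)
    then show ?thesis by (simp add: inverse_eq_divide exp_minus)
  qed
  then have "(flat n \<longlongrightarrow> 0) (at_right 0)"
    by (rule Lim_transform_eventually) (auto simp: eventually_at_filter flat_def)
  moreover have "(flat n \<longlongrightarrow> 0) (at_left 0)"
    by (rule tendsto_eventually) (auto simp: eventually_at_filter flat_def)
  ultimately show ?thesis by (simp add: filterlim_split_at)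
qed

lemma flat_has_derivative:
  "(flat n has_real_derivative flat (n+2) t - n * flat (n+1) t) (at t)"
proof (cases t "0::real" rule: linorder_cases)
  case less
  have "((\<lambda>_. 0) has_real_derivative 0) (at t)" by simp
  then have "(flat n has_real_derivative 0) (at t)"
    by (rule has_field_derivative_transform_within_open[of _ _ _ "{..<0}"]) (use less in \<open>auto simp: flat_def\<close>)
  then show ?thesis using less by (simp add: flat_def)
next
  case greater
  have "((\<lambda>t. inverse t ^ n * exp (- inverse t)) has_real_derivative
      (real n * (- (inverse t * inverse t)) * inverse t ^ (n - 1)) * exp (- inverse t)
       + inverse t ^ n * (exp (- inverse t) * (inverse t * inverse t))) (at t)"
    using greater by (auto intro!: derivative_eq_intros simp: mult_ac)
  moreover have "(real n * (- (inverse t * inverse t)) * inverse t ^ (n - 1)) * exp (- inverse t)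
       + inverse t ^ n * (exp (- inverse t) * (inverse t * inverse t)) = flat (n+2) t - n * flat (n+1) t"
    using greater by (cases n) (auto simp: flat_def inverse_eq_divide[symmetric] algebra_simps)
  ultimately have "((\<lambda>t. (1/t)^n * exp (- (1/t))) has_real_derivative flat (n+2) t - n * flat (n+1) t) (at t)"
    by (simp only: inverse_eq_divide)
  then show ?thesis
    by (rule has_field_derivative_transform_within_open[of _ _ _ "{0<..}"]) (use greater in \<open>auto simp: flat_def\<close>)
next
  case equal
  \<comment> \<open>At the origin the difference quotient is the next member of the family, whose
    limit 0 is the derivative.\<close>
  have "flat n h / h = flat (Suc n) h" if "h \<noteq> 0" for h by (simp add: flat_def)
  then have "\<forall>\<^sub>F h in at 0. flat (Suc n) h = flat n h / h"
    by (auto simp: eventually_at_filter)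
  with flat_tendsto_0[of "Suc n"] have "((\<lambda>h. flat n h / h) \<longlongrightarrow> 0) (at 0)"
    by (rule Lim_transform_eventually)
  then show ?thesis unfolding equal by (simp add: has_field_derivative_iff flat_def)
qed

text \<open>The chain rule runs through the real function \<open>l\<close>, whereas
  \<open>pderiv2\<close> is defined for complex ones. Uniqueness of the derivative shows that the
  complex derivative of \<open>l\<close> takes real values, which reconciles the two.\<close>

lemma C_k_compose_real:
  fixes g g' :: "real \<Rightarrow> real"
  assumes l: "C_k 1 (\<lambda>x. complex_of_real (l x))" and g: "\<And>t. (g has_real_derivative g' t) (at t)"
  shows "(\<lambda>x. complex_of_real (g (l x))) differentiable (at x)"
    and "pderiv2 i (\<lambda>x. complex_of_real (g (l x))) x = complex_of_real (g' (l x)) * pderiv2 i (\<lambda>x. complex_of_real (l x)) x"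
proof -
  obtain L where L: "((\<lambda>x. complex_of_real (l x)) has_derivative L) (at x)" "\<And>i. pderiv2 i (\<lambda>x. complex_of_real (l x)) x = L (axis i 1)"
    using differentiable_pderiv2[OF C1_differentiable[OF l]] by blast
  have lr: "(l has_derivative (\<lambda>h. Re (L h))) (at x)"
    using has_derivative_Re[OF L(1)] by simp
  have "((\<lambda>x. complex_of_real (l x)) has_derivative (\<lambda>h. complex_of_real (Re (L h)))) (at x)"
    using lr by (rule has_derivative_of_real)
  then have "L h = complex_of_real (Re (L h))" for h
    using L(1) has_derivative_unique by metis
  moreover have "((\<lambda>x. g (l x)) has_derivative (\<lambda>h. Re (L h) * g' (l x))) (at x)"
    using has_derivative_compose[OF lr, of g "\<lambda>h. h * g' (l x)"] g[of "l x"]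
    by (simp add: has_field_derivative_def mult_commute_abs)
  then have *: "((\<lambda>x. complex_of_real (g (l x))) has_derivative (\<lambda>h. complex_of_real (Re (L h) * g' (l x)))) (at x)"
    by (rule has_derivative_of_real)
  ultimately show "pderiv2 i (\<lambda>x. complex_of_real (g (l x))) x = complex_of_real (g' (l x)) * pderiv2 i (\<lambda>x. complex_of_real (l x)) x"
    using pderiv2_eqI[OF *, of i] by (simp add: L(2)) 
  show "(\<lambda>x. complex_of_real (g (l x))) differentiable (at x)"
    using * unfolding differentiable_def by blast
qed

lemma smooth_flat:
  assumes l: "smooth (\<lambda>x. complex_of_real (l x))"
  shows "smooth (\<lambda>x. complex_of_real (flat n (l x)))"
proof -
  have "C_k m (\<lambda>x. complex_of_real (flat n (l x)))" for m
  proof (induction m arbitrary: n)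
    case 0
    have "continuous_on UNIV (flat n)"
      by (meson DERIV_continuous_on flat_has_derivative has_field_derivative_at_within)
    moreover have "continuous_on UNIV (\<lambda>x. Re (complex_of_real (l x)))"
      using C1_continuous[OF smooth_imp_C1[OF l]] by (rule continuous_on_Re)
    ultimately show ?case
      by (auto intro!: continuous_on_of_real continuous_on_compose2[of UNIV "flat n"])
  next
    case (Suc m)
    have "pderiv2 i (\<lambda>x. complex_of_real (flat n (l x))) =
       (\<lambda>x. (complex_of_real (flat (n+2) (l x)) + complex_of_real (- real n) * complex_of_real (flat (n+1) (l x)))
            * pderiv2 i (\<lambda>x. complex_of_real (l x)) x)" for i
      using C_k_compose_real(2)[OF smooth_imp_C1[OF l] flat_has_derivative] by (simp add: fun_eq_iff)
    moreover have "C_k m (pderiv2 i (\<lambda>x. complex_of_real (l x)))" for i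
      using smooth_pderiv2[OF l] by (simp add: smooth_def)
    ultimately show ?case
      using C_k_compose_real(1)[OF smooth_imp_C1[OF l] flat_has_derivative]
      by (auto intro!: C_k_mult C_k_add C_k_const Suc simp del: of_real_minus of_real_of_nat_eq)
  qed
  then show ?thesis by (simp add: smooth_def)
qed

lemma smooth_imp_continuous: "smooth f \<Longrightarrow> continuous_on UNIV f"
  using C1_continuous smooth_imp_C1 by blast

lemma pderiv2_eq_0_outside:
  assumes "x \<notin> closure {x. f x \<noteq> 0}"
  shows "pderiv2 i f x = 0"
proof -
  have "((\<lambda>x. 0) has_derivative (\<lambda>h. 0)) (at x)" by simp
  then have "(f has_derivative (\<lambda>h. 0)) (at x)"
    by (rule has_derivative_transform_within_open[of _ _ _ _ "- closure {x. f x \<noteq> 0}"])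
      (use assms closure_subset[of "{x. f x \<noteq> 0}"] in auto)
  then show ?thesis by (rule pderiv2_eqI)
qed

lemma pderiv2_cong_open:
  assumes "open U" "x \<in> U" "\<And>y. y \<in> U \<Longrightarrow> f y = g y" "g differentiable (at x)"
  shows "pderiv2 i f x = pderiv2 i g x"
proof -
  obtain g' where g': "(g has_derivative g') (at x)" "pderiv2 i g x = g' (axis i 1)"
    using differentiable_pderiv2[OF assms(4)] by blast
  have "(f has_derivative g') (at x)"
    using g'(1) assms(1,2) by (rule has_derivative_transform_within_open) (use assms(3) in auto)
  then show ?thesis using pderiv2_eqI g'(2) by metis
qed

lemma compact_closure_mono: "compact (closure B) \<Longrightarrow> closure A \<subseteq> closure B \<Longrightarrow> compact (closure A)"
  by (metis closed_closure compact_Int_closed inf.absorb_iff2)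

lemma test_function_mult:
  assumes "test_function \<Omega> \<phi>" "smooth f"
  shows "test_function \<Omega> (\<lambda>x. \<phi> x * f x)"
proof -
  have "closure {x. \<phi> x * f x \<noteq> 0} \<subseteq> closure {x. \<phi> x \<noteq> 0}"
    by (intro closure_mono) auto
  then show ?thesis using assms unfolding test_function_def
    by (auto simp: smooth_mult simp del: compact_closure mult_eq_0_iff intro: compact_closure_mono)
qed

text \<open>Bumps on finitely many balls inside \<Omega> add up to a function \<open>l\<close> that
  is at least 1 on the neighbourhood \<open>U\<close> of \<open>K\<close> and positive only inside
  the balls. With h = \<open>flat 0\<close>, the quotient h(l) / (h(l) + h(1 - l)) is as smooth as
  \<open>l\<close> and equals 1 wherever l \<ge> 1.\<close>

lemma exists_cutoff:
  fixes K :: "(real^2) set"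
  assumes "compact K" "K \<subseteq> \<Omega>" "open \<Omega>"
  obtains \<psi> U where "test_function \<Omega> \<psi>" "open U" "K \<subseteq> U" "\<And>x. x \<in> U \<Longrightarrow> \<psi> x = 1" "\<And>x. cmod (\<psi> x) \<le> 1"
proof -
  have "\<forall>x\<in>K. \<exists>r>0. cball x r \<subseteq> \<Omega>" using assms open_contains_cball by blast
  then obtain r where r: "\<And>x. x \<in> K \<Longrightarrow> r x > 0 \<and> cball x (r x) \<subseteq> \<Omega>" by metis
  obtain S where S: "S \<subseteq> K" "finite S" "K \<subseteq> (\<Union>x\<in>S. ball x (r x / 2))"
  proof (rule compactE_image[OF assms(1), of K "\<lambda>x. ball x (r x / 2)"])
    show "K \<subseteq> (\<Union>c\<in>K. ball c (r c / 2))" using r by force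
  qed auto
  \<comment> \<open>The divisor is the value at distance \<open>r x / 2\<close>, because r^2 -
    (r/2)^2 = (3/4) r^2. Hence \<open>b x\<close> is at least 1 on the ball of half the
    radius.\<close>
  define b where "b x y = flat 0 ((r x)\<^sup>2 - (norm (y - x))\<^sup>2) / flat 0 ((r x)\<^sup>2 * (3/4))" for x y :: "real^2"
  define l where "l y = (\<Sum>x\<in>S. b x y)" for y
  define U where "U = (\<Union>x\<in>S. ball x (r x / 2))"
  have flat_mono: "flat 0 s \<le> flat 0 t" if "s \<le> t" for s t
    using that by (auto simp: flat_def frac_le)
  have b0: "b x y \<ge> 0" for x y by (simp add: b_def flat_nonneg)
  have b1: "b x y \<ge> 1" if "x \<in> S" "y \<in> ball x (r x / 2)" for x y
  proof -
    have rx: "r x > 0" using r S that by auto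
    have "norm (y - x) \<le> r x / 2" using that by (simp add: dist_norm norm_minus_commute)
    then have "(norm (y - x))\<^sup>2 \<le> (r x / 2)\<^sup>2" by (intro power_mono) auto
    then have "flat 0 ((r x)\<^sup>2 * (3/4)) \<le> flat 0 ((r x)\<^sup>2 - (norm (y - x))\<^sup>2)"
      by (intro flat_mono) (simp add: power_divide)
    moreover have "flat 0 ((r x)\<^sup>2 * (3/4)) > 0" using rx by (intro flat_pos) simp
    ultimately show ?thesis by (simp add: b_def)
  qed
  have l1: "l y \<ge> 1" if "y \<in> U" for y
  proof -
    obtain x where x: "x \<in> S" "y \<in> ball x (r x / 2)" using \<open>y \<in> U\<close> unfolding U_def by blast
    have "1 \<le> b x y" by (rule b1[OF x])
    also have "\<dots> \<le> l y" unfolding l_def using x(1) S(2) b0 by (intro member_le_sum) auto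
    finally show ?thesis .
  qed
  have norm_sq: "(norm (y - x))\<^sup>2 = (\<Sum>i\<in>UNIV. (y $ i - x $ i) * (y $ i - x $ i))" for x y :: "real^2"
    by (simp add: power2_norm_eq_inner inner_vec_def)
  have "smooth (\<lambda>y. complex_of_real (b x y))" for x
  proof -
    have "smooth (\<lambda>y. complex_of_real ((r x)\<^sup>2 - (norm (y - x))\<^sup>2))"
      unfolding norm_sq of_real_diff of_real_sum of_real_mult
      by (intro smooth_diff smooth_sum smooth_mult smooth_coord smooth_const)
    from smooth_mult[OF smooth_flat[OF this, of 0] smooth_const[of "inverse (complex_of_real (flat 0 ((r x)\<^sup>2 * (3/4))))"]]
    show ?thesis unfolding b_def of_real_divide by (simp only: divide_inverse)
  qed
  then have sl: "smooth (\<lambda>y. complex_of_real (l y))"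
    unfolding l_def of_real_sum by (intro smooth_sum)
  define den where "den y = complex_of_real (flat 0 (l y)) + complex_of_real (flat 0 (1 - l y))" for y
  \<comment> \<open>At least one of \<open>l y\<close> and \<open>1 - l y\<close> is
    positive.\<close>
  have den: "den y \<noteq> 0" for y
  proof -
    have "flat 0 (l y) + flat 0 (1 - l y) > 0"
      using flat_nonneg[of 0 "l y"] flat_nonneg[of 0 "1 - l y"] flat_pos[of "l y" 0] flat_pos[of "1 - l y" 0]
      by (cases "l y > 0") (auto intro: add_pos_nonneg add_nonneg_pos)
    then show ?thesis unfolding den_def of_real_add[symmetric] by (metis less_irrefl of_real_eq_0_iff)
  qed
  define \<psi> where "\<psi> y = complex_of_real (flat 0 (l y)) * inverse (den y)" for y
  have s1: "smooth (\<lambda>y. complex_of_real (1 - l y))"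
    unfolding of_real_diff by (intro smooth_diff smooth_const sl)
  have s\<psi>: "smooth \<psi>" unfolding \<psi>_def
    by (intro smooth_mult smooth_flat sl smooth_inverse den)
      (unfold den_def, intro smooth_add smooth_flat sl s1)
  have supp: "{x. \<psi> x \<noteq> 0} \<subseteq> (\<Union>x\<in>S. cball x (r x))"
  proof clarify
    fix y assume "\<psi> y \<noteq> 0"
    then have "l y > 0" unfolding \<psi>_def using flat_eq_0[of "l y" 0] by force
    then obtain x where x: "x \<in> S" "b x y > 0" unfolding l_def
      by (meson not_le sum_nonpos)
    then have "(r x)\<^sup>2 - (norm (y - x))\<^sup>2 > 0"
      unfolding b_def using flat_eq_0 by (metis div_0 less_irrefl not_le)
    then have "norm (y - x) < r x" using r S x by (intro power2_less_imp_less[of "norm (y-x)"]) (auto simp: less_imp_le subset_iff)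
    then show "y \<in> (\<Union>x\<in>S. cball x (r x))"
      using x by (auto simp: dist_norm norm_minus_commute intro!: bexI[of _ x])
  qed
  have cK: "compact (\<Union>x\<in>S. cball x (r x))" using S by auto
  have "closure {x. \<psi> x \<noteq> 0} \<subseteq> (\<Union>x\<in>S. cball x (r x))"
    by (rule closure_minimal[OF supp]) (use cK compact_imp_closed in blast)
  moreover have "(\<Union>x\<in>S. cball x (r x)) \<subseteq> \<Omega>" using r S by blast
  moreover have "compact (closure {x. \<psi> x \<noteq> 0})"
    using bounded_subset[OF compact_imp_bounded[OF cK] supp] by simp
  ultimately have t: "test_function \<Omega> \<psi>" using s\<psi> by (auto simp: test_function_def)
  have \<psi>1: "\<psi> y = 1" if "y \<in> U" for y
  proof -
    have "den y = complex_of_real (flat 0 (l y))" using l1[OF that] by (simp add: den_def flat_eq_0)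
    then show ?thesis using den[of y] by (simp add: \<psi>_def)
  qed
  have \<psi>_le: "cmod (\<psi> y) \<le> 1" for y
  proof -
    have "cmod (\<psi> y) = flat 0 (l y) / (flat 0 (l y) + flat 0 (1 - l y))"
      unfolding \<psi>_def den_def of_real_add[symmetric]
      by (simp add: norm_mult norm_inverse flat_nonneg divide_inverse del: of_real_add)
    also have "\<dots> \<le> 1" using flat_nonneg[of 0 "l y"] flat_nonneg[of 0 "1 - l y"]
      by (simp add: divide_le_eq)
    finally show ?thesis .
  qed
  show thesis
    by (rule that[of \<psi> U]) (use t \<psi>1 \<psi>_le S in \<open>auto simp: U_def\<close>)
qed

text \<open>As \<open>n\<close> grows, \<open>flat 0 (Suc n * t)\<close> tends to 1 for t > 0 and
  stays 0 otherwise; one such factor for each of the four sides produces the open box. The uniform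
  bound is for dominated convergence.\<close>

lemma box_smooth_approx:
  fixes a b :: "real^2"
  obtains \<beta> :: "nat \<Rightarrow> real^2 \<Rightarrow> complex" where "\<And>n. smooth (\<beta> n)"
    "\<And>x. (\<lambda>n. \<beta> n x) \<longlonglongrightarrow> indicator (box a b) x" "\<And>n x. cmod (\<beta> n x) \<le> 1"
proof
  define \<beta> where "\<beta> n x = (\<Prod>i\<in>UNIV. complex_of_real (flat 0 (Suc n * (x $ i - a $ i))) * complex_of_real (flat 0 (Suc n * (b $ i - x $ i))))" 
    for n and x :: "real^2"
  show "smooth (\<beta> n)" for n
    unfolding \<beta>_def
    by (intro smooth_prod smooth_mult smooth_flat)
       (unfold of_real_mult of_real_diff, (intro smooth_mult smooth_diff smooth_const smooth_coord)+)
  have le1: "flat 0 t \<le> 1" for t by (auto simp: flat_def)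
  show "cmod (\<beta> n x) \<le> 1" for n x
    unfolding \<beta>_def prod_norm[symmetric] norm_mult
    by (intro prod_le_1) (auto simp: flat_nonneg le1 mult_le_one simp del: of_nat_Suc)
  have lim: "(\<lambda>n. flat 0 (Suc n * t)) \<longlonglongrightarrow> indicator {0<..} t" for t :: real
  proof (cases "t > 0")
    case True
    have "(\<lambda>n. 1 / (real (Suc n) * t)) \<longlonglongrightarrow> 0"
      using tendsto_mult_left_zero[OF LIMSEQ_inverse_real_of_nat, of "1/t"] by (simp add: field_simps)
    then have "(\<lambda>n. exp (- (1 / (real (Suc n) * t)))) \<longlonglongrightarrow> exp (- 0)"
      by (intro tendsto_intros)
    moreover have "flat 0 (real (Suc n) * t) = exp (- (1 / (real (Suc n) * t)))" for n
      using True by (simp add: flat_def del: of_nat_Suc)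
    ultimately show ?thesis using True by (simp del: of_nat_Suc)
  next
    case False
    then have "flat 0 (Suc n * t) = 0" for n by (intro flat_eq_0) (simp add: mult_nonneg_nonpos)
    then show ?thesis using False by simp
  qed
  show "(\<lambda>n. \<beta> n x) \<longlonglongrightarrow> indicator (box a b) x" for x
  proof -
    have "(\<lambda>n. \<beta> n x) \<longlonglongrightarrow> (\<Prod>i\<in>UNIV. complex_of_real (indicator {0<..} (x $ i - a $ i)) * complex_of_real (indicator {0<..} (b $ i - x $ i)))"
      unfolding \<beta>_def UNIV_2 by (simp del: of_nat_Suc) (intro tendsto_mult tendsto_of_real lim)
    moreover have "(\<Prod>i\<in>UNIV. complex_of_real (indicator {0<..} (x $ i - a $ i)) * complex_of_real (indicator {0<..} (b $ i - x $ i))) = indicator (box a b) x"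
      by (simp add: indicator_def mem_box_cart UNIV_2 forall_2)
    ultimately show ?thesis by simp
  qed
qed

section \<open>Linear coordinates\<close>

definition cross2 :: "real^2 \<Rightarrow> real^2 \<Rightarrow> real" where
  "cross2 v w = v $ 1 * w $ 2 - v $ 2 * w $ 1"

text \<open>The two measures agree on boxes. The product form opens the way to Fubini's theorem,
  which speaks of pairs and not of vectors.\<close>

lemma lborel_axes:
  "(lborel :: (real^2) measure) = distr (lborel \<Otimes>\<^sub>M lborel) borel (\<lambda>(s, t). s *\<^sub>R axis 1 1 + t *\<^sub>R axis 2 1)"
proof (rule lborel_eqI)
  have T: "(\<lambda>(s, t). s *\<^sub>R axis 1 1 + t *\<^sub>R axis 2 1 :: real^2) \<in> borel_measurable borel"
    by (intro borel_measurable_continuous_onI) (auto simp: case_prod_beta intro!: continuous_intros)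
  fix l u :: "real^2" assume le: "\<And>b. b \<in> Basis \<Longrightarrow> l \<bullet> b \<le> u \<bullet> b"
  have le': "l $ i \<le> u $ i" for i using le[of "axis i 1"] by (simp add: inner_axis)
  have eq: "(\<lambda>(s, t). s *\<^sub>R axis 1 1 + t *\<^sub>R axis 2 1) -` box l u = {l$1<..<u$1} \<times> {l$2<..<u$2}"
    by (auto simp: mem_box_cart forall_2 axis_def)
  have B: "(\<Prod>b\<in>Basis. (u - l) \<bullet> b) = (u $ 1 - l $ 1) * (u $ 2 - l $ 2)"
  proof -
    have Bs: "(Basis :: (real^2) set) = {axis 1 1, axis 2 1}"
      by (auto simp: Basis_vec_def) (metis exhaust_2)
    have "axis 1 (1::real) \<noteq> (axis 2 1 :: real^2)" by (simp add: axis_eq_axis)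
    then show ?thesis unfolding Bs by (simp add: inner_axis)
  qed
  show "emeasure (distr (lborel \<Otimes>\<^sub>M lborel) borel (\<lambda>(s, t). s *\<^sub>R axis 1 1 + t *\<^sub>R axis 2 1)) (box l u) = (\<Prod>b\<in>Basis. (u - l) \<bullet> b)"
    unfolding B lborel_prod using T le'
    by (simp add: emeasure_distr eq lborel_prod[symmetric] lborel.emeasure_pair_measure_Times ennreal_mult)
qed simp

text \<open>Lebesgue measure is determined by its values on boxes. There the claim is the
  determinant formula for the linear map with columns \<open>v\<close> and \<open>w\<close>, applied
  to the preimage of the box.\<close>

lemma lborel_linear_coordinates:
  fixes v w :: "real^2"
  assumes J: "cross2 v w \<noteq> 0"
  shows "lborel = density (distr (lborel \<Otimes>\<^sub>M lborel) borel (\<lambda>(s, t). s *\<^sub>R v + t *\<^sub>R w)) (\<lambda>_. ennreal \<bar>cross2 v w\<bar>)"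
proof -
  define A where "A x = x $ 1 *\<^sub>R v + x $ 2 *\<^sub>R w" for x :: "real^2"
  have lin: "linear A" unfolding A_def by (auto intro!: linearI simp: algebra_simps)
  have A: "A \<in> borel_measurable borel" unfolding A_def
    by (intro borel_measurable_continuous_onI continuous_intros)
  have det: "det (matrix A) = cross2 v w"
    by (simp add: matrix_def A_def axis_def det_2 cross2_def)
  have inj: "inj A"
    using det J lin by (metis det_nz_iff_inj)
  have "lborel = density (distr lborel borel A) (\<lambda>_. ennreal \<bar>cross2 v w\<bar>)"
  proof (rule lborel_eqI)
    fix l u :: "real^2" assume le: "\<And>b. b \<in> Basis \<Longrightarrow> l \<bullet> b \<le> u \<bullet> b"
    let ?S = "A -` box l u"
    have surj: "surj A" using inj lin linear_injective_imp_surjective by blast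
    obtain B where B: "B > 0" "\<And>x. B * norm x \<le> norm (A x)"
      using linear_inj_bounded_below_pos[OF lin inj] by blast
    obtain K where K: "\<And>x. x \<in> box l u \<Longrightarrow> norm x \<le> K" using bounded_box[of l u] bounded_iff by metis
    have "norm x \<le> K / B" if "x \<in> ?S" for x
      using B(2)[of x] K[of "A x"] that B(1) by (simp add: field_simps)
    then have "bounded ?S" using bounded_iff by blast
    moreover have op: "open ?S"
      using lin by (intro open_vimage linear_continuous_on linear_conv_bounded_linear[THEN iffD1]) auto
    ultimately have lm: "?S \<in> lmeasurable" by (rule lmeasurable_open)
    have "emeasure (density (distr lborel borel A) (\<lambda>_. ennreal \<bar>cross2 v w\<bar>)) (box l u)
       = ennreal \<bar>cross2 v w\<bar> * emeasure lborel ?S"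
      using A by (simp add: emeasure_density nn_integral_cmult emeasure_distr)
    also have "emeasure lborel ?S = emeasure lebesgue ?S" using op by simp
    also have "\<dots> = ennreal (measure lebesgue ?S)" using lm by (simp add: emeasure_eq_measure2)
    also have "ennreal \<bar>cross2 v w\<bar> * \<dots> = ennreal (measure lebesgue (A ` ?S))"
      unfolding measure_linear_image[OF lin lm] det by (simp add: ennreal_mult)
    also have "A ` ?S = box l u" using surj by (simp add: surj_image_vimage_eq)
    also have "ennreal (measure lebesgue (box l u)) = emeasure lborel (box l u)"
      using emeasure_eq_measure2[of "box l u" lebesgue] by simp
    also have "\<dots> = (\<Prod>b\<in>Basis. (u - l) \<bullet> b)" using le by simp
    finally show "emeasure (density (distr lborel borel A) (\<lambda>_. ennreal \<bar>cross2 v w\<bar>)) (box l u) = (\<Prod>b\<in>Basis. (u - l) \<bullet> b)" .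
  qed simp
  also have "distr lborel borel A = distr (lborel \<Otimes>\<^sub>M lborel) borel (\<lambda>(s, t). s *\<^sub>R v + t *\<^sub>R w)"
  proof -
    have T: "(\<lambda>(s, t). s *\<^sub>R axis 1 1 + t *\<^sub>R axis 2 1 :: real^2) \<in> borel_measurable (lborel \<Otimes>\<^sub>M lborel)"
      unfolding lborel_prod measurable_lborel2
      by (intro borel_measurable_continuous_onI) (auto simp: case_prod_beta intro!: continuous_intros)
    have "A \<circ> (\<lambda>(s, t). s *\<^sub>R axis 1 1 + t *\<^sub>R axis 2 1) = (\<lambda>(s, t). s *\<^sub>R v + t *\<^sub>R w)"
      by (auto simp: A_def axis_def fun_eq_iff)
    then show ?thesis
      by (subst lborel_axes, subst distr_distr[OF A T]) simp
  qed
  finally show ?thesis .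
qed

text \<open>Fubini's theorem in oblique coordinates. It serves along lines transversal to a boundary
  graph and along the two edges of a corner.\<close>

lemma integrable_linear_coordinates:
  fixes F :: "real^2 \<Rightarrow> 'b :: {banach, second_countable_topology}"
  assumes "cross2 v w \<noteq> 0" and F: "integrable lborel F"
  shows "integrable (lborel \<Otimes>\<^sub>M lborel) (\<lambda>(s, t). F (s *\<^sub>R v + t *\<^sub>R w))"
    and "(\<integral>x. F x \<partial>lborel) = \<bar>cross2 v w\<bar> *\<^sub>R (\<integral>s. \<integral>t. F (s *\<^sub>R v + t *\<^sub>R w) \<partial>lborel \<partial>lborel)"
proof -
  have [measurable]: "F \<in> borel_measurable borel" using F by simp
  let ?T = "\<lambda>(s, t). s *\<^sub>R v + t *\<^sub>R w"
  have T: "?T \<in> borel_measurable (lborel \<Otimes>\<^sub>M lborel)" by measurable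
  have "integrable (density (distr (lborel \<Otimes>\<^sub>M lborel) borel ?T) (\<lambda>_. ennreal \<bar>cross2 v w\<bar>)) F"
    using F lborel_linear_coordinates[OF assms(1)] by metis
  then have "integrable (distr (lborel \<Otimes>\<^sub>M lborel) borel ?T) (\<lambda>x. \<bar>cross2 v w\<bar> *\<^sub>R F x)"
    by (subst (asm) integrable_density) auto
  then have "integrable (distr (lborel \<Otimes>\<^sub>M lborel) borel ?T) (\<lambda>x. (1 / \<bar>cross2 v w\<bar>) *\<^sub>R (\<bar>cross2 v w\<bar> *\<^sub>R F x))"
    by (rule integrable_scaleR_right)
  then have "integrable (distr (lborel \<Otimes>\<^sub>M lborel) borel ?T) F" using assms(1) by simp
  then show int: "integrable (lborel \<Otimes>\<^sub>M lborel) (\<lambda>(s, t). F (s *\<^sub>R v + t *\<^sub>R w))"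
    by (subst (asm) integrable_distr_eq[OF T]) (simp_all add: case_prod_unfold)
  have "(\<integral>x. F x \<partial>lborel) = (\<integral>x. F x \<partial>density (distr (lborel \<Otimes>\<^sub>M lborel) borel ?T) (\<lambda>_. ennreal \<bar>cross2 v w\<bar>))"
    using lborel_linear_coordinates[OF assms(1)] by metis
  also have "\<dots> = (\<integral>x. \<bar>cross2 v w\<bar> *\<^sub>R F x \<partial>distr (lborel \<Otimes>\<^sub>M lborel) borel ?T)"
    by (rule integral_density) auto
  also have "\<dots> = \<bar>cross2 v w\<bar> *\<^sub>R (\<integral>x. F x \<partial>distr (lborel \<Otimes>\<^sub>M lborel) borel ?T)" by simp
  also have "(\<integral>x. F x \<partial>distr (lborel \<Otimes>\<^sub>M lborel) borel ?T) = (\<integral>z. F (?T z) \<partial>(lborel \<Otimes>\<^sub>M lborel))"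
    by (rule integral_distr[OF T]) simp
  also have "\<dots> = (\<integral>s. \<integral>t. F (s *\<^sub>R v + t *\<^sub>R w) \<partial>lborel \<partial>lborel)"
    using lborel_pair.integral_fst'[OF int] by (simp add: case_prod_unfold)
  finally show "(\<integral>x. F x \<partial>lborel) = \<bar>cross2 v w\<bar> *\<^sub>R (\<integral>s. \<integral>t. F (s *\<^sub>R v + t *\<^sub>R w) \<partial>lborel \<partial>lborel)" .
qed

section \<open>Directional derivatives integrated over epigraphs\<close>

definition dirderiv :: "real^2 \<Rightarrow> (real^2 \<Rightarrow> complex) \<Rightarrow> real^2 \<Rightarrow> complex" where
  "dirderiv v f x = (\<Sum>i\<in>UNIV. complex_of_real (v $ i) * pderiv2 i f x)"

lemma dirderiv_eq:
  assumes "(f has_derivative f') (at x)"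
  shows "dirderiv v f x = f' v"
proof -
  have lin: "linear f'" using assms has_derivative_linear by blast
  have v: "v = (\<Sum>i\<in>UNIV. v $ i *\<^sub>R axis i 1)"
    using basis_expansion[of v] by (simp add: scalar_mult_eq_scaleR)
  have "f' v = (\<Sum>i\<in>UNIV. v $ i *\<^sub>R f' (axis i 1))"
    by (subst v) (simp add: linear_sum[OF lin] linear_cmul[OF lin])
  then show ?thesis
    unfolding dirderiv_def using pderiv2_eqI[OF assms] by (simp add: scaleR_conv_of_real)
qed

lemma vector_derivative_along_line:
  assumes "C_k 1 f"
  shows "((\<lambda>t. f (p + t *\<^sub>R v)) has_vector_derivative dirderiv v f (p + t *\<^sub>R v)) (at t within A)"
proof -
  obtain f' where f': "(f has_derivative f') (at (p + t *\<^sub>R v))"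
    using C1_differentiable[OF assms] unfolding differentiable_def by blast
  have "((\<lambda>t. p + t *\<^sub>R v) has_derivative (\<lambda>h. h *\<^sub>R v)) (at t within A)"
    by (auto intro!: derivative_eq_intros)
  from has_derivative_compose[OF this f']
  have "((\<lambda>t. f (p + t *\<^sub>R v)) has_derivative (\<lambda>h. f' (h *\<^sub>R v))) (at t within A)" .
  then show ?thesis
    unfolding has_vector_derivative_def dirderiv_eq[OF f']
    using linear_cmul[OF has_derivative_linear[OF f']] by simp
qed

lemma continuous_dirderiv: "C_k 1 f \<Longrightarrow> continuous_on UNIV (dirderiv v f)"
  unfolding dirderiv_def by (intro continuous_intros C1_continuous_pderiv2)

lemma dirderiv_eq_0_outside: "x \<notin> closure {x. f x \<noteq> 0} \<Longrightarrow> dirderiv v f x = 0"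
  by (simp add: dirderiv_def pderiv2_eq_0_outside)

lemma integrable_continuous_compact_support:
  fixes F :: "real^2 \<Rightarrow> complex"
  assumes F: "continuous_on UNIV F" and "compact K" "\<And>x. x \<notin> K \<Longrightarrow> F x = 0" "A \<in> sets borel"
  shows "integrable lborel (\<lambda>x. indicator A x *\<^sub>R F x)"
proof -
  have "integrable lborel (\<lambda>x. indicator K x *\<^sub>R F x)"
    by (rule borel_integrable_compact) (use assms continuous_on_subset[OF F] in auto)
  moreover have "(\<lambda>x. indicator K x *\<^sub>R F x) = F" using assms(3) by (force simp: indicator_def)
  ultimately have "integrable lborel F" by simp
  then show ?thesis using assms by (intro integrable_mult_indicator) auto
qed

text \<open>The fundamental theorem of calculus on a segment whose far end has left the
  support.\<close>

lemma integral_dirderiv_halfline: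
  assumes f: "C_k 1 f" and R: "\<And>x. f x \<noteq> 0 \<Longrightarrow> norm x \<le> R" and v: "v \<noteq> 0"
  shows "(\<integral>t. indicator {\<sigma><..} t *\<^sub>R dirderiv v f (p + t *\<^sub>R v) \<partial>lborel) = - f (p + \<sigma> *\<^sub>R v)"
proof -
  \<comment> \<open>For \<open>t\<close> beyond \<open>b\<close>, the norm of p + t v is at least t
    |v| - |p| \<ge> R + 1.\<close>
  define b where "b = max \<sigma> ((R + norm p + 1) / norm v)"
  have far: "p + t *\<^sub>R v \<notin> cball 0 R" if "t \<ge> b" for t
  proof -
    have "R + norm p + 1 \<le> t * norm v" using that v by (simp add: b_def field_simps)
    also have "\<dots> \<le> norm (t *\<^sub>R v)" by (simp add: mult_right_mono)
    also have "\<dots> \<le> norm (p + t *\<^sub>R v) + norm p" by (metis add.commute add_diff_cancel_left' norm_triangle_ineq4)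
    finally show ?thesis by simp
  qed
  have cl: "closure {x. f x \<noteq> 0} \<subseteq> cball 0 R" by (rule closure_minimal) (use R in auto)
  have "(\<integral>t. indicator {\<sigma><..} t *\<^sub>R dirderiv v f (p + t *\<^sub>R v) \<partial>lborel)
      = (\<integral>t. indicator {\<sigma>..b} t *\<^sub>R dirderiv v f (p + t *\<^sub>R v) \<partial>lborel)"
  proof (rule integral_cong_AE)
    have "AE t in lborel. t \<noteq> \<sigma>" by (rule AE_lborel_singleton)
    then show "AE t in lborel. indicator {\<sigma><..} t *\<^sub>R dirderiv v f (p + t *\<^sub>R v) = indicator {\<sigma>..b} t *\<^sub>R dirderiv v f (p + t *\<^sub>R v)"
    proof eventually_elim
      case (elim t)
      show ?case
      proof (cases "t \<le> b")
        case False
        then have "dirderiv v f (p + t *\<^sub>R v) = 0" using far[of t] cl by (intro dirderiv_eq_0_outside) auto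
        then show ?thesis by simp
      qed (use elim in \<open>auto simp: indicator_def\<close>)
    qed
  qed (use continuous_dirderiv[OF f, of v] in \<open>auto intro!: borel_measurable_scaleR borel_measurable_indicator borel_measurable_continuous_onI[of "\<lambda>t. dirderiv v f (p + t *\<^sub>R v)"] continuous_on_compose2[of UNIV "dirderiv v f"] continuous_intros\<close>)
  also have "\<dots> = f (p + b *\<^sub>R v) - f (p + \<sigma> *\<^sub>R v)"
    by (rule integral_FTC_Icc)
      (auto simp: b_def intro!: vector_derivative_along_line[OF f] continuous_on_compose2[OF continuous_dirderiv[OF f]] continuous_intros)
  also have "f (p + b *\<^sub>R v) = 0" using R far[of b] by force
  finally show ?thesis by simp
qed

text \<open>Every line parallel to \<open>v\<close> meets \<open>E\<close> in a half-line, on which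
  the derivative integrates to minus the value at the starting point; Fubini's theorem collects
  these values.\<close>

lemma integral_dirderiv_epigraph:
  assumes f: "C_k 1 f" and K: "compact (closure {x. f x \<noteq> 0})"
    and J: "cross2 e v \<noteq> 0" and E: "E \<in> sets borel" "\<And>s t. s *\<^sub>R e + t *\<^sub>R v \<in> E \<longleftrightarrow> \<sigma> s < t"
  shows "(\<integral>x. indicator E x *\<^sub>R dirderiv v f x \<partial>lborel) = - (\<bar>cross2 e v\<bar> *\<^sub>R (\<integral>s. f (s *\<^sub>R e + \<sigma> s *\<^sub>R v) \<partial>lborel))"
proof -
  have v: "v \<noteq> 0" using J by (auto simp: cross2_def)
  obtain R where R: "\<And>x. f x \<noteq> 0 \<Longrightarrow> norm x \<le> R"
    using K closure_subset[of "{x. f x \<noteq> 0}"] unfolding compact_eq_bounded_closed bounded_iff by blast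
  have int: "integrable lborel (\<lambda>x. indicator E x *\<^sub>R dirderiv v f x)"
    using K by (rule integrable_continuous_compact_support[OF continuous_dirderiv[OF f]])
      (use E dirderiv_eq_0_outside in auto)
  have "indicator E (s *\<^sub>R e + t *\<^sub>R v) = (indicator {\<sigma> s<..} t :: real)" for s t
    using E(2) by (simp add: indicator_def)
  then show ?thesis
    unfolding integrable_linear_coordinates(2)[OF J int]
    by (simp add: integral_dirderiv_halfline[OF f R v])
qed

text \<open>A half-plane that contains the support is an epigraph over the constant -R - 1, and
  \<open>f\<close> vanishes on its bounding line.\<close>

lemma integral_pderiv2_compact_support:
  assumes f: "C_k 1 f" and K: "compact (closure {x. f x \<noteq> 0})"
  shows "(\<integral>x. pderiv2 i f x \<partial>lborel) = 0"
proof -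
  define e v :: "real^2" where "e = axis (if i = 1 then 2 else 1) 1" and "v = axis i 1"
  have J: "cross2 e v \<noteq> 0" using exhaust_2[of i] by (auto simp: e_def v_def cross2_def axis_def)
  obtain R where R: "\<And>x. x \<in> closure {x. f x \<noteq> 0} \<Longrightarrow> norm x \<le> R"
    using K unfolding compact_eq_bounded_closed bounded_iff by blast
  have ei: "(s *\<^sub>R e + t *\<^sub>R v) $ i = t" for s t
    using exhaust_2[of i] by (auto simp: e_def v_def axis_def)
  define E where "E = {x :: real^2. - R - 1 < x $ i}"
  have "open E" unfolding E_def by (intro open_Collect_less continuous_intros)
  then have "(\<integral>x. indicator E x *\<^sub>R dirderiv v f x \<partial>lborel)
     = - (\<bar>cross2 e v\<bar> *\<^sub>R (\<integral>s. f (s *\<^sub>R e + (- R - 1) *\<^sub>R v) \<partial>lborel))"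
    by (intro integral_dirderiv_epigraph[OF f K J]) (simp, unfold E_def mem_Collect_eq ei, rule refl)
  also have "(\<integral>s. f (s *\<^sub>R e + (- R - 1) *\<^sub>R v) \<partial>lborel) = 0"
  proof -
    have "f (s *\<^sub>R e + (- R - 1) *\<^sub>R v) = 0" for s
    proof (rule ccontr)
      assume "\<not> ?thesis"
      then have "s *\<^sub>R e + (- R - 1) *\<^sub>R v \<in> closure {x. f x \<noteq> 0}" using closure_subset[of "{x. f x \<noteq> 0}"] by auto
      then have n: "norm (s *\<^sub>R e + (- R - 1) *\<^sub>R v) \<le> R" by (rule R)
      then have "R \<ge> 0" using norm_ge_zero[of "s *\<^sub>R e + (- R - 1) *\<^sub>R v"] by linarith
      moreover have "\<bar>- R - 1\<bar> \<le> R" using n component_le_norm_cart[of "s *\<^sub>R e + (- R - 1) *\<^sub>R v" i] unfolding ei by linarith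
      ultimately show False by linarith
    qed
    then show ?thesis by simp
  qed
  also have "(\<lambda>x. indicator E x *\<^sub>R dirderiv v f x) = pderiv2 i f"
  proof
    fix x
    have dv: "dirderiv v f x = pderiv2 i f x"
      using exhaust_2[of i] by (auto simp: dirderiv_def v_def sum_2 axis_def)
    show "indicator E x *\<^sub>R dirderiv v f x = pderiv2 i f x"
    proof (cases "x \<in> E")
      case False
      then have "R < \<bar>x $ i\<bar>" by (auto simp: E_def)
      then have "\<not> norm x \<le> R" using component_le_norm_cart[of x i] by linarith
      then have "x \<notin> closure {x. f x \<noteq> 0}" using R by blast
      then show ?thesis using False by (simp add: pderiv2_eq_0_outside)
    qed (simp add: dv)
  qed
  finally show ?thesis by simp
qed

section \<open>A trace inequality on Lipschitz domains\<close>

text \<open>Lagrange's identity gives the determinant: the square of \<open>cross2 e n\<close> is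
  |e|^2 |n|^2 - (e . n)^2 = 1. By Cramer's rule a vector orthogonal to \<open>e\<close> and
  \<open>n\<close> is then 0, which yields the expansion.\<close>

lemma orthonormal_expansion_2:
  fixes e n x :: "real^2"
  assumes "norm e = 1" "norm n = 1" "e \<bullet> n = 0"
  shows "x = (x \<bullet> e) *\<^sub>R e + (x \<bullet> n) *\<^sub>R n" and "\<bar>cross2 e n\<bar> = 1"
proof -
  have e: "e $ 1 * e $ 1 + e $ 2 * e $ 2 = 1" and n: "n $ 1 * n $ 1 + n $ 2 * n $ 2 = 1"
    and en: "e $ 1 * n $ 1 + e $ 2 * n $ 2 = 0"
    using assms by (simp_all add: norm_eq_1 inner_vec_def sum_2)
  have sq: "(cross2 e n)\<^sup>2 = 1"
  proof -
    have "(cross2 e n)\<^sup>2 = (e $ 1 * e $ 1 + e $ 2 * e $ 2) * (n $ 1 * n $ 1 + n $ 2 * n $ 2) - (e $ 1 * n $ 1 + e $ 2 * n $ 2)\<^sup>2"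
      by (simp add: cross2_def power2_eq_square algebra_simps)
    then show ?thesis by (simp add: e n en)
  qed
  then show c: "\<bar>cross2 e n\<bar> = 1" by (auto simp: power2_eq_1_iff)
  define y where "y = x - ((x \<bullet> e) *\<^sub>R e + (x \<bullet> n) *\<^sub>R n)"
  have ye: "y \<bullet> e = 0" and yn: "y \<bullet> n = 0"
    using assms inner_commute[of e n] by (simp_all add: y_def inner_diff_left inner_add_left norm_eq_1)
  have "y $ 1 * cross2 e n = (y \<bullet> e) * n $ 2 - (y \<bullet> n) * e $ 2" "y $ 2 * cross2 e n = (y \<bullet> n) * e $ 1 - (y \<bullet> e) * n $ 1"
    by (simp_all add: cross2_def inner_vec_def sum_2 algebra_simps)
  then have "y = 0" using ye yn sq by (auto simp: vec_eq_iff forall_2)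
  then show "x = (x \<bullet> e) *\<^sub>R e + (x \<bullet> n) *\<^sub>R n" by (simp add: y_def)
qed

text \<open>By the bound on \<epsilon>, the map from t to \<gamma> (s + \<epsilon> t) has Lipschitz
  constant 1/2, so t - \<gamma> (s + \<epsilon> t) increases strictly and has exactly one zero
  \<sigma> s. The region above the graph is thus an epigraph in the tilted direction as
  well.\<close>

lemma lipschitz_graph_transversal:
  fixes \<gamma> :: "real \<Rightarrow> real"
  assumes \<gamma>: "L-lipschitz_on UNIV \<gamma>" and \<epsilon>: "\<bar>\<epsilon>\<bar> * L \<le> 1/2"
  obtains \<sigma> where "\<And>s t. \<sigma> s < t \<longleftrightarrow> \<gamma> (s + \<epsilon> * t) < t" "\<And>s. \<gamma> (s + \<epsilon> * \<sigma> s) = \<sigma> s" "continuous_on UNIV \<sigma>"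
proof -
  have L: "L \<ge> 0" using \<gamma> lipschitz_on_nonneg by blast
  have lip: "\<bar>\<gamma> x - \<gamma> y\<bar> \<le> L * \<bar>x - y\<bar>" for x y
    using \<gamma> by (auto simp: lipschitz_on_def dist_real_def)
  have half: "\<bar>\<gamma> (s + \<epsilon> * t) - \<gamma> (s + \<epsilon> * t')\<bar> \<le> \<bar>t - t'\<bar> / 2" for s t t'
  proof -
    have "\<bar>\<gamma> (s + \<epsilon> * t) - \<gamma> (s + \<epsilon> * t')\<bar> \<le> L * \<bar>(s + \<epsilon> * t) - (s + \<epsilon> * t')\<bar>" by (rule lip)
    also have "\<dots> = (\<bar>\<epsilon>\<bar> * L) * \<bar>t - t'\<bar>" by (simp add: right_diff_distrib[symmetric] abs_mult)
    also have "\<dots> \<le> (1/2) * \<bar>t - t'\<bar>" by (rule mult_right_mono[OF \<epsilon>]) simp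
    finally show ?thesis by simp
  qed
  have c\<gamma>: "continuous_on UNIV \<gamma>" using \<gamma> lipschitz_on_continuous_on by blast
  have "\<exists>t. \<gamma> (s + \<epsilon> * t) = t" for s
  proof -
    \<comment> \<open>Between 0 and \<open>M\<close> or \<open>-M\<close> the composed function
      changes by at most \<open>M / 2\<close>, that is by |\<gamma> s|, so the zero lies in this
      interval.\<close>
    define M where "M = 2 * \<bar>\<gamma> s\<bar>"
    have "\<gamma> (s + \<epsilon> * M) \<le> M" "- M \<le> \<gamma> (s + \<epsilon> * (-M))"
      using half[of s M 0] half[of s "-M" 0] by (auto simp: M_def)
    then have "\<exists>t. - M \<le> t \<and> t \<le> M \<and> t - \<gamma> (s + \<epsilon> * t) = 0"
      by (intro IVT') (auto simp: M_def intro!: continuous_intros continuous_on_compose2[OF c\<gamma>])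
    then show ?thesis by (metis eq_iff_diff_eq_0)
  qed
  then obtain \<sigma> where \<sigma>: "\<And>s. \<gamma> (s + \<epsilon> * \<sigma> s) = \<sigma> s" by metis
  have 1: "\<sigma> s < t \<longleftrightarrow> \<gamma> (s + \<epsilon> * t) < t" for s t
    using half[of s t "\<sigma> s"] \<sigma>[of s] by (auto simp: abs_if split: if_splits)
  have "\<bar>\<sigma> s - \<sigma> s'\<bar> \<le> 2 * L * \<bar>s - s'\<bar>" for s s'
    using half[of s "\<sigma> s" "\<sigma> s'"] lip[of "s + \<epsilon> * \<sigma> s'" "s' + \<epsilon> * \<sigma> s'"] unfolding \<sigma>
    by (simp add: abs_if split: if_splits)
  then have "(2 * L)-lipschitz_on UNIV \<sigma>" using L by (auto simp: lipschitz_on_def dist_real_def)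
  then have "continuous_on UNIV \<sigma>" by (rule lipschitz_on_continuous_on)
  with 1 \<sigma> that show thesis by blast
qed

text \<open>A point strictly below the graph has a neighbourhood that misses \<Omega>, while from a
  point on the graph a small step along \<open>n\<close> enters \<Omega>.\<close>

lemma frontier_of_epigraph:
  fixes \<Omega> :: "(real^2) set"
  assumes \<Omega>: "open \<Omega>" and \<gamma>: "continuous_on UNIV \<gamma>" and en: "norm e = 1" "norm n = 1" "e \<bullet> n = 0"
    and ep: "\<And>x. x \<in> ball p r \<Longrightarrow> x \<in> \<Omega> \<longleftrightarrow> \<gamma> (x \<bullet> e) < x \<bullet> n" and x: "x \<in> ball p r"
  shows "x \<in> frontier \<Omega> \<longleftrightarrow> \<gamma> (x \<bullet> e) = x \<bullet> n"
proof
  assume fr: "x \<in> frontier \<Omega>"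
  then have "x \<notin> \<Omega>" using \<Omega> by (simp add: frontier_def interior_open)
  moreover have "\<not> x \<bullet> n < \<gamma> (x \<bullet> e)"
  proof
    assume lt: "x \<bullet> n < \<gamma> (x \<bullet> e)"
    define U where "U = ball p r \<inter> {y. y \<bullet> n < \<gamma> (y \<bullet> e)}"
    have "open U" unfolding U_def
      by (intro open_Int open_ball open_Collect_less continuous_intros continuous_on_compose2[OF \<gamma>]) auto
    moreover have "x \<in> U" using x lt by (simp add: U_def)
    ultimately have "U \<inter> \<Omega> \<noteq> {}" using fr open_Int_closure_eq_empty[of U \<Omega>] by (auto simp: frontier_def)
    then show False using ep by (force simp: U_def)
  qed
  ultimately show "\<gamma> (x \<bullet> e) = x \<bullet> n" using ep[OF x] by linarith
next
  assume eq: "\<gamma> (x \<bullet> e) = x \<bullet> n"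
  then have "x \<notin> \<Omega>" using ep[OF x] by simp
  moreover have "x \<in> closure \<Omega>"
  proof -
    obtain d where d: "d > 0" "ball x d \<subseteq> ball p r" using x openE[OF open_ball] by metis
    show ?thesis unfolding closure_approachable
    proof (intro allI impI)
      fix \<delta> :: real assume "\<delta> > 0"
      define t where "t = min d \<delta> / 2"
      have t: "0 < t" "t < d" "t < \<delta>" using d \<open>\<delta> > 0\<close> by (auto simp: t_def)
      define y where "y = x + t *\<^sub>R n"
      have "dist y x = t" using t en by (simp add: y_def dist_norm)
      moreover have "y \<in> \<Omega>"
      proof -
        have "y \<in> ball x d" using t \<open>dist y x = t\<close> by (simp add: dist_commute)
        then have "y \<in> ball p r" using d(2) by blast
        moreover have "y \<bullet> e = x \<bullet> e" "y \<bullet> n = x \<bullet> n + t"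
          using en inner_commute[of e n] by (simp_all add: y_def inner_add_left norm_eq_1)
        ultimately show ?thesis using ep[of y] t eq by simp
      qed
      ultimately show "\<exists>y\<in>\<Omega>. dist y x < \<delta>" using t by auto
    qed
  qed
  ultimately show "x \<in> frontier \<Omega>" using \<Omega> by (simp add: frontier_def interior_open)
qed

section \<open>The local estimate at a boundary point\<close>

abbreviation boundary_L1 :: "(real^2) set \<Rightarrow> (real^2 \<Rightarrow> complex) \<Rightarrow> ennreal" where
  "boundary_L1 \<Omega> f \<equiv> \<integral>\<^sup>+x. ennreal (cmod (f x)) \<partial>arc_measure (frontier \<Omega>)"

abbreviation trace_bound_on :: "(real^2) set \<Rightarrow> (real^2) set \<Rightarrow> real \<Rightarrow> bool" where
  "trace_bound_on \<Omega> U C \<equiv> \<forall>f i. C_k 1 f \<longrightarrow> compact (closure {x. f x \<noteq> 0}) \<longrightarrow> closure {x. f x \<noteq> 0} \<subseteq> U \<longrightarrow>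
     ennreal (cmod (LINT x|lebesgue_on \<Omega>. pderiv2 i f x)) \<le> ennreal C * boundary_L1 \<Omega> f"

lemma nn_integral_arc_measure:
  assumes "closed \<Gamma>" "f \<in> borel_measurable borel"
  shows "(\<integral>\<^sup>+x. f x \<partial>arc_measure \<Gamma>) = (\<integral>\<^sup>+x. f x * indicator \<Gamma> x \<partial>hausdorff1)"
  unfolding arc_measure_def using assms
  by (subst nn_integral_restrict_space) (auto simp: mult.commute intro!: borel_closed)

lemma space_arc_measure: "space (arc_measure \<Gamma>) = \<Gamma>"
  by (simp add: arc_measure_def space_restrict_space)

lemma borel_measurable_arc_measure: "f \<in> borel_measurable borel \<Longrightarrow> f \<in> borel_measurable (arc_measure \<Gamma>)"
  unfolding arc_measure_def by (rule measurable_restrict_space1) simp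

text \<open>The preimage of a set under \<open>X\<close> is contained in its image under
  \<open>q\<close>, so its length is controlled by the Hausdorff measure of the set. This compares
  the image of Lebesgue measure with a multiple of \<open>hausdorff1\<close>, and hence all
  integrals.\<close>

lemma nn_integral_graph_le_hausdorff1:
  fixes X :: "real \<Rightarrow> real^2" and g :: "real^2 \<Rightarrow> ennreal"
  assumes X: "continuous_on UNIV X" and q: "K-lipschitz_on UNIV q" "\<And>s. q (X s) = s" and g: "g \<in> borel_measurable borel"
  shows "(\<integral>\<^sup>+s. g (X s) \<partial>lborel) \<le> ennreal (2 * K + 1) * (\<integral>\<^sup>+x. g x \<partial>hausdorff1)"
proof -
  have Xm: "X \<in> borel_measurable lborel" using X by (simp add: borel_measurable_continuous_onI)
  have "(\<integral>\<^sup>+s. g (X s) \<partial>lborel) = (\<integral>\<^sup>+x. g x \<partial>distr lborel hausdorff1 X)"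
    using Xm g by (subst nn_integral_distr) (auto cong: measurable_cong_sets)
  also have "\<dots> \<le> (\<integral>\<^sup>+x. g x \<partial>scale_measure (ennreal (2 * K + 1)) hausdorff1)"
  proof (rule nn_integral_mono_measure)
    show "distr lborel hausdorff1 X \<le> scale_measure (ennreal (2 * K + 1)) hausdorff1"
    proof (subst le_measure)
      show "\<forall>A\<in>sets (distr lborel hausdorff1 X). emeasure (distr lborel hausdorff1 X) A \<le> emeasure (scale_measure (ennreal (2 * K + 1)) hausdorff1) A"
      proof
        fix A assume "A \<in> sets (distr lborel hausdorff1 X)"
        then have A: "A \<in> sets borel" by simp
        have XA: "X -` A \<in> sets borel" using measurable_sets[OF Xm, of A] A by simp
        have "emeasure (distr lborel hausdorff1 X) A = emeasure lborel (X -` A)"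
          using A Xm by (subst emeasure_distr) (auto cong: measurable_cong_sets)
        also have "\<dots> \<le> ennreal (2 * K + 1) * hausdorff1_outer A"
          by (rule emeasure_projection_le_hausdorff1[OF q(1) XA]) (metis q(2) image_eqI subsetI vimageD)
        finally show "emeasure (distr lborel hausdorff1 X) A \<le> emeasure (scale_measure (ennreal (2 * K + 1)) hausdorff1) A"
          using A by (simp add: emeasure_hausdorff1)
      qed
    qed simp
  qed simp
  also have "\<dots> = ennreal (2 * K + 1) * (\<integral>\<^sup>+x. g x \<partial>hausdorff1)"
    using g by (intro nn_integral_scale_measure) (auto cong: measurable_cong_sets)
  finally show ?thesis .
qed

lemma integral_lebesgue_on_eq:
  fixes f :: "real^2 \<Rightarrow> complex"
  assumes "A \<in> sets borel" "f \<in> borel_measurable borel"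
  shows "(LINT x|lebesgue_on A. f x) = (\<integral>x. indicator A x *\<^sub>R f x \<partial>lborel)"
proof -
  have "(LINT x|lebesgue_on A. f x) = (LINT x|lebesgue. indicator A x *\<^sub>R f x)"
    using assms by (subst integral_restrict_space) auto
  also have "\<dots> = (\<integral>x. indicator A x *\<^sub>R f x \<partial>lborel)"
    using assms by (intro integral_completion) auto
  finally show ?thesis .
qed

text \<open>
  The domain is an epigraph along every direction transversal to the graph, so each such derivative integrates to
  boundary values line by line. Two of these directions span the plane, and no differentiability of \<open>\<gamma>\<close> is needed.
\<close>
lemma green_local_direction:
  fixes \<Omega> :: "(real^2) set"
  assumes \<Omega>: "open \<Omega>" and \<gamma>: "L-lipschitz_on UNIV \<gamma>" and en: "norm e = 1" "norm n = 1" "e \<bullet> n = 0"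
    and ep: "\<And>x. x \<in> ball p r \<Longrightarrow> x \<in> \<Omega> \<longleftrightarrow> \<gamma> (x \<bullet> e) < x \<bullet> n" and \<epsilon>: "\<bar>\<epsilon>\<bar> * L \<le> 1/2"
    and f: "C_k 1 f" and K: "compact (closure {x. f x \<noteq> 0})" "closure {x. f x \<noteq> 0} \<subseteq> ball p r"
  shows "ennreal (cmod (LINT x|lebesgue_on \<Omega>. dirderiv (n + \<epsilon> *\<^sub>R e) f x))
     \<le> ennreal (2 * (1 + \<bar>\<epsilon>\<bar>) + 1) * boundary_L1 \<Omega> f"
proof -
  define v where "v = n + \<epsilon> *\<^sub>R e"
  obtain \<sigma> where \<sigma>: "\<And>s t. \<sigma> s < t \<longleftrightarrow> \<gamma> (s + \<epsilon> * t) < t" "\<And>s. \<gamma> (s + \<epsilon> * \<sigma> s) = \<sigma> s" "continuous_on UNIV \<sigma>"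
    using lipschitz_graph_transversal[OF \<gamma> \<epsilon>] by blast
  have c\<gamma>: "continuous_on UNIV \<gamma>" using \<gamma> lipschitz_on_continuous_on by blast
  define X where "X s = s *\<^sub>R e + \<sigma> s *\<^sub>R v" for s
  have coord: "(s *\<^sub>R e + t *\<^sub>R v) \<bullet> e = s + \<epsilon> * t" "(s *\<^sub>R e + t *\<^sub>R v) \<bullet> n = t" for s t
    using en by (simp_all add: v_def inner_add_left inner_commute[of n e] norm_eq_1 algebra_simps)
  have "cross2 e v = cross2 e n" by (simp add: v_def cross2_def algebra_simps)
  then have J: "\<bar>cross2 e v\<bar> = 1" using orthonormal_expansion_2(2)[OF en] by simp
  define E where "E = {x. \<gamma> (x \<bullet> e) < x \<bullet> n}"
  have "open E" unfolding E_def
    by (intro open_Collect_less continuous_intros continuous_on_compose2[OF c\<gamma>]) auto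
  then have E: "E \<in> sets borel" by simp
  have mf: "f \<in> borel_measurable borel" using C1_continuous[OF f] by (rule borel_measurable_continuous_onI)
  have md: "dirderiv v f \<in> borel_measurable borel" using continuous_dirderiv[OF f] by (rule borel_measurable_continuous_onI)
  have "(LINT x|lebesgue_on \<Omega>. dirderiv v f x) = (\<integral>x. indicator \<Omega> x *\<^sub>R dirderiv v f x \<partial>lborel)"
    using \<Omega> md by (intro integral_lebesgue_on_eq) auto
  also have "(\<lambda>x. indicator \<Omega> x *\<^sub>R dirderiv v f x) = (\<lambda>x. indicator E x *\<^sub>R dirderiv v f x)"
  proof
    fix x show "indicator \<Omega> x *\<^sub>R dirderiv v f x = indicator E x *\<^sub>R dirderiv v f x"
    proof (cases "x \<in> ball p r")
      case True
      then show ?thesis using ep by (simp add: E_def indicator_def)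
    next
      case False
      then have "x \<notin> closure {x. f x \<noteq> 0}" using K(2) by blast
      then show ?thesis by (simp add: dirderiv_eq_0_outside)
    qed
  qed
  also have "(\<integral>x. indicator E x *\<^sub>R dirderiv v f x \<partial>lborel) = - (\<integral>s. f (X s) \<partial>lborel)"
    unfolding X_def using J coord \<sigma>(1) by (subst integral_dirderiv_epigraph[OF f K(1) _ E, of e v \<sigma>]) (auto simp: E_def)
  finally have "ennreal (cmod (LINT x|lebesgue_on \<Omega>. dirderiv v f x)) = ennreal (cmod (\<integral>s. f (X s) \<partial>lborel))" by simp
  \<comment> \<open>Without integrability the Bochner integral is 0 by convention, and the bound is
    trivial.\<close>
  also have "\<dots> \<le> (\<integral>\<^sup>+s. ennreal (cmod (f (X s))) \<partial>lborel)"
  proof (cases "integrable lborel (\<lambda>s. f (X s))")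
    case True then show ?thesis by (rule integral_norm_bound_ennreal)
  qed (simp add: not_integrable_integral_eq)
  \<comment> \<open>Where \<open>f (X s)\<close> is non-zero, \<open>X s\<close> lies in the ball
    and on the graph, hence on the frontier.\<close>
  also have "\<dots> = (\<integral>\<^sup>+s. ennreal (cmod (f (X s))) * indicator (frontier \<Omega>) (X s) \<partial>lborel)"
  proof (intro nn_integral_cong)
    fix s
    show "ennreal (cmod (f (X s))) = ennreal (cmod (f (X s))) * indicator (frontier \<Omega>) (X s)"
    proof (cases "f (X s) = 0")
      case False
      then have "X s \<in> closure {x. f x \<noteq> 0}" using closure_subset[of "{x. f x \<noteq> 0}"] by auto
      then have "X s \<in> ball p r" using K(2) by (rule subsetD[rotated])
      then have "X s \<in> frontier \<Omega>"
        using frontier_of_epigraph[OF \<Omega> c\<gamma> en ep] \<sigma>(2)[of s] coord[of s "\<sigma> s"] by (simp add: X_def)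
      then show ?thesis by simp
    qed simp
  qed
  also have "\<dots> \<le> ennreal (2 * (1 + \<bar>\<epsilon>\<bar>) + 1) * (\<integral>\<^sup>+x. ennreal (cmod (f x)) * indicator (frontier \<Omega>) x \<partial>hausdorff1)"
  proof (rule nn_integral_graph_le_hausdorff1)
    show "continuous_on UNIV X" unfolding X_def by (intro continuous_intros \<sigma>(3))
    \<comment> \<open>This linear functional recovers the parameter \<open>s\<close> from
      \<open>X s\<close>.\<close>
    show "(1 + \<bar>\<epsilon>\<bar>)-lipschitz_on UNIV (\<lambda>x. x \<bullet> e - \<epsilon> * (x \<bullet> n))"
    proof (rule lipschitz_onI)
      fix x y :: "real^2"
      have "\<bar>(x - y) \<bullet> e\<bar> \<le> norm (x - y)" "\<bar>(x - y) \<bullet> n\<bar> \<le> norm (x - y)"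
        using Cauchy_Schwarz_ineq2[of "x - y" e] Cauchy_Schwarz_ineq2[of "x - y" n] en by auto
      then have "\<bar>(x - y) \<bullet> e\<bar> + \<bar>\<epsilon>\<bar> * \<bar>(x - y) \<bullet> n\<bar> \<le> norm (x - y) + \<bar>\<epsilon>\<bar> * norm (x - y)"
        by (intro add_mono mult_left_mono) auto
      moreover have "\<bar>(x - y) \<bullet> e - \<epsilon> * ((x - y) \<bullet> n)\<bar> \<le> \<bar>(x - y) \<bullet> e\<bar> + \<bar>\<epsilon>\<bar> * \<bar>(x - y) \<bullet> n\<bar>"
        using abs_triangle_ineq4[of "(x - y) \<bullet> e" "\<epsilon> * ((x - y) \<bullet> n)"] by (simp add: abs_mult)
      ultimately show "dist (x \<bullet> e - \<epsilon> * (x \<bullet> n)) (y \<bullet> e - \<epsilon> * (y \<bullet> n)) \<le> (1 + \<bar>\<epsilon>\<bar>) * dist x y"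
        by (simp add: dist_norm inner_diff_left algebra_simps)
    qed simp
    show "X s \<bullet> e - \<epsilon> * (X s \<bullet> n) = s" for s unfolding X_def coord by simp
  qed (use mf in measurable)
  also have "(\<integral>\<^sup>+x. ennreal (cmod (f x)) * indicator (frontier \<Omega>) x \<partial>hausdorff1) = boundary_L1 \<Omega> f"
    using mf by (intro nn_integral_arc_measure[symmetric]) auto
  finally show ?thesis by (simp add: v_def)
qed


section \<open>From boundary patches to the whole boundary\<close>

lemma finite_measure_lebesgue_on:
  assumes "open A" "bounded A"
  shows "finite_measure (lebesgue_on A)"
  using lmeasurable_open[OF assms(2,1)]
  by (intro finite_measureI) (auto simp: emeasure_restrict_space fmeasurable_def)

lemma integrable_continuous_bounded:
  fixes f :: "real^2 \<Rightarrow> complex"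
  assumes f: "continuous_on UNIV f" and A: "open A" "bounded A"
  shows "integrable (lebesgue_on A) f"
proof -
  interpret finite_measure "lebesgue_on A" by (rule finite_measure_lebesgue_on[OF A])
  have "bounded (f ` closure A)"
    using A by (intro compact_imp_bounded compact_continuous_image continuous_on_subset[OF f]) auto
  then obtain B where B: "\<And>x. x \<in> closure A \<Longrightarrow> norm (f x) \<le> B" by (auto simp: bounded_iff)
  have "f \<in> borel_measurable (lebesgue_on A)"
    using f by (intro measurable_restrict_space1 measurable_completion) (simp add: borel_measurable_continuous_onI)
  then show ?thesis
    using A B closure_subset[of A] by (intro integrable_const_bound[of _ B] AE_I2) (auto simp: space_restrict_space)
qed

lemma dirderiv_add_scaleR:
  "dirderiv (a *\<^sub>R v + b *\<^sub>R w) f x = of_real a * dirderiv v f x + of_real b * dirderiv w f x"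
  by (simp add: dirderiv_def sum_2 algebra_simps)

lemma dirderiv_axis: "dirderiv (axis i 1) f x = pderiv2 i f x"
  using exhaust_2[of i] by (auto simp: dirderiv_def sum_2 axis_def)

lemma ennreal_lincomb:
  "a \<ge> 0 \<Longrightarrow> b \<ge> 0 \<Longrightarrow> x \<ge> 0 \<Longrightarrow> y \<ge> 0 \<Longrightarrow> ennreal (a * x + b * y) = ennreal a * ennreal x + ennreal b * ennreal y"
  by (simp add: ennreal_mult)

text \<open>A coordinate derivative is a fixed combination of the derivatives along n and n +
  \<epsilon> e, for both of which the estimate along lines is available. The boundary piece has
  finite length because it lies on the graph of \<gamma> over a bounded interval.\<close>

lemma green_local:
  fixes \<Omega> :: "(real^2) set"
  assumes \<Omega>: "lipschitz_domain \<Omega>" and p: "p \<in> frontier \<Omega>"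
  obtains r C where "r > 0" "C \<ge> 0" "\<And>f i. C_k 1 f \<Longrightarrow> compact (closure {x. f x \<noteq> 0}) \<Longrightarrow> closure {x. f x \<noteq> 0} \<subseteq> ball p r \<Longrightarrow>
     ennreal (cmod (LINT x|lebesgue_on \<Omega>. pderiv2 i f x)) \<le> ennreal C * boundary_L1 \<Omega> f"
    "hausdorff1_outer (frontier \<Omega> \<inter> ball p r) < \<infinity>"
proof -
  have op: "open \<Omega>" "bounded \<Omega>" using \<Omega> by (auto simp: lipschitz_domain_def)
  obtain e n \<gamma> L r where en: "norm e = 1" "norm n = 1" "e \<bullet> n = 0" and \<gamma>: "L-lipschitz_on UNIV (\<gamma> :: real \<Rightarrow> real)" and r: "r > 0"
    and ep: "\<And>x. x \<in> ball p r \<Longrightarrow> x \<in> \<Omega> \<longleftrightarrow> \<gamma> (x \<bullet> e) < x \<bullet> n"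
    using \<Omega> p unfolding lipschitz_domain_def by metis
  have L: "L \<ge> 0" using \<gamma> lipschitz_on_nonneg by blast
  have c\<gamma>: "continuous_on UNIV \<gamma>" using \<gamma> lipschitz_on_continuous_on by blast
  \<comment> \<open>Any positive number with \<epsilon> L \<le> 1/2 would do; the form with
    \<open>L + 1\<close> also covers L = 0.\<close>
  define \<epsilon> where "\<epsilon> = 1 / (2 * (L + 1))"
  have \<epsilon>: "\<epsilon> > 0" "\<bar>\<epsilon>\<bar> * L \<le> 1/2" using L by (auto simp: \<epsilon>_def field_simps)
  \<comment> \<open>The coefficients of the two directional derivatives are at most 1 + 1/\<epsilon>
    and 1/\<epsilon> in absolute value; 3 and 2 (1 + \<epsilon>) + 1 are the constants for the tilts
    0 and \<epsilon>.\<close>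
  define C where "C = (1 + 1/\<epsilon>) * 3 + (1/\<epsilon>) * (2 * (1 + \<epsilon>) + 1)"
  have bound: "ennreal (cmod (LINT x|lebesgue_on \<Omega>. pderiv2 i f x)) \<le> ennreal C * boundary_L1 \<Omega> f"
    if f: "C_k 1 f" and K: "compact (closure {x. f x \<noteq> 0})" "closure {x. f x \<noteq> 0} \<subseteq> ball p r" for f i
  proof -
    let ?B = "\<integral>\<^sup>+x. ennreal (cmod (f x)) \<partial>arc_measure (frontier \<Omega>)"
    define v where "v = n + \<epsilon> *\<^sub>R e"
    define a b where "a = axis i 1 \<bullet> e" and "b = axis i 1 \<bullet> n"
    have ab: "\<bar>a\<bar> \<le> 1" "\<bar>b\<bar> \<le> 1"
      using Cauchy_Schwarz_ineq2[of "axis i 1" e] Cauchy_Schwarz_ineq2[of "axis i 1" n] en by (auto simp: a_def b_def)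
    have "axis i 1 = a *\<^sub>R e + b *\<^sub>R n" unfolding a_def b_def by (rule orthonormal_expansion_2(1)[OF en])
    also have "\<dots> = (b - a/\<epsilon>) *\<^sub>R n + (a/\<epsilon>) *\<^sub>R v" using \<epsilon> by (simp add: v_def algebra_simps)
    finally have ax: "pderiv2 i f x = of_real (b - a/\<epsilon>) * dirderiv n f x + of_real (a/\<epsilon>) * dirderiv v f x" for x
      by (metis dirderiv_add_scaleR dirderiv_axis)
    define I1 I2 where "I1 = (LINT x|lebesgue_on \<Omega>. dirderiv n f x)" and "I2 = (LINT x|lebesgue_on \<Omega>. dirderiv v f x)"
    have int: "integrable (lebesgue_on \<Omega>) (dirderiv u f)" for u
      using op by (intro integrable_continuous_bounded continuous_dirderiv f)
    have I1: "ennreal (cmod I1) \<le> ennreal 3 * ?B"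
      using green_local_direction[OF op(1) \<gamma> en ep _ f K, of 0] by (simp add: I1_def)
    have I2: "ennreal (cmod I2) \<le> ennreal (2 * (1 + \<epsilon>) + 1) * ?B"
      using green_local_direction[OF op(1) \<gamma> en ep \<epsilon>(2) f K] \<epsilon> by (simp add: I2_def v_def)
    have "(LINT x|lebesgue_on \<Omega>. pderiv2 i f x) = of_real (b - a/\<epsilon>) * I1 + of_real (a/\<epsilon>) * I2"
      unfolding ax I1_def I2_def using int by (subst Bochner_Integration.integral_add) auto
    then have "cmod (LINT x|lebesgue_on \<Omega>. pderiv2 i f x) \<le> \<bar>b - a/\<epsilon>\<bar> * cmod I1 + \<bar>a/\<epsilon>\<bar> * cmod I2"
      using norm_triangle_ineq[of "of_real (b - a/\<epsilon>) * I1" "of_real (a/\<epsilon>) * I2"]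
      by (simp only: norm_mult norm_of_real)
    also have "\<dots> \<le> (1 + 1/\<epsilon>) * cmod I1 + (1/\<epsilon>) * cmod I2"
    proof (intro add_mono mult_right_mono)
      show "\<bar>a/\<epsilon>\<bar> \<le> 1/\<epsilon>" using ab \<epsilon> by (simp add: abs_divide divide_right_mono)
      then show "\<bar>b - a/\<epsilon>\<bar> \<le> 1 + 1/\<epsilon>" using ab abs_triangle_ineq4[of b "a/\<epsilon>"] by linarith
    qed auto
    finally have "ennreal (cmod (LINT x|lebesgue_on \<Omega>. pderiv2 i f x)) \<le> ennreal ((1 + 1/\<epsilon>) * cmod I1 + (1/\<epsilon>) * cmod I2)"
      by (rule ennreal_leI)
    also have "\<dots> = ennreal (1 + 1/\<epsilon>) * ennreal (cmod I1) + ennreal (1/\<epsilon>) * ennreal (cmod I2)"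
      using \<epsilon>(1) by (intro ennreal_lincomb) auto
    also have "\<dots> \<le> ennreal (1 + 1/\<epsilon>) * (ennreal 3 * ?B) + ennreal (1/\<epsilon>) * (ennreal (2 * (1 + \<epsilon>) + 1) * ?B)"
      by (intro add_mono mult_left_mono I1 I2) auto
    also have "\<dots> = (ennreal (1 + 1/\<epsilon>) * ennreal 3 + ennreal (1/\<epsilon>) * ennreal (2 * (1 + \<epsilon>) + 1)) * ?B"
      by (simp only: distrib_right mult.assoc)
    also have "ennreal (1 + 1/\<epsilon>) * ennreal 3 + ennreal (1/\<epsilon>) * ennreal (2 * (1 + \<epsilon>) + 1) = ennreal C"
      unfolding C_def using \<epsilon>(1) by (intro ennreal_lincomb[symmetric]) auto
    finally show ?thesis .
  qed
  have C: "C \<ge> 0" using \<epsilon>(1) by (auto simp: C_def)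
  define G where "G s = s *\<^sub>R e + \<gamma> s *\<^sub>R n" for s
  have "hausdorff1_outer (frontier \<Omega> \<inter> ball p r) \<le> hausdorff1_outer (G ` {p \<bullet> e - r..p \<bullet> e + r})"
  proof (rule hausdorff1_outer_mono, clarify)
    fix x assume x: "x \<in> frontier \<Omega>" "x \<in> ball p r"
    then have "\<gamma> (x \<bullet> e) = x \<bullet> n" using frontier_of_epigraph[OF op(1) c\<gamma> en ep] by blast
    then have "x = G (x \<bullet> e)" using orthonormal_expansion_2(1)[OF en, of x] by (simp add: G_def)
    moreover have "\<bar>(x - p) \<bullet> e\<bar> \<le> norm (x - p)" using Cauchy_Schwarz_ineq2[of "x - p" e] en by simp
    then have "x \<bullet> e \<in> {p \<bullet> e - r..p \<bullet> e + r}"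
      using x by (auto simp: inner_diff_left dist_norm norm_minus_commute abs_le_iff)
    ultimately show "x \<in> G ` {p \<bullet> e - r..p \<bullet> e + r}" by blast
  qed
  also have "\<dots> \<le> ennreal ((1 + L) * ((p \<bullet> e + r) - (p \<bullet> e - r)))"
  proof (rule hausdorff1_outer_lipschitz_image)
    show "(1 + L)-lipschitz_on {p \<bullet> e - r..p \<bullet> e + r} G"
    proof (rule lipschitz_onI)
      fix s t
      have "dist (G s) (G t) = norm ((s - t) *\<^sub>R e + (\<gamma> s - \<gamma> t) *\<^sub>R n)"
        by (simp add: dist_norm G_def algebra_simps)
      also have "\<dots> \<le> \<bar>s - t\<bar> + \<bar>\<gamma> s - \<gamma> t\<bar>" using norm_triangle_ineq[of "(s - t) *\<^sub>R e" "(\<gamma> s - \<gamma> t) *\<^sub>R n"] en by simp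
      also have "\<bar>\<gamma> s - \<gamma> t\<bar> \<le> L * \<bar>s - t\<bar>" using \<gamma> by (auto simp: lipschitz_on_def dist_real_def)
      finally show "dist (G s) (G t) \<le> (1 + L) * dist s t" by (simp add: dist_real_def algebra_simps)
    qed (use L in auto)
  qed (use r in auto)
  also have "\<dots> < \<infinity>" by simp
  finally show thesis using that[OF r C bound] by blast
qed

text \<open>The support meets the closure of \<Omega> in a compact subset of \<Omega>. A cutoff
  equal to 1 near this set replaces \<open>f\<close> by a compactly supported function on the plane
  with the same derivative on \<Omega>, and such a derivative integrates to 0.\<close>

lemma integral_pderiv2_zero_near_frontier:
  assumes \<Omega>: "open \<Omega>" "bounded \<Omega>" and f: "C_k 1 f" and z: "closure {x. f x \<noteq> 0} \<inter> frontier \<Omega> = {}"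
  shows "(LINT x|lebesgue_on \<Omega>. pderiv2 i f x) = 0"
proof -
  define K where "K = closure {x. f x \<noteq> 0} \<inter> closure \<Omega>"
  have "compact K" unfolding K_def using \<Omega> by (intro closed_Int_compact) auto
  moreover have "K \<subseteq> \<Omega>" using z \<Omega> by (auto simp: K_def frontier_def interior_open)
  ultimately obtain \<psi> U where \<psi>: "test_function \<Omega> \<psi>" "open U" "K \<subseteq> U" "\<And>x. x \<in> U \<Longrightarrow> \<psi> x = 1"
    using exists_cutoff[of K \<Omega>] \<Omega> by metis
  define g where "g x = \<psi> x * f x" for x
  have s\<psi>: "C_k 1 \<psi>" using \<psi>(1) by (intro smooth_imp_C1) (simp add: test_function_def)
  then have g: "C_k 1 g" unfolding g_def using f by (rule C_k_mult)
  have sub: "closure {x. g x \<noteq> 0} \<subseteq> closure {x. \<psi> x \<noteq> 0}"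
    by (rule closure_mono) (auto simp: g_def)
  have Kg: "compact (closure {x. g x \<noteq> 0})"
    using \<psi>(1) sub by (auto simp: test_function_def simp del: compact_closure intro: compact_closure_mono)
  have "indicator \<Omega> x *\<^sub>R pderiv2 i f x = pderiv2 i g x" for x
  proof (cases "x \<in> \<Omega>")
    case True
    show ?thesis
    proof (cases "x \<in> closure {x. f x \<noteq> 0}")
      case xf: True
      then have "x \<in> U" using \<psi>(3) True closure_subset by (auto simp: K_def)
      then have "pderiv2 i g x = pderiv2 i f x"
        using \<psi>(2,4) by (intro pderiv2_cong_open[of U]) (auto simp: g_def C1_differentiable[OF f])
      then show ?thesis using True by simp
    next
      case False
      moreover have "closure {x. g x \<noteq> 0} \<subseteq> closure {x. f x \<noteq> 0}"
        by (rule closure_mono) (auto simp: g_def)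
      ultimately have "x \<notin> closure {x. g x \<noteq> 0}" by blast
      then show ?thesis using False pderiv2_eq_0_outside[of x f i] pderiv2_eq_0_outside[of x g i] by simp
    qed
  next
    case False
    then have "x \<notin> closure {x. g x \<noteq> 0}" using sub \<psi>(1) by (auto simp: test_function_def)
    then show ?thesis using False by (simp add: pderiv2_eq_0_outside)
  qed
  then show ?thesis
    using \<Omega> C1_continuous_pderiv2[OF f]
    by (subst integral_lebesgue_on_eq)
      (auto intro: borel_measurable_continuous_onI simp: integral_pderiv2_compact_support[OF g Kg])
qed

text \<open>Induction over the balls stands in for a partition of unity: a cutoff \<psi> equal to 1
  near the half ball at \<open>p\<close> splits \<open>f\<close> into \<psi> f, subject to the local
  estimate, and (1 - \<psi>) f, whose support avoids that half ball. The half radii leave room for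
  \<psi> inside the full ball.\<close>

lemma compact_frontier_cover_induct:
  fixes \<Omega> :: "(real^2) set"
  assumes \<Omega>: "open \<Omega>" "bounded \<Omega>" and S: "finite S"
    and local: "\<And>p. p \<in> S \<Longrightarrow> r p > 0 \<and> C p \<ge> 0 \<and> trace_bound_on \<Omega> (ball p (r p)) (C p)"
  shows "\<exists>B\<ge>0. \<forall>f i. C_k 1 f \<longrightarrow> closure {x. f x \<noteq> 0} \<inter> frontier \<Omega> \<subseteq> (\<Union>p\<in>S. ball p (r p / 2)) \<longrightarrow>
     ennreal (cmod (LINT x|lebesgue_on \<Omega>. pderiv2 i f x)) \<le> ennreal B * boundary_L1 \<Omega> f"
  using S local
proof (induction S)
  case empty
  show ?case
    by (rule exI[of _ 0]) (auto simp: integral_pderiv2_zero_near_frontier[OF \<Omega>])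
next
  case (insert p S)
  let ?I = "\<lambda>f. \<integral>\<^sup>+x. ennreal (cmod (f x)) \<partial>arc_measure (frontier \<Omega>)"
  obtain B where B: "B \<ge> 0" "\<And>f i. C_k 1 f \<Longrightarrow> closure {x. f x \<noteq> 0} \<inter> frontier \<Omega> \<subseteq> (\<Union>p\<in>S. ball p (r p / 2)) \<Longrightarrow>
     ennreal (cmod (LINT x|lebesgue_on \<Omega>. pderiv2 i f x)) \<le> ennreal B * ?I f"
    using insert by auto
  have p: "r p > 0" "C p \<ge> 0" and pb: "\<And>f i. C_k 1 f \<Longrightarrow> compact (closure {x. f x \<noteq> 0}) \<Longrightarrow> closure {x. f x \<noteq> 0} \<subseteq> ball p (r p) \<Longrightarrow>
     ennreal (cmod (LINT x|lebesgue_on \<Omega>. pderiv2 i f x)) \<le> ennreal (C p) * ?I f"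
    using insert.prems by auto
  obtain \<psi> U where \<psi>: "test_function (ball p (r p)) \<psi>" "open U" "cball p (r p / 2) \<subseteq> U" "\<And>x. x \<in> U \<Longrightarrow> \<psi> x = 1" "\<And>x. cmod (\<psi> x) \<le> 1"
    by (rule exists_cutoff[of "cball p (r p / 2)" "ball p (r p)"]) (use p in auto)
  have s\<psi>: "C_k 1 \<psi>" using \<psi>(1) by (intro smooth_imp_C1) (simp add: test_function_def)
  show ?case
  \<comment> \<open>The factor 2 bounds |1 - \<psi>|.\<close>
  proof (intro exI[of _ "C p + B * 2"] conjI allI impI)
    fix f i assume f: "C_k 1 f" and cl: "closure {x. f x \<noteq> 0} \<inter> frontier \<Omega> \<subseteq> (\<Union>p\<in>insert p S. ball p (r p / 2))"
    define f1 f2 where "f1 x = \<psi> x * f x" and "f2 x = (1 + (-1) * \<psi> x) * f x" for x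
    have f1: "C_k 1 f1" unfolding f1_def using s\<psi> f by (rule C_k_mult)
    have f2: "C_k 1 f2" unfolding f2_def by (intro C_k_mult C_k_add C_k_const s\<psi> f)
    have mf: "f \<in> borel_measurable (arc_measure (frontier \<Omega>))"
      using C1_continuous[OF f] by (intro borel_measurable_arc_measure borel_measurable_continuous_onI)
    have "closure {x. f1 x \<noteq> 0} \<subseteq> closure {x. \<psi> x \<noteq> 0}" by (rule closure_mono) (auto simp: f1_def)
    then have b1: "ennreal (cmod (LINT x|lebesgue_on \<Omega>. pderiv2 i f1 x)) \<le> ennreal (C p) * ?I f1"
      using \<psi>(1) by (intro pb f1) (auto simp: test_function_def simp del: compact_closure intro: compact_closure_mono)
    have "closure {x. f2 x \<noteq> 0} \<subseteq> closure {x. f x \<noteq> 0}" by (rule closure_mono) (auto simp: f2_def)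
    moreover have "closure {x. f2 x \<noteq> 0} \<subseteq> - U"
      using \<psi>(2,4) by (intro closure_minimal) (auto simp: f2_def)
    ultimately have "closure {x. f2 x \<noteq> 0} \<inter> frontier \<Omega> \<subseteq> (\<Union>p\<in>S. ball p (r p / 2))"
      using cl order_trans[OF ball_subset_cball \<psi>(3)] by (simp only: UN_insert) blast
    then have b2: "ennreal (cmod (LINT x|lebesgue_on \<Omega>. pderiv2 i f2 x)) \<le> ennreal B * ?I f2"
      by (intro B(2) f2)
    have I1: "?I f1 \<le> ?I f"
      using \<psi>(5) by (intro nn_integral_mono ennreal_leI) (simp add: f1_def norm_mult mult_left_le_one_le)
    have "cmod (1 + (-1) * \<psi> x) \<le> 2" for x
      using norm_triangle_ineq4[of 1 "\<psi> x"] \<psi>(5)[of x] by simp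
    then have "?I f2 \<le> (\<integral>\<^sup>+x. ennreal 2 * ennreal (cmod (f x)) \<partial>arc_measure (frontier \<Omega>))"
      by (intro nn_integral_mono) (auto simp: f2_def norm_mult ennreal_mult[symmetric] intro!: ennreal_leI mult_right_mono simp del: ennreal_numeral)
    also have "\<dots> = ennreal 2 * ?I f" using mf by (intro nn_integral_cmult) auto
    finally have I2: "?I f2 \<le> ennreal 2 * ?I f" .
    have "f = (\<lambda>x. f1 x + f2 x)" by (auto simp: f1_def f2_def algebra_simps)
    then have "pderiv2 i f x = pderiv2 i f1 x + pderiv2 i f2 x" for x
      using pderiv2_add[OF C1_differentiable[OF f1] C1_differentiable[OF f2]] by metis
    then have "(LINT x|lebesgue_on \<Omega>. pderiv2 i f x) = (LINT x|lebesgue_on \<Omega>. pderiv2 i f1 x) + (LINT x|lebesgue_on \<Omega>. pderiv2 i f2 x)"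
      using \<Omega> C1_continuous_pderiv2[OF f1] C1_continuous_pderiv2[OF f2]
      by (simp add: Bochner_Integration.integral_add integrable_continuous_bounded)
    then have "ennreal (cmod (LINT x|lebesgue_on \<Omega>. pderiv2 i f x))
       \<le> ennreal (cmod (LINT x|lebesgue_on \<Omega>. pderiv2 i f1 x) + cmod (LINT x|lebesgue_on \<Omega>. pderiv2 i f2 x))"
      by (intro ennreal_leI) (simp add: norm_triangle_ineq)
    also have "\<dots> \<le> ennreal (C p) * ?I f1 + ennreal B * ?I f2"
      by (simp add: add_mono b1 b2)
    also have "\<dots> \<le> ennreal (C p) * ?I f + ennreal B * (ennreal 2 * ?I f)"
      by (intro add_mono mult_left_mono I1 I2) auto
    also have "\<dots> = (ennreal (C p) + ennreal B * ennreal 2) * ?I f"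
      by (simp only: distrib_right mult.assoc)
    also have "ennreal (C p) + ennreal B * ennreal 2 = ennreal (C p + B * 2)"
      using p B(1) by (subst ennreal_plus) (auto simp: ennreal_mult simp del: ennreal_plus)
    finally show "ennreal (cmod (LINT x|lebesgue_on \<Omega>. pderiv2 i f x)) \<le> ennreal (C p + B * 2) * ?I f" .
  qed (use p B in auto)
qed

text \<open>Compactness of the frontier turns the local estimates into one without restriction on
  the support. Finite length is recorded too: it lets convergence in the square norm of the boundary
  imply convergence in the mean, and it gives smooth functions a trace.\<close>

lemma green_inequality:
  assumes \<Omega>: "lipschitz_domain \<Omega>"
  obtains B where "\<And>f i. C_k 1 f \<Longrightarrow> ennreal (cmod (LINT x|lebesgue_on \<Omega>. pderiv2 i f x)) \<le> ennreal B * boundary_L1 \<Omega> f"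
    and "finite_measure (arc_measure (frontier \<Omega>))"
proof -
  have op: "open \<Omega>" "bounded \<Omega>" using \<Omega> by (auto simp: lipschitz_domain_def)
  have "\<exists>r C. r > 0 \<and> C \<ge> 0 \<and> trace_bound_on \<Omega> (ball p r) C
     \<and> hausdorff1_outer (frontier \<Omega> \<inter> ball p r) < \<infinity>" if p: "p \<in> frontier \<Omega>" for p
  proof -
    obtain r C where "r > 0" "C \<ge> 0" "\<And>f i. C_k 1 f \<Longrightarrow> compact (closure {x. f x \<noteq> 0}) \<Longrightarrow> closure {x. f x \<noteq> 0} \<subseteq> ball p r \<Longrightarrow>
     ennreal (cmod (LINT x|lebesgue_on \<Omega>. pderiv2 i f x)) \<le> ennreal C * boundary_L1 \<Omega> f"
      "hausdorff1_outer (frontier \<Omega> \<inter> ball p r) < \<infinity>"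
      by (rule green_local[OF \<Omega> p]) blast
    then show ?thesis by (intro exI[of _ r] exI[of _ C]) blast
  qed
  then obtain r C where rC: "\<And>p. p \<in> frontier \<Omega> \<Longrightarrow> r p > 0 \<and> C p \<ge> 0 \<and> trace_bound_on \<Omega> (ball p (r p)) (C p)"
     and fin: "\<And>p. p \<in> frontier \<Omega> \<Longrightarrow> hausdorff1_outer (frontier \<Omega> \<inter> ball p (r p)) < \<infinity>"
    by metis
  have "compact (frontier \<Omega>)" using op by (simp add: compact_frontier_bounded)
  then obtain S where S: "S \<subseteq> frontier \<Omega>" "finite S" "frontier \<Omega> \<subseteq> (\<Union>p\<in>S. ball p (r p / 2))"
  proof (rule compactE_image[of "frontier \<Omega>" "frontier \<Omega>" "\<lambda>p. ball p (r p / 2)"])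
    show "frontier \<Omega> \<subseteq> (\<Union>c\<in>frontier \<Omega>. ball c (r c / 2))" using rC by force
  qed auto
  obtain B where B: "\<And>f i. C_k 1 f \<Longrightarrow> closure {x. f x \<noteq> 0} \<inter> frontier \<Omega> \<subseteq> (\<Union>p\<in>S. ball p (r p / 2)) \<Longrightarrow>
     ennreal (cmod (LINT x|lebesgue_on \<Omega>. pderiv2 i f x)) \<le> ennreal B * boundary_L1 \<Omega> f"
    using compact_frontier_cover_induct[OF op S(2), of r C] rC S(1) by blast
  have "hausdorff1_outer (\<Union>p\<in>T. frontier \<Omega> \<inter> ball p (r p)) < \<infinity>" if "T \<subseteq> S" for T
    using finite_subset[OF that S(2)] that
  proof (induction T)
    case (insert p T)
    have "hausdorff1_outer (\<Union>p\<in>insert p T. frontier \<Omega> \<inter> ball p (r p))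
      \<le> hausdorff1_outer (frontier \<Omega> \<inter> ball p (r p)) + hausdorff1_outer (\<Union>p\<in>T. frontier \<Omega> \<inter> ball p (r p))"
      unfolding UN_insert by (rule hausdorff1_outer_Un)
    also have "\<dots> < \<infinity>" using insert fin[of p] S(1) by auto
    finally show ?case .
  qed simp
  moreover have "frontier \<Omega> \<subseteq> (\<Union>p\<in>S. frontier \<Omega> \<inter> ball p (r p))"
  proof
    fix x assume x: "x \<in> frontier \<Omega>"
    then obtain p where p: "p \<in> S" "x \<in> ball p (r p / 2)" using S(3) by blast
    then have "r p > 0" using rC S(1) by blast
    with p x show "x \<in> (\<Union>p\<in>S. frontier \<Omega> \<inter> ball p (r p))" by (intro UN_I[of p]) auto
  qed
  ultimately have "hausdorff1_outer (frontier \<Omega>) < \<infinity>"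
    using order_le_less_trans[OF hausdorff1_outer_mono] by blast
  then have "finite_measure (arc_measure (frontier \<Omega>))"
    unfolding arc_measure_def
    by (intro finite_measureI) (simp add: space_restrict_space emeasure_restrict_space emeasure_hausdorff1 less_top)
  then show thesis using that[of B] B S(3) by blast
qed

section \<open>Weak gradients\<close>

text \<open>A Dynkin argument, since boxes form an intersection-stable generator of the Borel sets.
  Complements need the total integral to vanish, and it does because one box contains the bounded
  set where \<open>g\<close> is non-zero. Lebesgue sets differ from Borel sets by null sets
  only.\<close>

lemma AE_eq_0_of_box_integrals:
  fixes g :: "real^2 \<Rightarrow> complex"
  assumes g: "integrable lebesgue g" and bnd: "\<And>x. g x \<noteq> 0 \<Longrightarrow> norm x < R"
    and box: "\<And>a b. (LINT x:box a b|lebesgue. g x) = 0"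
  shows "AE x in lebesgue. g x = 0"
proof -
  have si: "set_integrable lebesgue A g" if "A \<in> sets lebesgue" for A
    using integrable_mult_indicator[OF that g] by (simp add: set_integrable_def)
  have tot: "integral\<^sup>L lebesgue g = 0"
  proof -
    have "x \<in> box (- (\<chi> i. R)) (\<chi> i. R)" if "norm x < R" for x :: "real^2"
      unfolding mem_box_cart using component_le_norm_cart[of x] that
      by (auto simp: abs_le_iff) (smt (verit) component_le_norm_cart)+
    then have "(\<lambda>x. indicator (box (- (\<chi> i. R)) (\<chi> i. R)) x *\<^sub>R g x) = g"
      using bnd by (force simp: indicator_def)
    then show ?thesis using box[of "- (\<chi> i. R)" "\<chi> i. R"] by (simp add: set_lebesgue_integral_def)
  qed
  have borel: "(LINT x:A|lebesgue. g x) = 0" if "A \<in> sets borel" for A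
  proof -
    have "Int_stable (range (\<lambda>(a, b). box a b :: (real^2) set))"
      by (auto simp: Int_stable_def box_Int_box)
    moreover have "range (\<lambda>(a, b). box a b :: (real^2) set) \<subseteq> Pow UNIV" by simp
    moreover have "A \<in> sigma_sets UNIV (range (\<lambda>(a, b). box a b :: (real^2) set))"
      using that by (simp add: borel_eq_box)
    ultimately show ?thesis
    proof (induction rule: sigma_sets_induct_disjoint)
      case (basic A)
      then show ?case using box by auto
    next
      case empty
      then show ?case by (simp add: set_lebesgue_integral_def)
    next
      case (compl A)
      then have A: "A \<in> sets lebesgue" by (simp add: borel_eq_box)
      have "(LINT x:A \<union> (UNIV - A)|lebesgue. g x) = (LINT x:A|lebesgue. g x) + (LINT x:UNIV - A|lebesgue. g x)"
        by (rule set_integral_Un) (use A si sets.compl_sets[OF A] in auto)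
      then show ?case using compl tot by (simp add: set_lebesgue_integral_def)
    next
      case (union A)
      have "sets (borel :: (real^2) measure) = sigma_sets UNIV (range (\<lambda>(a, b). box a b))"
        by (simp add: borel_eq_box)
      then have "A i \<in> sets borel" for i using union by blast
      then have A: "A i \<in> sets lebesgue" for i by simp
      have "(LINT x:(\<Union>i. A i)|lebesgue. g x) = (\<Sum>i. (LINT x:(A i)|lebesgue. g x))"
        by (rule lebesgue_integral_countable_add) (use A union si in \<open>auto simp: disjoint_family_on_def\<close>)
      then show ?case using union by simp
    qed
  qed
  interpret sigma_finite_measure "lebesgue :: (real^2) measure"
  proof
    have "(\<Union>n::nat. ball (0 :: real^2) (real n)) = UNIV"
      by (auto simp: reals_Archimedean2)
    moreover have "emeasure lebesgue (ball (0 :: real^2) (real n)) \<noteq> \<infinity>" for n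
      using lmeasurable_ball[of "0 :: real^2" "real n"] by (auto simp: fmeasurable_def)
    ultimately show "\<exists>A. countable A \<and> A \<subseteq> sets (lebesgue :: (real^2) measure) \<and> \<Union>A = space lebesgue \<and> (\<forall>a\<in>A. emeasure lebesgue a \<noteq> \<infinity>)"
      by (intro exI[of _ "range (\<lambda>n::nat. ball (0 :: real^2) (real n))"]) auto
  qed
  show ?thesis
  proof (rule density_zero[OF g])
    fix A :: "(real^2) set" assume "A \<in> sets lebesgue"
    then obtain S N N' where A: "A = S \<union> N" "N \<subseteq> N'" "N' \<in> null_sets lborel" "S \<in> sets lborel"
      by (rule sets_completionE)
    have "AE x in lebesgue. x \<notin> N'" using A(3) by (intro AE_not_in null_sets_completionI)
    then have "(LINT x:A|lebesgue. g x) = (LINT x:S|lebesgue. g x)"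
      unfolding set_lebesgue_integral_def using A \<open>A \<in> sets lebesgue\<close> g
      by (intro integral_cong_AE borel_measurable_scaleR borel_measurable_indicator)
        (auto simp: indicator_def elim!: eventually_mono)
    then show "(LINT x:A|lebesgue. g x) = 0" using borel A by simp
  qed
qed

section \<open>Square integrable functions and the fundamental lemma of the calculus of
  variations\<close>

lemma test_function_props:
  assumes "test_function \<Omega> \<phi>"
  shows "smooth \<phi>" "C_k 1 \<phi>" "compact (closure {x. \<phi> x \<noteq> 0})" "closure {x. \<phi> x \<noteq> 0} \<subseteq> \<Omega>"
  using assms smooth_imp_C1 unfolding test_function_def by blast+

lemma bounded_continuous_compact_support:
  fixes f :: "real^2 \<Rightarrow> complex"
  assumes "continuous_on UNIV f" "compact K" "\<And>x. x \<notin> K \<Longrightarrow> f x = 0"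
  obtains B where "\<And>x. cmod (f x) \<le> B"
proof -
  have "bounded (f ` K)"
    using assms by (intro compact_imp_bounded compact_continuous_image continuous_on_subset[OF assms(1)]) auto
  then obtain B where "\<And>x. x \<in> K \<Longrightarrow> cmod (f x) \<le> B" by (auto simp: bounded_iff)
  then have "cmod (f x) \<le> max B 0" for x using assms(3)[of x] by (cases "x \<in> K") (auto intro: le_max_iff_disj[THEN iffD2])
  then show thesis using that by blast
qed

lemma continuous_measurable_lebesgue_on:
  fixes f :: "real^2 \<Rightarrow> 'b :: real_normed_vector"
  shows "continuous_on UNIV f \<Longrightarrow> f \<in> borel_measurable (lebesgue_on A)"
  by (intro measurable_restrict_space1 measurable_completion) (simp add: borel_measurable_continuous_onI)

lemma integrable_mult_bounded:
  fixes f b :: "'a \<Rightarrow> complex"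
  assumes f: "integrable M f" and b: "b \<in> borel_measurable M" "\<And>x. x \<in> space M \<Longrightarrow> cmod (b x) \<le> B"
  shows "integrable M (\<lambda>x. f x * b x)"
proof (rule Bochner_Integration.integrable_bound)
  show "integrable M (\<lambda>x. B * cmod (f x))" using f by auto
  show "AE x in M. cmod (f x * b x) \<le> norm (B * cmod (f x))"
  proof (rule AE_I2)
    fix x assume "x \<in> space M"
    then have B: "cmod (b x) \<le> B" by (rule b)
    then have "cmod (f x) * cmod (b x) \<le> cmod (f x) * B" by (rule mult_left_mono) simp
    also have "\<dots> \<le> norm (B * cmod (f x))" by (simp add: mult.commute)
    finally show "cmod (f x * b x) \<le> norm (B * cmod (f x))" by (simp add: norm_mult)
  qed
qed (use f b in measurable)

text \<open>Pointwise |f| \<le> 1 + |f|^2, and the constant 1 has a finite integral.\<close>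

lemma square_integrable_imp_integrable:
  assumes "finite_measure M" "square_integrable M f"
  shows "integrable M f"
proof -
  interpret finite_measure M by fact
  have f: "f \<in> borel_measurable M" "(\<integral>\<^sup>+x. ennreal ((cmod (f x))\<^sup>2) \<partial>M) < \<infinity>"
    using assms(2) by (auto simp: square_integrable_def L2_sq_def)
  have "cmod (f x) \<le> 1 + (cmod (f x))\<^sup>2" for x
  proof -
    have "0 \<le> (cmod (f x) - 1)\<^sup>2" by simp
    then have "2 * cmod (f x) \<le> 1 + (cmod (f x))\<^sup>2" by (simp add: power2_diff)
    then show ?thesis using norm_ge_zero[of "f x"] by linarith
  qed
  then have "(\<integral>\<^sup>+x. ennreal (cmod (f x)) \<partial>M) \<le> (\<integral>\<^sup>+x. ennreal 1 + ennreal ((cmod (f x))\<^sup>2) \<partial>M)"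
    by (intro nn_integral_mono) (simp add: ennreal_plus[symmetric] ennreal_leI del: ennreal_plus ennreal_1)
  also have "\<dots> = emeasure M (space M) + (\<integral>\<^sup>+x. ennreal ((cmod (f x))\<^sup>2) \<partial>M)"
    using f(1) by (subst nn_integral_add) auto
  also have "\<dots> < \<infinity>" using f(2) by (simp add: less_top[symmetric])
  finally show ?thesis using f(1) by (simp add: integrable_iff_bounded)
qed

lemma square_integrable_diff:
  assumes "square_integrable M f" "square_integrable M g"
  shows "square_integrable M (\<lambda>x. f x - g x)"
proof -
  have m: "f \<in> borel_measurable M" "g \<in> borel_measurable M" using assms by (auto simp: square_integrable_def)
  have "(cmod (f x - g x))\<^sup>2 \<le> 2 * (cmod (f x))\<^sup>2 + 2 * (cmod (g x))\<^sup>2" for x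
  proof -
    have "(cmod (f x - g x))\<^sup>2 \<le> (cmod (f x) + cmod (g x))\<^sup>2"
      by (intro power_mono norm_triangle_ineq4) simp
    also have "\<dots> \<le> 2 * (cmod (f x))\<^sup>2 + 2 * (cmod (g x))\<^sup>2"
      using zero_le_power2[of "cmod (f x) - cmod (g x)"] by (simp add: power2_eq_square algebra_simps)
    finally show ?thesis .
  qed
  then have "L2_sq M (\<lambda>x. f x - g x) \<le> (\<integral>\<^sup>+x. ennreal 2 * ennreal ((cmod (f x))\<^sup>2) + ennreal 2 * ennreal ((cmod (g x))\<^sup>2) \<partial>M)"
    unfolding L2_sq_def
    by (intro nn_integral_mono, subst ennreal_lincomb[symmetric]) (auto simp del: ennreal_plus intro!: ennreal_leI)
  also have "\<dots> = ennreal 2 * L2_sq M f + ennreal 2 * L2_sq M g"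
    unfolding L2_sq_def using m by (subst nn_integral_add) (auto simp: nn_integral_cmult simp del: ennreal_numeral)
  also have "\<dots> < \<infinity>" using assms by (simp add: square_integrable_def ennreal_mult_less_top)
  finally show ?thesis using m by (auto simp: square_integrable_def)
qed

lemma square_integrable_continuous:
  fixes f :: "real^2 \<Rightarrow> complex"
  assumes f: "continuous_on UNIV f" and A: "open A" "bounded A"
  shows "square_integrable (lebesgue_on A) f"
proof -
  have "continuous_on UNIV (\<lambda>x. complex_of_real ((cmod (f x))\<^sup>2))" by (intro continuous_intros f)
  then have "integrable (lebesgue_on A) (\<lambda>x. complex_of_real ((cmod (f x))\<^sup>2))"
    using A by (rule integrable_continuous_bounded)
  then have "(\<integral>\<^sup>+x. ennreal (norm (complex_of_real ((cmod (f x))\<^sup>2))) \<partial>lebesgue_on A) < \<infinity>"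
    by (simp only: integrable_iff_bounded)
  then show ?thesis using continuous_measurable_lebesgue_on[OF f]
    by (simp add: square_integrable_def L2_sq_def norm_power)
qed

text \<open>A cutoff \<psi> times a smooth approximation of a box is a test function, so in the
  limit f \<psi> integrates to 0 over every box and vanishes almost everywhere. Taking \<psi> equal
  to 1 on the members of a compact exhaustion of \<Omega> removes it.\<close>

lemma fundamental_lemma:
  fixes f :: "real^2 \<Rightarrow> complex"
  assumes \<Omega>: "open \<Omega>" and f: "integrable (lebesgue_on \<Omega>) f"
    and z: "\<And>\<phi>. test_function \<Omega> \<phi> \<Longrightarrow> (LINT x|lebesgue_on \<Omega>. f x * \<phi> x) = 0"
  shows "AE x in lebesgue_on \<Omega>. f x = 0"
proof -
  have main: "AE x in lebesgue. x \<in> \<Omega> \<longrightarrow> f x * \<psi> x = 0" if \<psi>: "test_function \<Omega> \<psi>" for \<psi>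
  proof -
    note tp = test_function_props[OF \<psi>]
    have c\<psi>: "continuous_on UNIV \<psi>" using tp(1) by (rule smooth_imp_continuous)
    have z\<psi>: "\<psi> x = 0" if "x \<notin> closure {x. \<psi> x \<noteq> 0}" for x using that closure_subset[of "{x. \<psi> x \<noteq> 0}"] by auto
    obtain B where B: "\<And>x. cmod (\<psi> x) \<le> B"
      using bounded_continuous_compact_support[OF c\<psi> tp(3) z\<psi>] by blast
    obtain R where R: "\<And>x. x \<in> closure {x. \<psi> x \<noteq> 0} \<Longrightarrow> norm x \<le> R"
      using tp(3) unfolding compact_eq_bounded_closed bounded_iff by blast
    define g where "g x = indicator \<Omega> x *\<^sub>R (f x * \<psi> x)" for x
    have f\<psi>: "integrable (lebesgue_on \<Omega>) (\<lambda>x. f x * \<psi> x)"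
      using f continuous_measurable_lebesgue_on[OF c\<psi>] B by (rule integrable_mult_bounded)
    then have g: "integrable lebesgue g"
      unfolding g_def using \<Omega> by (subst (asm) integrable_restrict_space) auto
    have "AE x in lebesgue. g x = 0"
    proof (rule AE_eq_0_of_box_integrals[OF g])
      fix x assume "g x \<noteq> 0"
      then have "x \<in> closure {x. \<psi> x \<noteq> 0}" using z\<psi>[of x] unfolding g_def by fastforce
      then have "norm x \<le> R" by (rule R)
      then show "norm x < R + 1" by simp
    next
      fix a b :: "real^2"
      obtain \<beta> where \<beta>: "\<And>n. smooth (\<beta> n)" "\<And>x. (\<lambda>n. \<beta> n x) \<longlonglongrightarrow> indicator (box a b) x" "\<And>n x. cmod (\<beta> n x) \<le> 1"
        using box_smooth_approx[of a b] by blast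
      have "(\<lambda>n. LINT x|lebesgue_on \<Omega>. (f x * \<psi> x) * \<beta> n x) \<longlonglongrightarrow> (LINT x|lebesgue_on \<Omega>. (f x * \<psi> x) * indicator (box a b) x)"
      proof (rule integral_dominated_convergence[where w = "\<lambda>x. cmod (f x * \<psi> x)"])
        show "AE x in lebesgue_on \<Omega>. (\<lambda>n. f x * \<psi> x * \<beta> n x) \<longlonglongrightarrow> f x * \<psi> x * indicator (box a b) x"
          by (intro AE_I2 tendsto_mult \<beta>(2)) auto
        show "AE x in lebesgue_on \<Omega>. norm (f x * \<psi> x * \<beta> n x) \<le> cmod (f x * \<psi> x)" for n
          using \<beta>(3) by (intro AE_I2) (simp add: norm_mult mult_left_le)
        show "(\<lambda>x. f x * \<psi> x * \<beta> n x) \<in> borel_measurable (lebesgue_on \<Omega>)" for n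
          by (rule borel_measurable_times[OF borel_measurable_integrable[OF f\<psi>] continuous_measurable_lebesgue_on[OF smooth_imp_continuous[OF \<beta>(1)]]])
        show "(\<lambda>x. f x * \<psi> x * indicator (box a b) x) \<in> borel_measurable (lebesgue_on \<Omega>)"
          by (intro borel_measurable_times[OF borel_measurable_integrable[OF f\<psi>]] measurable_restrict_space1 borel_measurable_indicator) simp
      qed (use f\<psi> in auto)
      moreover have "(LINT x|lebesgue_on \<Omega>. (f x * \<psi> x) * \<beta> n x) = 0" for n
        using z[OF test_function_mult[OF \<psi> \<beta>(1)]] by (simp add: mult.assoc)
      ultimately have "(LINT x|lebesgue_on \<Omega>. (f x * \<psi> x) * indicator (box a b) x) = 0"
        by (simp add: LIMSEQ_const_iff)
      also have "(LINT x|lebesgue_on \<Omega>. (f x * \<psi> x) * indicator (box a b) x) = (LINT x|lebesgue. indicator \<Omega> x *\<^sub>R ((f x * \<psi> x) * indicator (box a b) x))"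
        using \<Omega> by (subst integral_restrict_space) auto
      also have "\<dots> = (LINT x:box a b|lebesgue. g x)"
        unfolding set_lebesgue_integral_def g_def by (intro Bochner_Integration.integral_cong) (auto simp: indicator_def)
      finally show "(LINT x:box a b|lebesgue. g x) = 0" .
    qed
    then show ?thesis by eventually_elim (auto simp: g_def)
  qed
  obtain C :: "nat \<Rightarrow> (real^2) set" where C: "\<And>n. compact (C n)" "\<And>n. C n \<subseteq> \<Omega>" "\<Union>(range C) = \<Omega>"
    using open_Union_compact_subsets[OF \<Omega>] by metis
  have "AE x in lebesgue. x \<in> C n \<longrightarrow> f x = 0" for n
  proof -
    obtain \<psi> U where \<psi>: "test_function \<Omega> \<psi>" "C n \<subseteq> U" "\<And>x. x \<in> U \<Longrightarrow> \<psi> x = 1"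
      using exists_cutoff[OF C(1,2) \<Omega>] by metis
    show ?thesis using main[OF \<psi>(1)] by eventually_elim (use \<psi>(2,3) C(2)[of n] in force)
  qed
  then have "AE x in lebesgue. \<forall>n. x \<in> C n \<longrightarrow> f x = 0"
    by (intro AE_all_countable[THEN iffD2] allI)
  then have "AE x in lebesgue. x \<in> \<Omega> \<longrightarrow> f x = 0" by eventually_elim (use C(3) in blast)
  then show ?thesis using \<Omega> by (simp add: AE_restrict_space_iff)
qed

text \<open>Integration by parts: the support of v \<phi> does not meet the frontier, so the
  derivative of this product integrates to 0.\<close>

lemma is_weak_gradient_smooth:
  assumes \<Omega>: "open \<Omega>" "bounded \<Omega>" and v: "smooth v"
  shows "is_weak_gradient \<Omega> v (\<lambda>x. \<chi> i. pderiv2 i v x)"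
  unfolding is_weak_gradient_def
proof (intro conjI allI impI)
  note v1 = smooth_imp_C1[OF v]
  show "square_integrable (lebesgue_on \<Omega>) (\<lambda>x. (\<chi> i. pderiv2 i v x) $ i)" for i
    using square_integrable_continuous[OF C1_continuous_pderiv2[OF v1] \<Omega>] by simp
  fix i \<phi> assume "test_function \<Omega> \<phi>"
  note \<phi> = test_function_props[OF this]
  have v\<phi>: "C_k 1 (\<lambda>x. v x * \<phi> x)" by (rule C_k_mult[OF v1 \<phi>(2)])
  have "closure {x. v x * \<phi> x \<noteq> 0} \<subseteq> closure {x. \<phi> x \<noteq> 0}" by (rule closure_mono) auto
  then have "closure {x. v x * \<phi> x \<noteq> 0} \<inter> frontier \<Omega> = {}"
    using \<phi>(4) \<Omega> by (auto simp: frontier_def interior_open)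
  then have "0 = (LINT x|lebesgue_on \<Omega>. pderiv2 i (\<lambda>x. v x * \<phi> x) x)"
    using integral_pderiv2_zero_near_frontier[OF \<Omega> v\<phi>] by simp
  also have "\<dots> = (LINT x|lebesgue_on \<Omega>. v x * pderiv2 i \<phi> x + pderiv2 i v x * \<phi> x)"
    by (simp only: pderiv2_mult[OF C1_differentiable[OF v1] C1_differentiable[OF \<phi>(2)]])
  also have "\<dots> = (LINT x|lebesgue_on \<Omega>. v x * pderiv2 i \<phi> x) + (LINT x|lebesgue_on \<Omega>. pderiv2 i v x * \<phi> x)"
    using \<Omega> C1_continuous_pderiv2[OF v1] C1_continuous_pderiv2[OF \<phi>(2)] C1_continuous[OF v1] C1_continuous[OF \<phi>(2)]
    by (intro Bochner_Integration.integral_add integrable_continuous_bounded continuous_on_mult)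
  finally show "(LINT x|lebesgue_on \<Omega>. v x * pderiv2 i \<phi> x) = - (LINT x|lebesgue_on \<Omega>. (\<chi> i. pderiv2 i v x) $ i * \<phi> x)"
    by (simp add: eq_neg_iff_add_eq_0)
qed

lemma integrable_mult_continuous:
  fixes u b :: "real^2 \<Rightarrow> complex"
  assumes \<Omega>: "open \<Omega>" "bounded \<Omega>" and u: "square_integrable (lebesgue_on \<Omega>) u" and b: "continuous_on UNIV b"
  shows "integrable (lebesgue_on \<Omega>) (\<lambda>x. u x * b x)"
proof -
  have "bounded (b ` closure \<Omega>)"
    using \<Omega> by (intro compact_imp_bounded compact_continuous_image continuous_on_subset[OF b]) auto
  then obtain B where B: "\<And>x. x \<in> closure \<Omega> \<Longrightarrow> cmod (b x) \<le> B" by (auto simp: bounded_iff)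
  show ?thesis
    using square_integrable_imp_integrable[OF finite_measure_lebesgue_on[OF \<Omega>] u] continuous_measurable_lebesgue_on[OF b]
    by (rule integrable_mult_bounded[of _ _ _ B]) (use B closure_subset in \<open>auto simp: space_restrict_space\<close>)
qed

lemma is_weak_gradient_diff:
  assumes \<Omega>: "open \<Omega>" "bounded \<Omega>" and u: "square_integrable (lebesgue_on \<Omega>) u" "is_weak_gradient \<Omega> u g"
    and v: "square_integrable (lebesgue_on \<Omega>) v" "is_weak_gradient \<Omega> v h"
  shows "is_weak_gradient \<Omega> (\<lambda>x. u x - v x) (\<lambda>x. g x - h x)"
  unfolding is_weak_gradient_def
proof (intro conjI allI impI)
  have gh: "square_integrable (lebesgue_on \<Omega>) (\<lambda>x. g x $ i)" "square_integrable (lebesgue_on \<Omega>) (\<lambda>x. h x $ i)" for i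
    using u v by (auto simp: is_weak_gradient_def)
  then show "square_integrable (lebesgue_on \<Omega>) (\<lambda>x. (g x - h x) $ i)" for i
    by (simp add: square_integrable_diff)
  fix i \<phi> assume t: "test_function \<Omega> \<phi>"
  note \<phi> = test_function_props[OF this]
  have "(LINT x|lebesgue_on \<Omega>. (u x - v x) * pderiv2 i \<phi> x) = (LINT x|lebesgue_on \<Omega>. u x * pderiv2 i \<phi> x) - (LINT x|lebesgue_on \<Omega>. v x * pderiv2 i \<phi> x)"
    unfolding left_diff_distrib
    by (intro Bochner_Integration.integral_diff integrable_mult_continuous[OF \<Omega>] u v C1_continuous_pderiv2[OF \<phi>(2)])
  also have "\<dots> = - ((LINT x|lebesgue_on \<Omega>. g x $ i * \<phi> x) - (LINT x|lebesgue_on \<Omega>. h x $ i * \<phi> x))"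
    using u(2) v(2) t by (simp add: is_weak_gradient_def)
  also have "(LINT x|lebesgue_on \<Omega>. g x $ i * \<phi> x) - (LINT x|lebesgue_on \<Omega>. h x $ i * \<phi> x) = (LINT x|lebesgue_on \<Omega>. (g x - h x) $ i * \<phi> x)"
    unfolding vector_minus_component left_diff_distrib
    by (intro Bochner_Integration.integral_diff[symmetric] integrable_mult_continuous[OF \<Omega>] gh C1_continuous[OF \<phi>(2)])
  finally show "(LINT x|lebesgue_on \<Omega>. (u x - v x) * pderiv2 i \<phi> x) = - (LINT x|lebesgue_on \<Omega>. (g x - h x) $ i * \<phi> x)" .
qed

text \<open>\<open>grad\<close> is an arbitrary choice among weak gradients, and every computation
  with it rests on this uniqueness. The difference of two candidates integrates to 0 against all
  test functions.\<close>

lemma is_weak_gradient_unique: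
  assumes \<Omega>: "open \<Omega>" "bounded \<Omega>" and g: "is_weak_gradient \<Omega> u g" and h: "is_weak_gradient \<Omega> u h"
  shows "AE x in lebesgue_on \<Omega>. g x = h x"
proof -
  have gh: "square_integrable (lebesgue_on \<Omega>) (\<lambda>x. g x $ i)" "square_integrable (lebesgue_on \<Omega>) (\<lambda>x. h x $ i)" for i
    using g h by (auto simp: is_weak_gradient_def)
  have "AE x in lebesgue_on \<Omega>. g x $ i - h x $ i = 0" for i
  proof (rule fundamental_lemma[OF \<Omega>(1)])
    show "integrable (lebesgue_on \<Omega>) (\<lambda>x. g x $ i - h x $ i)"
      by (intro square_integrable_imp_integrable square_integrable_diff finite_measure_lebesgue_on \<Omega> gh)
    fix \<phi> assume t: "test_function \<Omega> \<phi>"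
    have "(LINT x|lebesgue_on \<Omega>. (g x $ i - h x $ i) * \<phi> x) = (LINT x|lebesgue_on \<Omega>. g x $ i * \<phi> x) - (LINT x|lebesgue_on \<Omega>. h x $ i * \<phi> x)"
      unfolding left_diff_distrib
      by (intro Bochner_Integration.integral_diff integrable_mult_continuous[OF \<Omega>] gh C1_continuous test_function_props(2)[OF t])
    moreover have "- (LINT x|lebesgue_on \<Omega>. g x $ i * \<phi> x) = - (LINT x|lebesgue_on \<Omega>. h x $ i * \<phi> x)"
    proof -
      have "(LINT x|lebesgue_on \<Omega>. u x * pderiv2 i \<phi> x) = - (LINT x|lebesgue_on \<Omega>. g x $ i * \<phi> x)"
        using g t by (simp add: is_weak_gradient_def)
      moreover have "(LINT x|lebesgue_on \<Omega>. u x * pderiv2 i \<phi> x) = - (LINT x|lebesgue_on \<Omega>. h x $ i * \<phi> x)"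
        using h t by (simp add: is_weak_gradient_def)
      ultimately show ?thesis by simp
    qed
    ultimately show "(LINT x|lebesgue_on \<Omega>. (g x $ i - h x $ i) * \<phi> x) = 0" by simp
  qed
  then have "AE x in lebesgue_on \<Omega>. \<forall>i. g x $ i - h x $ i = 0" by (simp add: AE_all_countable)
  then show ?thesis by eventually_elim (simp add: vec_eq_iff)
qed

lemma grad_is_weak_gradient: "u \<in> H1 \<Omega> \<Longrightarrow> is_weak_gradient \<Omega> u (grad \<Omega> u)"
  unfolding H1_def grad_def by (auto dest: someI[of "is_weak_gradient \<Omega> u"])

lemma smooth_in_H1:
  assumes \<Omega>: "open \<Omega>" "bounded \<Omega>" and v: "smooth v"
  shows "v \<in> H1 \<Omega>" and "AE x in lebesgue_on \<Omega>. grad \<Omega> v x = (\<chi> i. pderiv2 i v x)"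
proof -
  show *: "v \<in> H1 \<Omega>"
    using is_weak_gradient_smooth[OF assms] square_integrable_continuous[OF smooth_imp_continuous[OF v] \<Omega>]
    by (auto simp: H1_def)
  show "AE x in lebesgue_on \<Omega>. grad \<Omega> v x = (\<chi> i. pderiv2 i v x)"
    by (rule is_weak_gradient_unique[OF \<Omega> grad_is_weak_gradient[OF *] is_weak_gradient_smooth[OF assms]])
qed

text \<open>The choices made for \<open>u\<close> and for the difference are independent, so
  linearity can hold only almost everywhere. The differences are those measured by
  \<open>H1_sq\<close> in \<open>has_trace\<close>.\<close>

lemma grad_diff_smooth:
  assumes \<Omega>: "open \<Omega>" "bounded \<Omega>" and u: "u \<in> H1 \<Omega>" and v: "smooth v"
  shows "AE x in lebesgue_on \<Omega>. grad \<Omega> (\<lambda>x. u x - v x) x = grad \<Omega> u x - (\<chi> i. pderiv2 i v x)"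
proof -
  have sq: "square_integrable (lebesgue_on \<Omega>) u" "square_integrable (lebesgue_on \<Omega>) v"
    using u smooth_in_H1(1)[OF \<Omega> v] by (auto simp: H1_def)
  have w: "is_weak_gradient \<Omega> (\<lambda>x. u x - v x) (\<lambda>x. grad \<Omega> u x - (\<chi> i. pderiv2 i v x))"
    by (rule is_weak_gradient_diff[OF \<Omega> sq(1) grad_is_weak_gradient[OF u] sq(2) is_weak_gradient_smooth[OF \<Omega> v]])
  then have "(\<lambda>x. u x - v x) \<in> H1 \<Omega>" using square_integrable_diff[OF sq] by (auto simp: H1_def)
  from is_weak_gradient_unique[OF \<Omega> grad_is_weak_gradient[OF this] w] show ?thesis .
qed

section \<open>Limits of integrals along sequences that converge in the square norm\<close>

lemma L2_sq_cong_AE: "AE x in M. f x = g x \<Longrightarrow> L2_sq M f = L2_sq M g"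
  unfolding L2_sq_def by (rule nn_integral_cong_AE) (auto elim!: eventually_mono)

lemma ennreal_tendsto_0_le:
  fixes f g :: "nat \<Rightarrow> ennreal"
  assumes "f \<longlonglongrightarrow> 0" "\<And>m. g m \<le> f m"
  shows "g \<longlonglongrightarrow> 0"
  by (rule tendsto_sandwich[OF _ _ tendsto_const assms(1)]) (use assms(2) in auto)

text \<open>Cauchy-Schwarz against the constant 1 bounds the square of the integral by
  \<open>L2_sq\<close> times the finite total mass. The square is removed by comparing with the
  square of a threshold.\<close>

lemma nn_integral_norm_tendsto_0:
  assumes M: "finite_measure M" and f: "\<And>m. f m \<in> borel_measurable M" and lim: "(\<lambda>m. L2_sq M (f m)) \<longlonglongrightarrow> 0"
  shows "(\<lambda>m. \<integral>\<^sup>+x. ennreal (cmod (f m x)) \<partial>M) \<longlonglongrightarrow> 0"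
proof -
  interpret finite_measure M by fact
  let ?I = "\<lambda>m. \<integral>\<^sup>+x. ennreal (cmod (f m x)) \<partial>M"
  have bound: "(?I m)\<^sup>2 \<le> L2_sq M (f m) * emeasure M (space M)" for m
    using Cauchy_Schwarz_nn_integral[of "\<lambda>x. ennreal (cmod (f m x))" M "\<lambda>_. 1"] f[of m]
    by (simp add: L2_sq_def ennreal_power)
  have "(\<lambda>m. L2_sq M (f m) * emeasure M (space M)) \<longlonglongrightarrow> 0 * emeasure M (space M)"
    by (rule tendsto_mult_ennreal[OF lim tendsto_const]) auto
  then have sq: "(\<lambda>m. (?I m)\<^sup>2) \<longlonglongrightarrow> 0"
    using bound by (intro ennreal_tendsto_0_le[where g = "\<lambda>m. (?I m)\<^sup>2"]) auto
  show ?thesis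
  proof (rule order_tendstoI)
    fix a :: ennreal assume "0 < a"
    then have "0 < a\<^sup>2" by (simp add: zero_less_iff_neq_zero)
    then have "\<forall>\<^sub>F m in sequentially. (?I m)\<^sup>2 < a\<^sup>2" using sq order_tendstoD(2) by blast
    then show "\<forall>\<^sub>F m in sequentially. ?I m < a"
    proof eventually_elim
      case (elim m)
      show ?case
      proof (rule ccontr)
        assume "\<not> ?I m < a"
        then have "a\<^sup>2 \<le> (?I m)\<^sup>2" by (intro power_mono) auto
        then show False using elim by simp
      qed
    qed
  qed auto
qed

text \<open>The error is at most |B| times the integral of |f - F m|, which tends to 0 because the
  total mass is finite.\<close>

lemma integral_mult_tendsto:
  fixes f :: "'a \<Rightarrow> complex"
  assumes M: "finite_measure M" and f: "square_integrable M f" "\<And>m. square_integrable M (F m)"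
    and lim: "(\<lambda>m. L2_sq M (\<lambda>x. f x - F m x)) \<longlonglongrightarrow> 0"
    and b: "b \<in> borel_measurable M" "\<And>x. x \<in> space M \<Longrightarrow> cmod (b x) \<le> B"
  shows "(\<lambda>m. LINT x|M. F m x * b x) \<longlonglongrightarrow> (LINT x|M. f x * b x)"
proof -
  have int: "integrable M f" "integrable M (F m)" for m
    using square_integrable_imp_integrable[OF M] f by auto
  have intb: "integrable M (\<lambda>x. f x * b x)" "integrable M (\<lambda>x. F m x * b x)" for m
    using int b by (auto intro!: integrable_mult_bounded)
  let ?I = "\<lambda>m. \<integral>\<^sup>+x. ennreal (cmod (f x - F m x)) \<partial>M"
  have I0: "?I \<longlonglongrightarrow> 0"
    by (rule nn_integral_norm_tendsto_0[OF M _ lim]) (use int in auto)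
  have bound: "ennreal (cmod ((LINT x|M. F m x * b x) - (LINT x|M. f x * b x))) \<le> ennreal \<bar>B\<bar> * ?I m" for m
  proof -
    have "(LINT x|M. f x * b x) - (LINT x|M. F m x * b x) = (LINT x|M. (f x - F m x) * b x)"
      using intb by (simp add: left_diff_distrib)
    then have "ennreal (cmod ((LINT x|M. F m x * b x) - (LINT x|M. f x * b x))) = ennreal (cmod (LINT x|M. (f x - F m x) * b x))"
      by (metis norm_minus_commute)
    also have "\<dots> \<le> (\<integral>\<^sup>+x. ennreal (cmod ((f x - F m x) * b x)) \<partial>M)"
      by (rule integral_norm_bound_ennreal) (use intb in \<open>simp add: left_diff_distrib\<close>)
    also have "\<dots> \<le> (\<integral>\<^sup>+x. ennreal \<bar>B\<bar> * ennreal (cmod (f x - F m x)) \<partial>M)"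
    proof (rule nn_integral_mono)
      fix x assume "x \<in> space M"
      then have "cmod (b x) \<le> \<bar>B\<bar>" using b(2) by force
      then have "cmod ((f x - F m x) * b x) \<le> \<bar>B\<bar> * cmod (f x - F m x)"
        by (simp add: norm_mult mult.commute mult_right_mono)
      then show "ennreal (cmod ((f x - F m x) * b x)) \<le> ennreal \<bar>B\<bar> * ennreal (cmod (f x - F m x))"
        by (simp add: ennreal_mult[symmetric] ennreal_leI)
    qed
    also have "\<dots> = ennreal \<bar>B\<bar> * ?I m"
      using int by (intro nn_integral_cmult) auto
    finally show ?thesis .
  qed
  have "(\<lambda>m. ennreal \<bar>B\<bar> * ?I m) \<longlonglongrightarrow> ennreal \<bar>B\<bar> * 0"
    by (intro tendsto_mult_ennreal tendsto_const I0) auto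
  then have "(\<lambda>m. ennreal (cmod ((LINT x|M. F m x * b x) - (LINT x|M. f x * b x)))) \<longlonglongrightarrow> ennreal 0"
    using ennreal_tendsto_0_le[OF _ bound] by simp
  then have "(\<lambda>m. cmod ((LINT x|M. F m x * b x) - (LINT x|M. f x * b x))) \<longlonglongrightarrow> 0"
    by (subst (asm) tendsto_ennreal_iff) auto
  then show ?thesis by (simp add: tendsto_norm_zero_iff LIM_zero_iff)
qed

section \<open>The source identity\<close>

lemma tendsto_0_if_le:
  fixes f :: "nat \<Rightarrow> complex" and e :: "nat \<Rightarrow> ennreal"
  assumes "\<And>m. ennreal (cmod (f m)) \<le> e m" "e \<longlonglongrightarrow> 0"
  shows "f \<longlonglongrightarrow> 0"
proof -
  have "(\<lambda>m. ennreal (cmod (f m))) \<longlonglongrightarrow> ennreal 0"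
    using ennreal_tendsto_0_le[OF assms(2,1)] by simp
  then have "(\<lambda>m. cmod (f m)) \<longlonglongrightarrow> 0"
    by (subst (asm) tendsto_ennreal_iff) auto
  then show ?thesis by (rule tendsto_norm_zero_cancel)
qed

text \<open>On the bounded set \<Omega> the smooth \<open>w\<close> and its derivatives are bounded,
  so Sobolev convergence passes to the limit in each integral. The approximants are expressed
  through classical derivatives, which is the form that Green's inequality can treat.\<close>

lemma helmholtz_form_smooth_limit:
  assumes \<Omega>: "open \<Omega>" "bounded \<Omega>" and u: "u \<in> H1 \<Omega>" and w: "smooth w" and v: "\<And>m. smooth (v m)"
    and lim: "(\<lambda>m. H1_sq \<Omega> (\<lambda>x. u x - v m x)) \<longlonglongrightarrow> 0"
  shows "(\<lambda>m. (\<Sum>i\<in>UNIV. LINT x|lebesgue_on \<Omega>. pderiv2 i (v m) x * pderiv2 i w x)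
            - complex_of_real (k\<^sup>2) * (LINT x|lebesgue_on \<Omega>. v m x * w x)) \<longlonglongrightarrow> helmholtz_form \<Omega> k u w"
proof -
  let ?M = "lebesgue_on \<Omega>"
  have fin: "finite_measure ?M" by (rule finite_measure_lebesgue_on[OF \<Omega>])
  have gu: "square_integrable ?M u" "\<And>i. square_integrable ?M (\<lambda>x. grad \<Omega> u x $ i)"
    using u grad_is_weak_gradient[OF u] by (auto simp: H1_def is_weak_gradient_def)
  have gw: "\<And>i. square_integrable ?M (\<lambda>x. grad \<Omega> w x $ i)"
    using grad_is_weak_gradient[OF smooth_in_H1(1)[OF \<Omega> w]] by (auto simp: is_weak_gradient_def)
  have sv: "square_integrable ?M (v m)" "square_integrable ?M (pderiv2 i (v m))" for m i
    using \<Omega> v smooth_pderiv2 by (auto intro!: square_integrable_continuous smooth_imp_continuous)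
  have bd: "\<exists>B. \<forall>x\<in>space ?M. cmod (b x) \<le> B" if "continuous_on UNIV b" for b :: "real^2 \<Rightarrow> complex"
  proof -
    have "bounded (b ` closure \<Omega>)"
      using \<Omega> by (intro compact_imp_bounded compact_continuous_image continuous_on_subset[OF that]) auto
    then obtain B where "\<And>x. x \<in> closure \<Omega> \<Longrightarrow> cmod (b x) \<le> B" by (auto simp: bounded_iff)
    then show ?thesis using closure_subset[of \<Omega>] by (intro exI[of _ B]) (auto simp: space_restrict_space)
  qed
  have 1: "(\<lambda>m. LINT x|?M. v m x * w x) \<longlonglongrightarrow> (LINT x|?M. u x * w x)"
  proof -
    have "(\<lambda>m. L2_sq ?M (\<lambda>x. u x - v m x)) \<longlonglongrightarrow> 0"
      by (rule ennreal_tendsto_0_le[OF lim]) (simp add: H1_sq_def)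
    moreover obtain B where "\<forall>x\<in>space ?M. cmod (w x) \<le> B" using bd smooth_imp_continuous[OF w] by blast
    ultimately show ?thesis
      by (intro integral_mult_tendsto[OF fin gu(1) sv(1)] continuous_measurable_lebesgue_on smooth_imp_continuous[OF w]) auto
  qed
  have 2: "(\<lambda>m. LINT x|?M. pderiv2 i (v m) x * pderiv2 i w x) \<longlonglongrightarrow> (LINT x|?M. grad \<Omega> u x $ i * pderiv2 i w x)" for i
  proof -
    have "L2_sq ?M (\<lambda>x. grad \<Omega> (\<lambda>x. u x - v m x) x $ i) = L2_sq ?M (\<lambda>x. grad \<Omega> u x $ i - pderiv2 i (v m) x)" for m
      by (rule L2_sq_cong_AE) (use grad_diff_smooth[OF \<Omega> u v[of m]] in \<open>auto elim!: eventually_mono\<close>)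
    moreover have "L2_sq ?M (\<lambda>x. grad \<Omega> (\<lambda>x. u x - v m x) x $ i) \<le> H1_sq \<Omega> (\<lambda>x. u x - v m x)" for m
      unfolding H1_sq_def by (intro add_increasing member_le_sum) auto
    ultimately have "(\<lambda>m. L2_sq ?M (\<lambda>x. grad \<Omega> u x $ i - pderiv2 i (v m) x)) \<longlonglongrightarrow> 0"
      by (intro ennreal_tendsto_0_le[OF lim]) auto
    moreover obtain B where "\<forall>x\<in>space ?M. cmod (pderiv2 i w x) \<le> B"
      using bd smooth_imp_continuous[OF smooth_pderiv2[OF w]] by blast
    ultimately show ?thesis
      by (intro integral_mult_tendsto[OF fin gu(2) sv(2)] continuous_measurable_lebesgue_on smooth_imp_continuous smooth_pderiv2 w) auto
  qed
  have int: "integrable ?M (\<lambda>x. grad \<Omega> u x $ i * pderiv2 i w x)" for i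
    by (rule integrable_mult_continuous[OF \<Omega> gu(2) smooth_imp_continuous[OF smooth_pderiv2[OF w]]])
  have "(LINT x|?M. bdot (grad \<Omega> u x) (grad \<Omega> w x)) = (LINT x|?M. (\<Sum>i\<in>UNIV. grad \<Omega> u x $ i * pderiv2 i w x))"
  proof (rule integral_cong_AE)
    show "(\<lambda>x. bdot (grad \<Omega> u x) (grad \<Omega> w x)) \<in> borel_measurable ?M"
      using gu gw unfolding bdot_def square_integrable_def by (intro borel_measurable_sum borel_measurable_times) auto
    show "(\<lambda>x. \<Sum>i\<in>UNIV. grad \<Omega> u x $ i * pderiv2 i w x) \<in> borel_measurable ?M"
      using int by (intro borel_measurable_sum) auto
    show "AE x in ?M. bdot (grad \<Omega> u x) (grad \<Omega> w x) = (\<Sum>i\<in>UNIV. grad \<Omega> u x $ i * pderiv2 i w x)"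
      using smooth_in_H1(2)[OF \<Omega> w] by eventually_elim (simp add: bdot_def)
  qed
  also have "\<dots> = (\<Sum>i\<in>UNIV. LINT x|?M. grad \<Omega> u x $ i * pderiv2 i w x)"
    using int by (intro Bochner_Integration.integral_sum) auto
  finally have "helmholtz_form \<Omega> k u w = (\<Sum>i\<in>UNIV. LINT x|?M. grad \<Omega> u x $ i * pderiv2 i w x) - complex_of_real (k\<^sup>2) * (LINT x|?M. u x * w x)"
    by (simp add: helmholtz_form_def)
  then show ?thesis using 1 2 by (auto intro!: tendsto_diff tendsto_sum tendsto_mult)
qed

text \<open>
  The difference of smooth approximations of \<open>u1\<close> and \<open>u2\<close> tends to 0 on the boundary, which controls the
  boundary term of Green's formula.
\<close>
lemma helmholtz_form_eq_of_trace_eq: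
  assumes \<Omega>: "lipschitz_domain \<Omega>" and u1: "has_trace \<Omega> u1 g" and u2: "has_trace \<Omega> u2 g"
    and w: "smooth w" and hw: "\<And>x. (\<Sum>i\<in>UNIV. pderiv2 i (pderiv2 i w) x) = - complex_of_real (k\<^sup>2) * w x"
  shows "helmholtz_form \<Omega> k u1 w = helmholtz_form \<Omega> k u2 w"
proof -
  let ?M = "lebesgue_on \<Omega>" and ?A = "arc_measure (frontier \<Omega>)"
  have op: "open \<Omega>" "bounded \<Omega>" using \<Omega> by (auto simp: lipschitz_domain_def)
  obtain B where B: "\<And>f i. C_k 1 f \<Longrightarrow> ennreal (cmod (LINT x|?M. pderiv2 i f x)) \<le> ennreal B * (\<integral>\<^sup>+x. ennreal (cmod (f x)) \<partial>?A)"
    and finA: "finite_measure ?A"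
    using green_inequality[OF \<Omega>] by metis
  obtain v1 where v1: "\<And>m. smooth (v1 m)" "(\<lambda>m. H1_sq \<Omega> (\<lambda>x. u1 x - v1 m x)) \<longlonglongrightarrow> 0" "(\<lambda>m. L2_sq ?A (\<lambda>x. g x - v1 m x)) \<longlonglongrightarrow> 0"
    using u1 unfolding has_trace_def by blast
  obtain v2 where v2: "\<And>m. smooth (v2 m)" "(\<lambda>m. H1_sq \<Omega> (\<lambda>x. u2 x - v2 m x)) \<longlonglongrightarrow> 0" "(\<lambda>m. L2_sq ?A (\<lambda>x. g x - v2 m x)) \<longlonglongrightarrow> 0"
    using u2 unfolding has_trace_def by blast
  have g: "g \<in> borel_measurable ?A" using u1 by (auto simp: has_trace_def square_integrable_def)
  define P where "P v = (\<Sum>i\<in>UNIV. LINT x|?M. pderiv2 i v x * pderiv2 i w x) - complex_of_real (k\<^sup>2) * (LINT x|?M. v x * w x)" for v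
  have lim: "(\<lambda>m. P (v1 m) - P (v2 m)) \<longlonglongrightarrow> helmholtz_form \<Omega> k u1 w - helmholtz_form \<Omega> k u2 w"
    unfolding P_def using u1 u2
    by (intro tendsto_diff[of "\<lambda>m. (\<Sum>i\<in>UNIV. LINT x|?M. pderiv2 i (v1 m) x * pderiv2 i w x) - complex_of_real (k\<^sup>2) * (LINT x|?M. v1 m x * w x)"]
      helmholtz_form_smooth_limit op w v1 v2) (auto simp: has_trace_def)
  note c = smooth_imp_continuous and pd = smooth_pderiv2
  \<comment> \<open>With y = v1 - v2 and the Helmholtz equation for w, the integrand is the
    divergence of y times the gradient of w.\<close>
  have Pdiff: "P (v1 m) - P (v2 m) = (\<Sum>i\<in>UNIV. LINT x|?M. pderiv2 i (\<lambda>x. (v1 m x - v2 m x) * pderiv2 i w x) x)" for m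
  proof -
    define y where "y x = v1 m x - v2 m x" for x
    have y: "smooth y" unfolding y_def using v1 v2 by (intro smooth_diff)
    have y1: "pderiv2 i (v1 m) x = pderiv2 i y x + pderiv2 i (v2 m) x" for i x
    proof -
      have "pderiv2 i (\<lambda>x. y x + v2 m x) x = pderiv2 i y x + pderiv2 i (v2 m) x"
        by (intro pderiv2_add C1_differentiable smooth_imp_C1 y v2)
      then show ?thesis by (simp add: y_def)
    qed
    have int: "integrable ?M (\<lambda>x. f x * h x)" if "smooth f" "smooth h" for f h
      using op c[OF smooth_mult[OF that]] by (intro integrable_continuous_bounded) auto
    have "P (v1 m) - P (v2 m) = (\<Sum>i\<in>UNIV. LINT x|?M. pderiv2 i y x * pderiv2 i w x) - complex_of_real (k\<^sup>2) * (LINT x|?M. y x * w x)"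
    proof -
      have a: "(LINT x|?M. pderiv2 i (v1 m) x * pderiv2 i w x)
          = (LINT x|?M. pderiv2 i y x * pderiv2 i w x) + (LINT x|?M. pderiv2 i (v2 m) x * pderiv2 i w x)" for i
        unfolding y1 distrib_right by (intro Bochner_Integration.integral_add int pd v2 w y)
      have b: "(LINT x|?M. y x * w x) = (LINT x|?M. v1 m x * w x) - (LINT x|?M. v2 m x * w x)"
        unfolding y_def left_diff_distrib by (intro Bochner_Integration.integral_diff int v1 v2 w)
      show ?thesis unfolding P_def a b by (simp add: sum.distrib algebra_simps)
    qed
    also have "\<dots> = (LINT x|?M. (\<Sum>i\<in>UNIV. pderiv2 i y x * pderiv2 i w x) - complex_of_real (k\<^sup>2) * (y x * w x))"
      using int y w pd by (subst Bochner_Integration.integral_diff) (auto simp: Bochner_Integration.integral_sum)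
    also have "\<dots> = (LINT x|?M. (\<Sum>i\<in>UNIV. pderiv2 i (\<lambda>x. y x * pderiv2 i w x) x))"
    proof (rule Bochner_Integration.integral_cong[OF refl])
      fix x
      have "pderiv2 i (\<lambda>x. y x * pderiv2 i w x) x = y x * pderiv2 i (pderiv2 i w) x + pderiv2 i y x * pderiv2 i w x" for i
        using y w pd by (intro pderiv2_mult C1_differentiable smooth_imp_C1) auto
      then show "(\<Sum>i\<in>UNIV. pderiv2 i y x * pderiv2 i w x) - complex_of_real (k\<^sup>2) * (y x * w x) = (\<Sum>i\<in>UNIV. pderiv2 i (\<lambda>x. y x * pderiv2 i w x) x)"
        by (simp add: sum.distrib sum_distrib_left[symmetric] hw)
    qed
    also have "\<dots> = (\<Sum>i\<in>UNIV. LINT x|?M. pderiv2 i (\<lambda>x. y x * pderiv2 i w x) x)"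
      by (intro Bochner_Integration.integral_sum integrable_continuous_bounded c pd smooth_mult y w op)
    finally show ?thesis by (simp add: y_def)
  qed
  \<comment> \<open>The two smooth sequences are compared on the boundary through their common limit
    \<open>g\<close>.\<close>
  define I where "I m = (\<integral>\<^sup>+x. ennreal (cmod (g x - v1 m x)) \<partial>?A) + (\<integral>\<^sup>+x. ennreal (cmod (g x - v2 m x)) \<partial>?A)" for m
  have mv: "f \<in> borel_measurable ?A" if "smooth f" for f
    using c[OF that] by (intro borel_measurable_arc_measure borel_measurable_continuous_onI)
  have I0: "I \<longlonglongrightarrow> 0"
  proof -
    have "I \<longlonglongrightarrow> 0 + 0" unfolding I_def
      by (intro tendsto_add nn_integral_norm_tendsto_0 finA v1 v2 borel_measurable_diff g mv)
    then show ?thesis by simp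
  qed
  have "(\<lambda>m. LINT x|?M. pderiv2 i (\<lambda>x. (v1 m x - v2 m x) * pderiv2 i w x) x) \<longlonglongrightarrow> 0" for i
  proof -
    have "bounded (pderiv2 i w ` frontier \<Omega>)"
      using op by (intro compact_imp_bounded compact_continuous_image continuous_on_subset[OF c[OF pd[OF w]]])
        (auto simp: compact_frontier_bounded)
    then obtain W where W: "\<And>x. x \<in> frontier \<Omega> \<Longrightarrow> cmod (pderiv2 i w x) \<le> W" by (auto simp: bounded_iff)
    show ?thesis
    proof (rule tendsto_0_if_le)
      fix m
      have "C_k 1 (\<lambda>x. (v1 m x - v2 m x) * pderiv2 i w x)"
        using v1 v2 w pd by (intro smooth_imp_C1 smooth_mult smooth_diff) auto
      then have "ennreal (cmod (LINT x|?M. pderiv2 i (\<lambda>x. (v1 m x - v2 m x) * pderiv2 i w x) x))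
         \<le> ennreal B * (\<integral>\<^sup>+x. ennreal (cmod ((v1 m x - v2 m x) * pderiv2 i w x)) \<partial>?A)" by (rule B)
      also have "\<dots> \<le> ennreal B * (\<integral>\<^sup>+x. ennreal \<bar>W\<bar> * (ennreal (cmod (g x - v1 m x)) + ennreal (cmod (g x - v2 m x))) \<partial>?A)"
      proof (intro mult_left_mono nn_integral_mono)
        fix x assume "x \<in> space ?A"
        then have "cmod (pderiv2 i w x) \<le> \<bar>W\<bar>" using W by (force simp: space_arc_measure)
        moreover have "cmod (v1 m x - v2 m x) \<le> cmod (g x - v1 m x) + cmod (g x - v2 m x)"
          using norm_triangle_ineq4[of "g x - v2 m x" "g x - v1 m x"] by simp
        ultimately have "cmod (v1 m x - v2 m x) * cmod (pderiv2 i w x) \<le> (cmod (g x - v1 m x) + cmod (g x - v2 m x)) * \<bar>W\<bar>"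
          by (intro mult_mono) auto
        then have "cmod ((v1 m x - v2 m x) * pderiv2 i w x) \<le> \<bar>W\<bar> * cmod (g x - v1 m x) + \<bar>W\<bar> * cmod (g x - v2 m x)"
          by (simp only: norm_mult) (simp add: algebra_simps)
        then have "ennreal (cmod ((v1 m x - v2 m x) * pderiv2 i w x)) \<le> ennreal (\<bar>W\<bar> * cmod (g x - v1 m x) + \<bar>W\<bar> * cmod (g x - v2 m x))"
          by (rule ennreal_leI)
        then show "ennreal (cmod ((v1 m x - v2 m x) * pderiv2 i w x)) \<le> ennreal \<bar>W\<bar> * (ennreal (cmod (g x - v1 m x)) + ennreal (cmod (g x - v2 m x)))"
          by (simp only: ennreal_lincomb abs_ge_zero norm_ge_zero distrib_left)
      qed simp
      also have "\<dots> = ennreal B * (ennreal \<bar>W\<bar> * I m)"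
        unfolding I_def using g mv[OF v1(1)] mv[OF v2(1)] by (subst nn_integral_cmult) (auto simp: nn_integral_add)
      finally show "ennreal (cmod (LINT x|?M. pderiv2 i (\<lambda>x. (v1 m x - v2 m x) * pderiv2 i w x) x)) \<le> ennreal B * (ennreal \<bar>W\<bar> * I m)" .
    next
      have "(\<lambda>m. ennreal B * (ennreal \<bar>W\<bar> * I m)) \<longlonglongrightarrow> ennreal B * (ennreal \<bar>W\<bar> * 0)"
        by (intro tendsto_mult_ennreal tendsto_const I0) auto
      then show "(\<lambda>m. ennreal B * (ennreal \<bar>W\<bar> * I m)) \<longlonglongrightarrow> 0" by simp
    qed
  qed
  then have "(\<lambda>m. P (v1 m) - P (v2 m)) \<longlonglongrightarrow> (\<Sum>i\<in>(UNIV :: 2 set). 0)"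
    unfolding Pdiff by (intro tendsto_sum)
  then have "helmholtz_form \<Omega> k u1 w - helmholtz_form \<Omega> k u2 w = 0"
    using LIMSEQ_unique[OF lim] by simp
  then show ?thesis by simp
qed

text \<open>The constant sequence \<open>w\<close> serves as approximation, and finite length of the
  boundary makes \<open>w\<close> square integrable there. Even the Sobolev norm of the zero
  function takes an argument, since its \<open>grad\<close> is known only up to a null set.\<close>

lemma has_trace_smooth:
  assumes \<Omega>: "lipschitz_domain \<Omega>" and w: "smooth w"
  shows "has_trace \<Omega> w w"
proof -
  have op: "open \<Omega>" "bounded \<Omega>" using \<Omega> by (auto simp: lipschitz_domain_def)
  interpret A: finite_measure "arc_measure (frontier \<Omega>)" using green_inequality[OF \<Omega>] by metis
  have mw: "w \<in> borel_measurable (arc_measure (frontier \<Omega>))"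
    using smooth_imp_continuous[OF w] by (intro borel_measurable_arc_measure borel_measurable_continuous_onI)
  have "bounded (w ` frontier \<Omega>)"
    using op by (intro compact_imp_bounded compact_continuous_image continuous_on_subset[OF smooth_imp_continuous[OF w]])
      (auto simp: compact_frontier_bounded)
  then obtain W where W: "\<And>x. x \<in> frontier \<Omega> \<Longrightarrow> cmod (w x) \<le> W" by (auto simp: bounded_iff)
  have "L2_sq (arc_measure (frontier \<Omega>)) w \<le> (\<integral>\<^sup>+x. ennreal (W\<^sup>2) \<partial>arc_measure (frontier \<Omega>))"
    unfolding L2_sq_def using W by (intro nn_integral_mono ennreal_leI power_mono) (auto simp: space_arc_measure)
  also have "\<dots> < \<infinity>" using A.finite_emeasure_space
    by (simp add: ennreal_mult_eq_top_iff top.not_eq_extremum[symmetric])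
  finally have sq: "square_integrable (arc_measure (frontier \<Omega>)) w" using mw by (simp add: square_integrable_def)
  have "AE x in lebesgue_on \<Omega>. grad \<Omega> (\<lambda>x. 0) x = 0"
    using smooth_in_H1(2)[OF op smooth_const[of 0]]
  proof eventually_elim
    case (elim x)
    have "pderiv2 i (\<lambda>x. 0) x = 0" for i by (rule pderiv2_eqI[of "\<lambda>x. 0" "\<lambda>x. 0"]) simp
    then show ?case using elim by (simp add: vec_eq_iff)
  qed
  then have "L2_sq (lebesgue_on \<Omega>) (\<lambda>x. grad \<Omega> (\<lambda>x. 0) x $ i) = L2_sq (lebesgue_on \<Omega>) (\<lambda>x. 0)" for i
    by (intro L2_sq_cong_AE) (auto elim!: eventually_mono)
  then have "H1_sq \<Omega> (\<lambda>x. 0) = 0" by (simp add: H1_sq_def L2_sq_def)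
  then show ?thesis
    unfolding has_trace_def using sq w smooth_in_H1(1)[OF op w]
    by (auto intro!: exI[of _ "\<lambda>_. w"] simp: L2_sq_def)
qed

lemma AE_lebesgue_on_subset:
  assumes "open D" "open \<Omega>" "D \<subseteq> \<Omega>" "AE x in lebesgue_on \<Omega>. P x"
  shows "AE x in lebesgue_on D. P x"
  using assms by (auto simp: AE_restrict_space_iff elim!: eventually_mono)

text \<open>The two functions agree near every point of \<open>D\<close>, hence so do their
  derivatives. It is applied to a cutoff times w, and with w = 0 to locate the support of the
  source.\<close>

lemma div_source_smooth:
  assumes \<Omega>: "open \<Omega>" "bounded \<Omega>" and D: "open D" "D \<subseteq> \<Omega>" and \<rho>: "square_integrable (lebesgue_on D) \<rho>"
    and \<phi>: "smooth \<phi>" and w: "smooth w" and U: "open U" "D \<subseteq> U" "\<And>x. x \<in> U \<Longrightarrow> \<phi> x = w x"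
  shows "div_source \<Omega> D \<rho> a \<phi> = - (LINT x|lebesgue_on D. \<rho> x * (\<Sum>i\<in>UNIV. complex_of_real (a $ i) * pderiv2 i w x))"
proof -
  have gm: "(\<lambda>x. grad \<Omega> \<phi> x $ i) \<in> borel_measurable (lebesgue_on D)" for i
  proof -
    have "(\<lambda>x. grad \<Omega> \<phi> x $ i) \<in> borel_measurable (lebesgue_on \<Omega>)"
      using grad_is_weak_gradient[OF smooth_in_H1(1)[OF \<Omega> \<phi>]] by (auto simp: is_weak_gradient_def square_integrable_def)
    then show ?thesis using D(2) by (rule measurable_restrict_mono)
  qed
  have rm: "\<rho> \<in> borel_measurable (lebesgue_on D)" using \<rho> by (simp add: square_integrable_def)
  have "(LINT x|lebesgue_on D. \<rho> x * bdot (\<chi> i. complex_of_real (a $ i)) (grad \<Omega> \<phi> x))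
      = (LINT x|lebesgue_on D. \<rho> x * (\<Sum>i\<in>UNIV. complex_of_real (a $ i) * pderiv2 i w x))"
  proof (rule integral_cong_AE)
    show "(\<lambda>x. \<rho> x * bdot (\<chi> i. complex_of_real (a $ i)) (grad \<Omega> \<phi> x)) \<in> borel_measurable (lebesgue_on D)"
      unfolding bdot_def by (intro borel_measurable_times rm borel_measurable_sum gm) auto
    show "(\<lambda>x. \<rho> x * (\<Sum>i\<in>UNIV. complex_of_real (a $ i) * pderiv2 i w x)) \<in> borel_measurable (lebesgue_on D)"
      by (intro borel_measurable_times rm borel_measurable_sum continuous_measurable_lebesgue_on smooth_imp_continuous
          smooth_mult smooth_const smooth_pderiv2 w)
    have "AE x in lebesgue_on D. grad \<Omega> \<phi> x = (\<chi> i. pderiv2 i \<phi> x)"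
      by (rule AE_lebesgue_on_subset[OF D(1) \<Omega>(1) D(2) smooth_in_H1(2)[OF \<Omega> \<phi>]])
    moreover have "AE x in lebesgue_on D. x \<in> D" by (intro AE_I2) (simp add: space_restrict_space)
    ultimately show "AE x in lebesgue_on D. \<rho> x * bdot (\<chi> i. complex_of_real (a $ i)) (grad \<Omega> \<phi> x) = \<rho> x * (\<Sum>i\<in>UNIV. complex_of_real (a $ i) * pderiv2 i w x)"
    proof eventually_elim
      case (elim x)
      have "pderiv2 i \<phi> x = pderiv2 i w x" for i
        using U elim(2) by (intro pderiv2_cong_open[of U]) (auto intro!: C1_differentiable smooth_imp_C1 w)
      then show ?case using elim by (simp add: bdot_def)
    qed
  qed
  then show ?thesis by (simp add: div_source_def)
qed

text \<open>Test functions supported off the closure of \<open>D\<close> are annihilated. A cutoff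
  equal to 1 near the closures of both polygons is therefore legitimate in both Neumann
  derivatives.\<close>

lemma source_support_subset:
  assumes \<Omega>: "open \<Omega>" "bounded \<Omega>" and D: "open D" "D \<subseteq> \<Omega>" and \<rho>: "square_integrable (lebesgue_on D) \<rho>"
  shows "source_support \<Omega> (div_source \<Omega> D \<rho> a) \<subseteq> closure D"
proof -
  have "div_source \<Omega> D \<rho> a \<phi> = 0" if "test_function (\<Omega> - closure D) \<phi>" for \<phi>
  proof -
    note \<phi> = test_function_props[OF that]
    have "\<phi> x = 0" if "x \<in> D" for x
    proof (rule ccontr)
      assume "\<phi> x \<noteq> 0"
      then have "x \<in> closure {x. \<phi> x \<noteq> 0}" using closure_subset[of "{x. \<phi> x \<noteq> 0}"] by auto
      then show False using \<phi>(4) closure_subset[of D] \<open>x \<in> D\<close> by blast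
    qed
    then have "div_source \<Omega> D \<rho> a \<phi> = - (LINT x|lebesgue_on D. \<rho> x * (\<Sum>i\<in>UNIV. complex_of_real (a $ i) * pderiv2 i (\<lambda>x. 0) x))"
      by (intro div_source_smooth[OF \<Omega> D \<rho> \<phi>(1) smooth_const D(1)]) auto
    moreover have "pderiv2 i (\<lambda>x. 0) x = 0" for i x by (rule pderiv2_eqI[of "\<lambda>x. 0" "\<lambda>x. 0"]) simp
    ultimately show ?thesis by simp
  qed
  moreover have "open (\<Omega> - closure D)" using \<Omega> by (simp add: open_Diff)
  ultimately show ?thesis unfolding source_support_def by blast
qed

text \<open>The smooth function \<open>w\<close> is its own trace, so the common functional
  \<open>h\<close> may be evaluated at it for both solutions. The values of the Helmholtz form
  coincide, and only the source terms remain.\<close>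

lemma source_identity:
  fixes \<zeta> :: "complex^2"
  assumes \<Omega>: "lipschitz_domain \<Omega>"
    and D1: "open D1" "closure D1 \<subseteq> \<Omega>" "square_integrable (lebesgue_on D1) \<rho>1"
    and D2: "open D2" "closure D2 \<subseteq> \<Omega>" "square_integrable (lebesgue_on D2) \<rho>2"
    and c1: "has_cauchy_data \<Omega> k (div_source \<Omega> D1 \<rho>1 a1) u1 g h"
    and c2: "has_cauchy_data \<Omega> k (div_source \<Omega> D2 \<rho>2 a2) u2 g h"
    and \<zeta>: "bdot \<zeta> \<zeta> = - complex_of_real (k\<^sup>2)"
  defines "w \<equiv> \<lambda>x. exp (\<Sum>i\<in>UNIV. \<zeta> $ i * complex_of_real (x $ i))"
  shows "(\<Sum>i\<in>UNIV. complex_of_real (a1 $ i) * \<zeta> $ i) * (LINT x|lebesgue_on D1. \<rho>1 x * w x)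
       = (\<Sum>i\<in>UNIV. complex_of_real (a2 $ i) * \<zeta> $ i) * (LINT x|lebesgue_on D2. \<rho>2 x * w x)"
proof -
  have op: "open \<Omega>" "bounded \<Omega>" using \<Omega> by (auto simp: lipschitz_domain_def)
  have w: "smooth w" and pw: "pderiv2 i w = (\<lambda>x. \<zeta> $ i * w x)" for i
    unfolding w_def by (fact smooth_exp_linear)+
  \<comment> \<open>The condition on \<zeta> is the Helmholtz equation for the exponential.\<close>
  have hw: "(\<Sum>i\<in>UNIV. pderiv2 i (pderiv2 i w) x) = - complex_of_real (k\<^sup>2) * w x" for x
  proof -
    have "pderiv2 i (\<lambda>x. \<zeta> $ i * w x) x = \<zeta> $ i * \<zeta> $ i * w x" for i
    proof -
      have "pderiv2 i (\<lambda>x. \<zeta> $ i * w x) x = \<zeta> $ i * pderiv2 i w x + pderiv2 i (\<lambda>x. \<zeta> $ i) x * w x"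
        by (intro pderiv2_mult C1_differentiable smooth_imp_C1 smooth_const w)
      moreover have "pderiv2 i (\<lambda>x. \<zeta> $ i) x = 0" by (rule pderiv2_eqI[of "\<lambda>x. \<zeta> $ i" "\<lambda>x. 0"]) simp
      ultimately show ?thesis by (simp add: pw)
    qed
    then show ?thesis using \<zeta> by (simp add: pw bdot_def sum_distrib_right[symmetric])
  qed
  define K where "K = closure D1 \<union> closure D2"
  have sub: "D1 \<subseteq> \<Omega>" "D2 \<subseteq> \<Omega>" using D1 D2 closure_subset by blast+
  have "compact K" unfolding K_def using bounded_subset[OF op(2) sub(1)] bounded_subset[OF op(2) sub(2)]
    by (intro compact_Un) (simp_all add: compact_closure)
  moreover have "K \<subseteq> \<Omega>" using D1 D2 by (simp add: K_def)
  ultimately obtain \<psi> U where \<psi>: "test_function \<Omega> \<psi>" "open U" "K \<subseteq> U" "\<And>x. x \<in> U \<Longrightarrow> \<psi> x = 1"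
    using exists_cutoff[of K \<Omega>] op(1) by metis
  \<comment> \<open>Stated for a general source so that it applies to both. The factor a . \<zeta>
    comes from differentiating the exponential, the sign from \<open>div_source\<close>.\<close>
  have val: "h w = helmholtz_form \<Omega> k u w - (\<Sum>i\<in>UNIV. complex_of_real (a $ i) * \<zeta> $ i) * (LINT x|lebesgue_on D. \<rho> x * w x)"
    if c: "has_cauchy_data \<Omega> k (div_source \<Omega> D \<rho> a) u g h" and D: "open D" "D \<subseteq> \<Omega>" "closure D \<subseteq> K" "square_integrable (lebesgue_on D) \<rho>"
    for D \<rho> a u
  proof -
    have cut: "cutoff \<Omega> (div_source \<Omega> D \<rho> a) \<psi>"
      unfolding cutoff_def using \<psi> source_support_subset[OF op D(1,2,4), of a] D(3) by blast
    have "h w = helmholtz_form \<Omega> k u w + div_source \<Omega> D \<rho> a (\<lambda>x. \<psi> x * w x)"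
      using c cut has_trace_smooth[OF \<Omega> w] unfolding has_cauchy_data_def has_neumann_derivative_def by blast
    also have "div_source \<Omega> D \<rho> a (\<lambda>x. \<psi> x * w x) = - (LINT x|lebesgue_on D. \<rho> x * (\<Sum>i\<in>UNIV. complex_of_real (a $ i) * pderiv2 i w x))"
      using \<psi> D closure_subset[of D]
      by (intro div_source_smooth[OF op D(1,2,4) smooth_mult[OF test_function_props(1)[OF \<psi>(1)] w] w \<psi>(2)]) auto
    also have "(LINT x|lebesgue_on D. \<rho> x * (\<Sum>i\<in>UNIV. complex_of_real (a $ i) * pderiv2 i w x))
        = (LINT x|lebesgue_on D. (\<Sum>i\<in>UNIV. complex_of_real (a $ i) * \<zeta> $ i) * (\<rho> x * w x))"
      by (intro Bochner_Integration.integral_cong) (simp_all add: pw sum_2 algebra_simps)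
    finally show ?thesis by simp
  qed
  have "helmholtz_form \<Omega> k u1 w = helmholtz_form \<Omega> k u2 w"
    using c1 c2 by (intro helmholtz_form_eq_of_trace_eq[OF \<Omega> _ _ w hw]) (auto simp: has_cauchy_data_def)
  then show ?thesis
    using val[OF c1 D1(1) sub(1) _ D1(3)] val[OF c2 D2(1) sub(2) _ D2(3)] by (auto simp: K_def)
qed

section \<open>Corners of polygons\<close>

text \<open>A linear bijection maps components of the complement onto components of the complement
  of the image, and both it and its inverse preserve boundedness. This carries the Jordan curve
  theorem from the complex plane to \<open>real^2\<close>.\<close>

lemma inside_linear_image:
  fixes T :: "'a::euclidean_space \<Rightarrow> 'b::euclidean_space"
  assumes T: "linear T" "bij T"
  shows "inside (T ` S) = T ` inside S"
proof -
  have inj: "inj T" and surj: "surj T" using T by (auto simp: bij_def)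
  obtain T' where T'l: "linear T'" and "T' \<circ> T = id"
    using linear_injective_left_inverse[OF T(1) inj] by blast
  then have TT': "T' (T x) = x" "T (T' y) = y" for x y
    using surj by (metis comp_apply id_apply, metis comp_apply id_apply surjD)
  have comp: "f ` connected_component_set (- S) x \<subseteq> connected_component_set (- (f ` S)) (f x)"
    if "linear f" "inj f" "x \<notin> S" for f :: "'c::euclidean_space \<Rightarrow> 'd::euclidean_space" and S x
  proof (rule connected_component_maximal)
    show "f x \<in> f ` connected_component_set (- S) x" using that by (auto simp: connected_component_refl)
    show "connected (f ` connected_component_set (- S) x)"
      using that by (intro connected_continuous_image linear_continuous_on connected_connected_component)
        (auto simp: linear_conv_bounded_linear)
    show "f ` connected_component_set (- S) x \<subseteq> - (f ` S)"
      using connected_component_subset[of "- S" x] that(2) by (force simp: inj_def)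
  qed
  have "T x \<in> inside (T ` S) \<longleftrightarrow> x \<in> inside S" for x
  proof (cases "x \<in> S")
    case True
    then show ?thesis using inside_no_overlap[of S] inside_no_overlap[of "T ` S"] by blast
  next
    case False
    then have TxS: "T x \<notin> T ` S" using inj by (auto simp: inj_def)
    have 1: "T ` connected_component_set (- S) x \<subseteq> connected_component_set (- (T ` S)) (T x)"
      by (rule comp[OF T(1) inj False])
    have inj': "inj T'" using TT' by (metis injI)
    have im: "T' ` T ` S = S" using TT' by (force simp: image_iff)
    have 2: "T' ` connected_component_set (- (T ` S)) (T x) \<subseteq> connected_component_set (- S) x"
      using comp[OF T'l inj' TxS] unfolding im TT' .
    have "bounded (connected_component_set (- S) x) \<longleftrightarrow> bounded (connected_component_set (- (T ` S)) (T x))"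
    proof
      assume "bounded (connected_component_set (- S) x)"
      then have "bounded (T ` connected_component_set (- S) x)"
        using T(1) by (intro bounded_linear_image) (auto simp: linear_conv_bounded_linear)
      moreover have "connected_component_set (- (T ` S)) (T x) \<subseteq> T ` connected_component_set (- S) x"
        using 2 TT' by (metis image_eqI image_subset_iff subsetI)
      ultimately show "bounded (connected_component_set (- (T ` S)) (T x))" by (rule bounded_subset)
    next
      assume "bounded (connected_component_set (- (T ` S)) (T x))"
      then have "bounded (T' ` connected_component_set (- (T ` S)) (T x))"
        using T'l by (intro bounded_linear_image) (auto simp: linear_conv_bounded_linear)
      moreover have "connected_component_set (- S) x \<subseteq> T' ` connected_component_set (- (T ` S)) (T x)"
        using 1 TT' by (metis image_eqI image_subset_iff subsetI)
      ultimately show "bounded (connected_component_set (- S) x)" by (rule bounded_subset)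
    qed
    then show ?thesis using False TxS by (simp add: inside_def)
  qed
  then show ?thesis using surj by (auto simp: image_iff surj_def) metis
qed

text \<open>In the complex plane a Jordan curve is the frontier of its inside; the coordinate map
  \<open>T\<close> transports this.\<close>

lemma Jordan_curve_subset_closure_inside:
  fixes c :: "real \<Rightarrow> real^2"
  assumes c: "simple_path c" "pathfinish c = pathstart c"
  shows "path_image c \<subseteq> closure (inside (path_image c))"
proof -
  define T :: "real^2 \<Rightarrow> complex" where "T x = Complex (x $ 1) (x $ 2)" for x
  have lin: "linear T" by (rule linearI) (auto simp: T_def complex_eq_iff)
  have inj: "inj T" by (auto simp: inj_def T_def vec_eq_iff forall_2)
  have surj: "surj T" unfolding surj_def
  proof
    fix z show "\<exists>x. z = T x"
      by (rule exI[of _ "vector [Re z, Im z]"]) (simp add: T_def)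
  qed
  have pi: "path_image (T \<circ> c) = T ` path_image c" by (rule path_image_compose)
  have "simple_path (T \<circ> c)" using c(1) lin inj by (simp add: simple_path_linear_image_eq)
  moreover have "pathfinish (T \<circ> c) = pathstart (T \<circ> c)" using c(2) by (simp add: pathfinish_compose pathstart_compose)
  ultimately have "frontier (inside (path_image (T \<circ> c))) = path_image (T \<circ> c)"
    using Jordan_inside_outside by blast
  then have "T ` path_image c \<subseteq> closure (T ` inside (path_image c))"
    unfolding pi inside_linear_image[OF lin bijI[OF inj surj]] by (auto simp: frontier_def)
  also have "\<dots> = T ` closure (inside (path_image c))"
    by (rule closure_injective_linear_image[OF lin inj, symmetric])
  finally show ?thesis using inj by (simp add: inj_image_subset_iff)
qed

section \<open>Closed polylines and their vertices\<close>

lemma pathstart_polyline: "pathstart (polyline (x # xs)) = x"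
  by (induction "x # xs" arbitrary: x xs rule: polyline.induct) auto

lemma pathfinish_polyline: "xs \<noteq> [] \<Longrightarrow> pathfinish (polyline xs) = last xs"
  by (induction xs rule: polyline.induct) auto

lemma path_image_polyline:
  "2 \<le> length xs \<Longrightarrow> path_image (polyline xs) = (\<Union>i<length xs - 1. closed_segment (xs ! i) (xs ! Suc i))"
proof (induction xs rule: polyline.induct)
  case (4 p q r ps)
  have "path_image (polyline (p # q # r # ps)) = closed_segment p q \<union> path_image (polyline (q # r # ps))"
    by (simp add: path_image_join pathstart_polyline)
  also have "path_image (polyline (q # r # ps)) = (\<Union>i<length (q # r # ps) - 1. closed_segment ((q # r # ps) ! i) ((q # r # ps) ! Suc i))"
    using 4 by simp
  also have "closed_segment p q \<union> \<dots> = (\<Union>i<Suc (length (q # r # ps) - 1). closed_segment ((p # q # r # ps) ! i) ((p # q # r # ps) ! Suc i))"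
    unfolding lessThan_Suc_eq_insert_0 by simp
  finally show ?case by simp
qed auto

lemma set_subset_path_image_polyline: "2 \<le> length xs \<Longrightarrow> set xs \<subseteq> path_image (polyline xs)"
proof
  fix x assume len: "2 \<le> length xs" and "x \<in> set xs"
  then obtain i where i: "i < length xs" "x = xs ! i" by (metis in_set_conv_nth)
  show "x \<in> path_image (polyline xs)"
  proof (cases "i < length xs - 1")
    case True
    then show ?thesis unfolding path_image_polyline[OF len] i by (intro UN_I[of i]) auto
  next
    case False
    then have "i = Suc (length xs - 2)" "length xs - 2 < length xs - 1" using i len by auto
    then show ?thesis unfolding path_image_polyline[OF len] i by (intro UN_I[of "length xs - 2"]) auto
  qed
qed

text \<open>The first edge meets the remaining arc only in \<open>q\<close>, and that arc passes
  through all later vertices, so \<open>p\<close> does not recur.\<close>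

lemma arc_polyline_distinct: "2 \<le> length xs \<Longrightarrow> arc (polyline xs) \<Longrightarrow> distinct xs"
proof (induction xs rule: polyline.induct)
  case (3 p q)
  then show ?case by (auto dest: arc_distinct_ends)
next
  case (4 p q r ps)
  have "arc (linepath p q) \<and> arc (polyline (q # r # ps)) \<and> path_image (linepath p q) \<inter> path_image (polyline (q # r # ps)) \<subseteq> {q}"
    using 4(3) by (simp add: arc_join_eq pathstart_polyline)
  moreover have "set (q # r # ps) \<subseteq> path_image (polyline (q # r # ps))"
    by (rule set_subset_path_image_polyline) simp
  moreover have "p \<noteq> q" using arc_distinct_ends[of "linepath p q"] calculation(1) by auto
  moreover have "p \<in> path_image (linepath p q)" by simp
  ultimately have "p \<notin> set (q # r # ps)" "arc (polyline (q # r # ps))" by blast+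
  then show ?case using 4(1) by simp
qed auto

lemma closed_polyline_path_image:
  assumes "2 \<le> length ps"
  shows "path_image (closed_polyline ps) = (\<Union>i<length ps. closed_segment (ps ! i) (ps ! (Suc i mod length ps)))"
proof -
  have "path_image (closed_polyline ps) = (\<Union>i<length ps. closed_segment ((ps @ [hd ps]) ! i) ((ps @ [hd ps]) ! Suc i))"
    unfolding closed_polyline_def using assms by (subst path_image_polyline) auto
  also have "\<dots> = (\<Union>i<length ps. closed_segment (ps ! i) (ps ! (Suc i mod length ps)))"
  proof (rule SUP_cong[OF refl])
    fix i assume i: "i \<in> {..<length ps}"
    have "(ps @ [hd ps]) ! Suc i = ps ! (Suc i mod length ps)"
    proof (cases "Suc i = length ps")
      case True
      then show ?thesis using assms by (cases ps) (auto simp: nth_append)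
    qed (use i in \<open>auto simp: nth_append\<close>)
    then show "closed_segment ((ps @ [hd ps]) ! i) ((ps @ [hd ps]) ! Suc i) = closed_segment (ps ! i) (ps ! (Suc i mod length ps))"
      using i by (simp add: nth_append)
  qed
  finally show ?thesis .
qed

lemma closed_polyline_ends:
  assumes "ps \<noteq> []"
  shows "pathstart (closed_polyline ps) = hd ps" "pathfinish (closed_polyline ps) = hd ps"
  using assms by (auto simp: closed_polyline_def pathfinish_polyline neq_Nil_conv pathstart_polyline)

text \<open>Removing the first edge of the loop leaves an arc through all vertices, with the
  starting vertex at its end.\<close>

lemma simple_closed_polyline_distinct:
  assumes "3 \<le> length ps" "simple_path (closed_polyline ps)"
  shows "distinct ps"
proof -
  obtain p q r xs where ps: "ps = p # q # r # xs"
    using assms(1) by (metis Suc_le_length_iff numeral_3_eq_3)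
  have eq: "closed_polyline ps = linepath p q +++ polyline (q # r # xs @ [p])"
    by (simp add: closed_polyline_def ps)
  have "arc (polyline (q # r # xs @ [p]))"
    using assms(2) unfolding eq
    by (subst (asm) simple_path_join_loop_eq) (auto simp: pathstart_polyline pathfinish_polyline)
  then have "distinct (q # r # xs @ [p])" by (intro arc_polyline_distinct) auto
  then show ?thesis by (auto simp: ps)
qed

text \<open>The edges lie in the hull, and the complement of a convex set that contains the curve
  belongs to the outside of the curve.\<close>

lemma open_polygon_subset_hull:
  assumes "open_polygon ps D"
  shows "D \<subseteq> convex hull (set ps)" "open D" "bounded D"
proof -
  have len: "2 \<le> length ps" and D: "D = inside (path_image (closed_polyline ps))" and sp: "simple_path (closed_polyline ps)"
    using assms by (auto simp: open_polygon_def)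
  have "path_image (closed_polyline ps) \<subseteq> convex hull (set ps)"
    unfolding closed_polyline_path_image[OF len]
  proof (rule UN_least)
    fix i assume "i \<in> {..<length ps}"
    then have "ps ! i \<in> set ps" "ps ! (Suc i mod length ps) \<in> set ps" by (auto intro!: nth_mem mod_less_divisor)
    then show "closed_segment (ps ! i) (ps ! (Suc i mod length ps)) \<subseteq> convex hull (set ps)"
      by (intro closed_segment_subset convex_convex_hull) (auto intro: hull_inc)
  qed
  from outside_subset_convex[OF convex_convex_hull this] show *: "D \<subseteq> convex hull (set ps)"
    unfolding D by (auto simp: inside_outside)
  show "open D" unfolding D using sp by (intro open_inside closed_simple_path_image)
  show "bounded D" by (rule bounded_subset[OF bounded_convex_hull *]) (simp add: finite_imp_bounded)
qed

text \<open>A hull point other than \<open>p\<close> puts positive weight on the hull of the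
  remaining points, which stays in the open half-space below the level of \<open>p\<close>.\<close>

lemma convex_hull_unique_max:
  fixes p d :: "'a::euclidean_space"
  assumes "p \<in> S" and max: "\<And>q. q \<in> S \<Longrightarrow> q \<noteq> p \<Longrightarrow> q \<bullet> d < p \<bullet> d" and x: "x \<in> convex hull S" "x \<noteq> p"
  shows "x \<bullet> d < p \<bullet> d"
proof (cases "S = {p}")
  case False
  define S' where "S' = S - {p}"
  have S: "S = insert p S'" "S' \<noteq> {}" using assms(1) False by (auto simp: S'_def)
  obtain u v b where u: "0 \<le> u" "0 \<le> v" "u + v = 1" and b: "b \<in> convex hull S'" "x = u *\<^sub>R p + v *\<^sub>R b"
    using x(1) unfolding S(1) convex_hull_insert[OF S(2)] by blast
  have "convex hull S' \<subseteq> {y. y \<bullet> d < p \<bullet> d}"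
    using max by (intro hull_minimal) (auto simp: S'_def inner_commute[of _ d] convex_halfspace_lt)
  then have bd: "b \<bullet> d < p \<bullet> d" using b by auto
  have "v \<noteq> 0" using b u x(2) by auto
  then have "v * (b \<bullet> d) < v * (p \<bullet> d)" using bd u by simp
  then have "x \<bullet> d < u * (p \<bullet> d) + v * (p \<bullet> d)" by (simp add: b inner_add_left)
  also have "\<dots> = p \<bullet> d" using u by (simp add: distrib_right[symmetric])
  finally show ?thesis .
qed (use x in simp)

text \<open>Cramer's rule: the coordinates along \<open>v\<close> and \<open>w\<close> are quotients
  of determinants.\<close>

lemma cross2_solve:
  fixes v w x :: "real^2"
  assumes "cross2 v w \<noteq> 0"
  shows "x = (cross2 x w / cross2 v w) *\<^sub>R v + (cross2 v x / cross2 v w) *\<^sub>R w"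
proof -
  have "cross2 v w *\<^sub>R x = cross2 x w *\<^sub>R v + cross2 v x *\<^sub>R w"
    by (simp add: vec_eq_iff forall_2 cross2_def algebra_simps)
  then have "(1 / cross2 v w) *\<^sub>R (cross2 v w *\<^sub>R x) = (1 / cross2 v w) *\<^sub>R (cross2 x w *\<^sub>R v + cross2 v x *\<^sub>R w)" by simp
  then show ?thesis using assms by (simp add: scaleR_add_right)
qed

lemma cross2_coords_unique:
  assumes "cross2 v w \<noteq> 0" "s *\<^sub>R v + t *\<^sub>R w = s' *\<^sub>R v + t' *\<^sub>R w"
  shows "s = s' \<and> t = t'"
proof -
  have "cross2 (s *\<^sub>R v + t *\<^sub>R w) w = s * cross2 v w" "cross2 v (s *\<^sub>R v + t *\<^sub>R w) = t * cross2 v w" for s t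
    by (simp_all add: cross2_def algebra_simps)
  then have "s * cross2 v w = s' * cross2 v w" "t * cross2 v w = t' * cross2 v w" using assms(2) by metis+
  then show ?thesis using assms(1) by simp
qed

lemma not_collinear_cross2:
  fixes a b c :: "real^2"
  assumes "\<not> collinear {a, b, c}"
  shows "cross2 (c - b) (a - b) \<noteq> 0"
proof
  assume z: "cross2 (c - b) (a - b) = 0"
  define x y where "x = a - b" and "y = c - b"
  have z': "y $ 1 * x $ 2 = y $ 2 * x $ 1" using z by (simp add: x_def y_def cross2_def)
  have "x \<noteq> 0" using assms unfolding x_def by (auto simp: insert_commute)
  have "\<exists>k. y = k *\<^sub>R x"
  proof (cases "x $ 1 = 0")
    case True
    then have "x $ 2 \<noteq> 0" using \<open>x \<noteq> 0\<close> by (auto simp: vec_eq_iff forall_2)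
    then show ?thesis using z' True by (intro exI[of _ "y $ 2 / x $ 2"]) (auto simp: vec_eq_iff forall_2)
  next
    case False
    then show ?thesis using z' by (intro exI[of _ "y $ 1 / x $ 1"]) (auto simp: vec_eq_iff forall_2 field_simps)
  qed
  then have "collinear {0, x, y}" unfolding collinear_lemma by auto
  then have "collinear {a, b, c}"
    using collinear_3[of a b c] by (simp add: x_def y_def)
  then show False using assms by simp
qed

text \<open>
  Near \<open>p\<close> the curve consists of the two edges at \<open>p\<close>. Each half parallelogram with \<open>s < 0\<close> or \<open>t < 0\<close> is connected,
  avoids the curve and contains a point beyond the maximum of \<open>d\<close>, so it lies outside; by the Jordan curve theorem
  \<open>D\<close> accumulates at \<open>p\<close>, and only the remaining quadrant is left.
\<close>
lemma open_polygon_corner: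
  assumes poly: "open_polygon ps D" and p: "p \<in> set ps" and max: "\<And>q. q \<in> set ps \<Longrightarrow> q \<noteq> p \<Longrightarrow> q \<bullet> d < p \<bullet> d"
  obtains v w \<delta> where "cross2 v w \<noteq> 0" "v \<bullet> d < 0" "w \<bullet> d < 0" "\<delta> > 0"
    "\<And>s t. \<bar>s\<bar> < \<delta> \<Longrightarrow> \<bar>t\<bar> < \<delta> \<Longrightarrow> p + s *\<^sub>R v + t *\<^sub>R w \<in> D \<longleftrightarrow> 0 < s \<and> 0 < t"
proof -
  define n where "n = length ps"
  have n: "3 \<le> n" and sp: "simple_path (closed_polyline ps)" and D: "D = inside (path_image (closed_polyline ps))"
    and nc: "\<And>i. i < n \<Longrightarrow> \<not> collinear {ps ! i, ps ! (Suc i mod n), ps ! (Suc (Suc i) mod n)}"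
    using poly by (auto simp: open_polygon_def n_def)
  have dist: "distinct ps" using simple_closed_polyline_distinct n sp by (simp add: n_def)
  define P where "P = path_image (closed_polyline ps)"
  have Pe: "P = (\<Union>i<n. closed_segment (ps ! i) (ps ! (Suc i mod n)))"
    unfolding P_def n_def by (rule closed_polyline_path_image) (use n in \<open>simp add: n_def\<close>)
  obtain i where i: "i < n" "p = ps ! i" using p by (metis in_set_conv_nth n_def)
  \<comment> \<open>The cyclic predecessor of \<open>i\<close>: the edges with indices
    \<open>i\<close> and \<open>j\<close> are the two incident with \<open>p\<close>.\<close>
  define j where "j = (if i = 0 then n - 1 else i - 1)"
  have j: "j < n" "Suc j mod n = i" "Suc (Suc j) mod n = Suc i mod n"
    using i n by (auto simp: j_def mod_Suc)
  define q r where "q = ps ! (Suc i mod n)" and "r = ps ! j"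
  define v w where "v = q - p" and "w = r - p"
  have J: "cross2 v w \<noteq> 0" using not_collinear_cross2[OF nc[OF j(1)]] j i by (simp add: v_def w_def q_def r_def)
  have mem: "q \<in> set ps" "r \<in> set ps" using j(1) n by (auto simp: q_def r_def n_def intro!: nth_mem mod_less_divisor)
  have "q \<noteq> p" "r \<noteq> p" using J by (auto simp: v_def w_def cross2_def)
  then have vd: "v \<bullet> d < 0" "w \<bullet> d < 0" using max mem by (auto simp: v_def w_def inner_diff_left)
  define Q where "Q = (\<Union>m\<in>{..<n} - {i, j}. closed_segment (ps ! m) (ps ! (Suc m mod n)))"
  have PQ: "P = closed_segment p q \<union> closed_segment p r \<union> Q"
  proof -
    have "{..<n} = insert i (insert j ({..<n} - {i, j}))" using i j by auto
    then have "P = (\<Union>m\<in>insert i (insert j ({..<n} - {i, j})). closed_segment (ps ! m) (ps ! (Suc m mod n)))"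
      unfolding Pe by simp
    then show ?thesis unfolding UN_insert using i j by (auto simp: Q_def q_def r_def closed_segment_commute)
  qed
  \<comment> \<open>Both end points of any other edge lie strictly below the level of
    \<open>p\<close>, and so does the whole edge.\<close>
  have "p \<notin> Q"
  proof
    assume "p \<in> Q"
    then obtain m where m: "m < n" "m \<noteq> i" "m \<noteq> j" "p \<in> closed_segment (ps ! m) (ps ! (Suc m mod n))" by (auto simp: Q_def)
    have "ps ! m \<noteq> p" using m i dist by (simp add: nth_eq_iff_index_eq n_def)
    moreover have "Suc m mod n \<noteq> i"
      using m i n by (cases "Suc m = n") (auto simp: j_def split: if_splits)
    moreover have "Suc m mod n < n" using n by simp
    ultimately have "ps ! (Suc m mod n) \<noteq> p" using i dist by (simp add: nth_eq_iff_index_eq n_def)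
    with \<open>ps ! m \<noteq> p\<close> have "ps ! m \<bullet> d < p \<bullet> d" "ps ! (Suc m mod n) \<bullet> d < p \<bullet> d"
      using m n by (auto intro!: max nth_mem mod_less_divisor simp: n_def)
    then have "closed_segment (ps ! m) (ps ! (Suc m mod n)) \<subseteq> {x. x \<bullet> d < p \<bullet> d}"
      by (intro closed_segment_subset) (auto simp: inner_commute[of _ d] convex_halfspace_lt)
    then show False using m(4) by auto
  qed
  moreover have "closed Q" unfolding Q_def by (intro closed_UN) auto
  ultimately obtain e where e: "e > 0" "ball p e \<subseteq> - Q"
    using open_contains_ball[of "- Q"] by auto
  \<comment> \<open>The bound 1 keeps points with one coordinate 0 and the other non-negative on the
    edges at \<open>p\<close>; the second bound keeps the parallelogram inside the ball that the
    other edges avoid.\<close>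
  define \<delta> where "\<delta> = min 1 (e / (norm v + norm w + 1))"
  have \<delta>: "\<delta> > 0" "\<delta> \<le> 1" "\<delta> * (norm v + norm w) < e"
  proof -
    have pos: "norm v + norm w + 1 > 0" by (simp add: add_nonneg_pos)
    then show "\<delta> > 0" "\<delta> \<le> 1" using e(1) by (auto simp: \<delta>_def)
    have "\<delta> * (norm v + norm w) \<le> e / (norm v + norm w + 1) * (norm v + norm w)"
      by (intro mult_right_mono) (auto simp: \<delta>_def)
    also have "\<dots> < e" using e(1) pos by (simp add: field_simps)
    finally show "\<delta> * (norm v + norm w) < e" .
  qed
  define X where "X z = p + fst z *\<^sub>R v + snd z *\<^sub>R w" for z
  have Xc: "continuous_on A X" for A unfolding X_def by (intro continuous_intros)
  have Xb: "X (s, t) \<in> ball p e" if "\<bar>s\<bar> < \<delta>" "\<bar>t\<bar> < \<delta>" for s t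
  proof -
    have "norm (s *\<^sub>R v + t *\<^sub>R w) \<le> \<bar>s\<bar> * norm v + \<bar>t\<bar> * norm w" using norm_triangle_ineq[of "s *\<^sub>R v" "t *\<^sub>R w"] by simp
    also have "\<dots> \<le> \<delta> * norm v + \<delta> * norm w" using that by (intro add_mono mult_right_mono) auto
    also have "\<dots> < e" using \<delta>(3) by (simp add: distrib_left)
    finally show ?thesis by (simp add: X_def dist_norm norm_minus_commute add.assoc add.commute[of "t *\<^sub>R w"])
  qed
  have XP: "X (s, t) \<notin> P" if st: "\<bar>s\<bar> < \<delta>" "\<bar>t\<bar> < \<delta>" and off: "s < 0 \<or> t < 0 \<or> (s > 0 \<and> t > 0)" for s t
  proof
    assume "X (s, t) \<in> P"
    then have "X (s, t) \<in> closed_segment p q \<or> X (s, t) \<in> closed_segment p r" using Xb[OF st] e(2) by (auto simp: PQ)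
    then obtain u where u: "0 \<le> u" and "X (s, t) = p + u *\<^sub>R v \<or> X (s, t) = p + u *\<^sub>R w"
      by (auto simp: in_segment v_def w_def algebra_simps)
    then have "s *\<^sub>R v + t *\<^sub>R w = u *\<^sub>R v + 0 *\<^sub>R w \<or> s *\<^sub>R v + t *\<^sub>R w = 0 *\<^sub>R v + u *\<^sub>R w"
      by (auto simp: X_def add.assoc)
    then show False using cross2_coords_unique[OF J] u off by (metis less_irrefl not_le)
  qed
  have conn: "b \<in> D" if A: "convex A" "a \<in> X ` A" "b \<in> X ` A" "X ` A \<inter> P = {}" "a \<in> D" for A a b
  proof -
    have "connected (X ` A)" using A(1) by (intro connected_continuous_image Xc convex_connected)
    then have "connected_component (- P) a b" using A(2,3,4) unfolding connected_component_def by blast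
    then show ?thesis using A(5) unfolding D P_def[symmetric] by (metis inside_same_component)
  qed
  have maxD: "x \<bullet> d < p \<bullet> d" if "x \<in> D" "x \<noteq> p" for x
    using convex_hull_unique_max[OF p max] open_polygon_subset_hull(1)[OF poly] that by blast
  \<comment> \<open>This point belongs to both half parallelograms, so a single witness outside
    \<open>D\<close> settles the cases \<open>s < 0\<close> and \<open>t < 0\<close>.\<close>
  define z where "z = X (- \<delta>/2, - \<delta>/2)"
  have zD: "z \<notin> D"
  proof
    assume "z \<in> D"
    moreover have "z \<bullet> d = p \<bullet> d + (\<delta>/2) * (- (v \<bullet> d) - w \<bullet> d)" by (simp add: z_def X_def inner_add_left algebra_simps)
    moreover have "(\<delta>/2) * (- (v \<bullet> d) - w \<bullet> d) > 0" using \<delta>(1) vd by (intro mult_pos_pos) auto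
    ultimately show False using maxD[of z] by (cases "z = p") auto
  qed
  have neg: "X (s, t) \<notin> D" if st: "\<bar>s\<bar> < \<delta>" "\<bar>t\<bar> < \<delta>" and "s < 0 \<or> t < 0" for s t
  proof
    assume XD: "X (s, t) \<in> D"
    have "z \<in> D"
    proof (cases "s < 0")
      case True
      show ?thesis
      proof (rule conn[OF _ _ _ _ XD])
        show "convex ({-\<delta><..<0} \<times> {-\<delta><..<\<delta>})" by (intro convex_Times) auto
        show "X (s, t) \<in> X ` ({-\<delta><..<0} \<times> {-\<delta><..<\<delta>})" using True st by (intro imageI) auto
        show "z \<in> X ` ({-\<delta><..<0} \<times> {-\<delta><..<\<delta>})" unfolding z_def using \<delta>(1) by (intro imageI) auto
        show "X ` ({-\<delta><..<0} \<times> {-\<delta><..<\<delta>}) \<inter> P = {}" using XP by auto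
      qed
    next
      case False
      then have "t < 0" using that by simp
      show ?thesis
      proof (rule conn[OF _ _ _ _ XD])
        show "convex ({-\<delta><..<\<delta>} \<times> {-\<delta><..<0})" by (intro convex_Times) auto
        show "X (s, t) \<in> X ` ({-\<delta><..<\<delta>} \<times> {-\<delta><..<0})" using \<open>t < 0\<close> st by (intro imageI) auto
        show "z \<in> X ` ({-\<delta><..<\<delta>} \<times> {-\<delta><..<0})" unfolding z_def using \<delta>(1) by (intro imageI) auto
        show "X ` ({-\<delta><..<\<delta>} \<times> {-\<delta><..<0}) \<inter> P = {}" using XP by auto
      qed
    qed
    then show False using zD by simp
  qed
  have zero: "X (s, t) \<notin> D" if st: "\<bar>s\<bar> < \<delta>" "\<bar>t\<bar> < \<delta>" and "0 \<le> s" "0 \<le> t" "s = 0 \<or> t = 0" for s t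
  proof -
    have "X (s, t) \<in> P"
    proof (cases "s = 0")
      case True
      have "X (s, t) = (1 - t) *\<^sub>R p + t *\<^sub>R r" using True by (simp add: X_def w_def algebra_simps)
      then have "X (s, t) \<in> closed_segment p r" using st that \<delta>(2) unfolding in_segment by (intro exI[of _ t]) auto
      then show ?thesis by (simp add: PQ)
    next
      case False
      have "X (s, t) = (1 - s) *\<^sub>R p + s *\<^sub>R q" using False that by (simp add: X_def v_def algebra_simps)
      then have "X (s, t) \<in> closed_segment p q" using st that \<delta>(2) unfolding in_segment by (intro exI[of _ s]) auto
      then show ?thesis by (simp add: PQ)
    qed
    then show ?thesis using inside_no_overlap[of P] unfolding D P_def[symmetric] by blast
  qed
  \<comment> \<open>A neighbourhood of \<open>p\<close> given by bounds on the Cramer coordinates.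
    It contains a point of \<open>D\<close>, which must lie in the open quadrant, and connectedness
    spreads membership over the quadrant.\<close>
  define N where "N = {x. \<bar>cross2 (x - p) w / cross2 v w\<bar> < \<delta> \<and> \<bar>cross2 v (x - p) / cross2 v w\<bar> < \<delta>}"
  have "open N" unfolding N_def cross2_def
    by (intro open_Collect_conj open_Collect_less continuous_intros) (use J in \<open>auto simp: cross2_def\<close>)
  moreover have "p \<in> N" using \<delta>(1) by (simp add: N_def cross2_def)
  moreover have "p \<in> closure D"
  proof -
    have "ps \<noteq> []" using p by auto
    then have "P \<subseteq> closure D" unfolding P_def D by (intro Jordan_curve_subset_closure_inside sp) (simp add: closed_polyline_ends)
    then show ?thesis by (auto simp: PQ)
  qed
  ultimately obtain y where y: "y \<in> N" "y \<in> D" using open_Int_closure_eq_empty[of N D] by blast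
  obtain s0 t0 where st0: "y = X (s0, t0)" "\<bar>s0\<bar> < \<delta>" "\<bar>t0\<bar> < \<delta>"
  proof
    show "y = X (cross2 (y - p) w / cross2 v w, cross2 v (y - p) / cross2 v w)"
      using cross2_solve[OF J, of "y - p"] by (simp add: X_def algebra_simps)
  qed (use y(1) in \<open>auto simp: N_def\<close>)
  then have pos0: "s0 > 0" "t0 > 0" using y(2) neg[of s0 t0] zero[of s0 t0] by (meson not_le less_le_not_le linorder_cases order_less_le)+
  have pos: "X (s, t) \<in> D" if st: "\<bar>s\<bar> < \<delta>" "\<bar>t\<bar> < \<delta>" and "s > 0" "t > 0" for s t
  proof (rule conn)
    show "convex ({0<..<\<delta>} \<times> {0<..<\<delta>})" by (intro convex_Times) auto
    show "y \<in> D" by (rule y(2))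
    show "y \<in> X ` ({0<..<\<delta>} \<times> {0<..<\<delta>})" unfolding st0(1) using st0 pos0 by (intro imageI) auto
    show "X (s, t) \<in> X ` ({0<..<\<delta>} \<times> {0<..<\<delta>})" using that by (intro imageI) auto
    show "X ` ({0<..<\<delta>} \<times> {0<..<\<delta>}) \<inter> P = {}" using XP by auto
  qed
  show thesis
  proof (rule that[OF J vd \<delta>(1)])
    fix s t :: real assume st: "\<bar>s\<bar> < \<delta>" "\<bar>t\<bar> < \<delta>"
    have "X (s, t) \<in> D \<longleftrightarrow> 0 < s \<and> 0 < t"
      using pos[OF st] neg[OF st] zero[OF st] by (meson linorder_not_le order_le_less)
    then show "p + s *\<^sub>R v + t *\<^sub>R w \<in> D \<longleftrightarrow> 0 < s \<and> 0 < t" by (simp add: X_def)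
  qed
qed

section \<open>Asymptotics of corner integrals\<close>

definition clin :: "complex^2 \<Rightarrow> real^2 \<Rightarrow> complex" where
  "clin \<zeta> x = (\<Sum>i\<in>UNIV. \<zeta> $ i * complex_of_real (x $ i))"

lemma clin_add: "clin \<zeta> (x + y) = clin \<zeta> x + clin \<zeta> y"
  and clin_diff: "clin \<zeta> (x - y) = clin \<zeta> x - clin \<zeta> y"
  and clin_scaleR: "clin \<zeta> (s *\<^sub>R x) = of_real s * clin \<zeta> x"
  by (simp_all add: clin_def sum_2 algebra_simps)

lemma continuous_clin: "continuous_on A (clin \<zeta>)"
  unfolding clin_def by (intro continuous_intros)

section \<open>Integrals of exponentials over parallelograms\<close>

lemma integral_exp_interval:
  fixes a :: complex
  assumes "a \<noteq> 0" "\<delta> \<ge> 0"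
  shows "(\<integral>s. indicator {s0..s0+\<delta>} s *\<^sub>R exp (of_real (s - s0) * a) \<partial>lborel) = (exp (of_real \<delta> * a) - 1) / a"
proof -
  have "((\<lambda>s. exp (of_real (s - s0) * a) / a) has_vector_derivative exp (of_real (s - s0) * a)) (at s within A)" for s A
    unfolding of_real_diff
    by (rule has_vector_derivative_real_field[where f = "\<lambda>z. exp ((z - of_real s0) * a) / a"])
      (use assms in \<open>auto intro!: derivative_eq_intros\<close>)
  then show ?thesis
    using assms by (subst integral_FTC_Icc) (auto intro!: continuous_intros simp: diff_divide_distrib)
qed

text \<open>In coordinates along the edges the exponential is a product, and the double integral
  factors into two integrals over intervals. These coordinates start at the origin, hence the
  expansion of \<open>p\<close> with coefficients \<open>s0\<close> and \<open>t0\<close>.\<close>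

lemma integral_exp_parallelogram:
  fixes v w p :: "real^2"
  assumes J: "cross2 v w \<noteq> 0" and \<delta>: "\<delta> > 0" and \<zeta>: "clin \<zeta> v \<noteq> 0" "clin \<zeta> w \<noteq> 0"
    and P: "P = (\<lambda>(s, t). p + s *\<^sub>R v + t *\<^sub>R w) ` ({0..\<delta>} \<times> {0..\<delta>})"
  shows "integrable lborel (\<lambda>x. indicator P x *\<^sub>R exp (clin \<zeta> (x - p)))"
    and "(\<integral>x. indicator P x *\<^sub>R exp (clin \<zeta> (x - p)) \<partial>lborel)
      = of_real \<bar>cross2 v w\<bar> * ((exp (of_real \<delta> * clin \<zeta> v) - 1) / clin \<zeta> v) * ((exp (of_real \<delta> * clin \<zeta> w) - 1) / clin \<zeta> w)"
proof -
  have "compact P" unfolding P case_prod_beta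
    by (intro compact_continuous_image compact_Times continuous_intros) auto
  then show int: "integrable lborel (\<lambda>x. indicator P x *\<^sub>R exp (clin \<zeta> (x - p)))"
    by (intro borel_integrable_compact continuous_intros continuous_on_compose2[OF continuous_clin[of UNIV]]) auto
  obtain s0 t0 where p: "p = s0 *\<^sub>R v + t0 *\<^sub>R w" using cross2_solve[OF J] by blast
  have eq: "indicator P (s *\<^sub>R v + t *\<^sub>R w) *\<^sub>R exp (clin \<zeta> (s *\<^sub>R v + t *\<^sub>R w - p))
     = (indicator {s0..s0+\<delta>} s *\<^sub>R exp (of_real (s - s0) * clin \<zeta> v)) * (indicator {t0..t0+\<delta>} t *\<^sub>R exp (of_real (t - t0) * clin \<zeta> w))" for s t
  proof -
    have "s *\<^sub>R v + t *\<^sub>R w \<in> P \<longleftrightarrow> s \<in> {s0..s0+\<delta>} \<and> t \<in> {t0..t0+\<delta>}"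
    proof
      assume "s *\<^sub>R v + t *\<^sub>R w \<in> P"
      then obtain s' t' where st: "s' \<in> {0..\<delta>}" "t' \<in> {0..\<delta>}" "s *\<^sub>R v + t *\<^sub>R w = p + s' *\<^sub>R v + t' *\<^sub>R w" by (auto simp: P)
      then have "s *\<^sub>R v + t *\<^sub>R w = (s0 + s') *\<^sub>R v + (t0 + t') *\<^sub>R w" by (simp add: p algebra_simps)
      then have "s = s0 + s' \<and> t = t0 + t'" by (rule cross2_coords_unique[OF J])
      then show "s \<in> {s0..s0+\<delta>} \<and> t \<in> {t0..t0+\<delta>}" using st by auto
    next
      assume "s \<in> {s0..s0+\<delta>} \<and> t \<in> {t0..t0+\<delta>}"
      then have "(s - s0, t - t0) \<in> {0..\<delta>} \<times> {0..\<delta>}" by auto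
      moreover have "s *\<^sub>R v + t *\<^sub>R w = (\<lambda>(s, t). p + s *\<^sub>R v + t *\<^sub>R w) (s - s0, t - t0)" by (simp add: p algebra_simps)
      ultimately show "s *\<^sub>R v + t *\<^sub>R w \<in> P" unfolding P by (rule rev_image_eqI)
    qed
    moreover have "clin \<zeta> (s *\<^sub>R v + t *\<^sub>R w - p) = of_real (s - s0) * clin \<zeta> v + of_real (t - t0) * clin \<zeta> w"
      by (simp add: p clin_add clin_diff clin_scaleR algebra_simps)
    ultimately show ?thesis by (auto simp: indicator_def exp_add)
  qed
  show "(\<integral>x. indicator P x *\<^sub>R exp (clin \<zeta> (x - p)) \<partial>lborel)
      = of_real \<bar>cross2 v w\<bar> * ((exp (of_real \<delta> * clin \<zeta> v) - 1) / clin \<zeta> v) * ((exp (of_real \<delta> * clin \<zeta> w) - 1) / clin \<zeta> w)"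
    unfolding integrable_linear_coordinates(2)[OF J int] eq integral_mult_right_zero integral_mult_left_zero
      integral_exp_interval[OF \<zeta>(1) less_imp_le[OF \<delta>]] integral_exp_interval[OF \<zeta>(2) less_imp_le[OF \<delta>]]
    by (simp add: scaleR_conv_of_real)
qed

text \<open>On \<open>A\<close> the exponential has modulus at most \<open>exp (- c)\<close>. For
  the estimate, \<open>A\<close> will be the complement of a corner parallelogram or the whole
  plane.\<close>

lemma norm_integral_exp_le:
  fixes \<rho> :: "real^2 \<Rightarrow> complex"
  assumes D: "open D" "bounded D" and \<rho>: "integrable (lebesgue_on D) \<rho>"
    and A: "A \<in> sets borel" and b: "\<And>x. x \<in> D \<Longrightarrow> x \<in> A \<Longrightarrow> Re (clin \<zeta> (x - p)) \<le> - c"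
  shows "integrable (lebesgue_on D) (\<lambda>x. \<rho> x * exp (clin \<zeta> (x - p)))"
    "cmod (LINT x|lebesgue_on D. indicator A x *\<^sub>R (\<rho> x * exp (clin \<zeta> (x - p)))) \<le> exp (- c) * (LINT x|lebesgue_on D. cmod (\<rho> x))"
proof -
  have ce: "continuous_on UNIV (\<lambda>x. exp (clin \<zeta> (x - p)))"
    by (intro continuous_intros continuous_on_compose2[OF continuous_clin[of UNIV]]) auto
  have "bounded ((\<lambda>x. exp (clin \<zeta> (x - p))) ` closure D)"
    using D by (intro compact_imp_bounded compact_continuous_image continuous_on_subset[OF ce]) auto
  then obtain B where "\<And>x. x \<in> closure D \<Longrightarrow> cmod (exp (clin \<zeta> (x - p))) \<le> B" by (force simp: bounded_iff)
  then show int: "integrable (lebesgue_on D) (\<lambda>x. \<rho> x * exp (clin \<zeta> (x - p)))"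
    using closure_subset[of D]
    by (intro integrable_mult_bounded[OF \<rho> continuous_measurable_lebesgue_on[OF ce], of B]) (auto simp: space_restrict_space)
  have "cmod (LINT x|lebesgue_on D. indicator A x *\<^sub>R (\<rho> x * exp (clin \<zeta> (x - p)))) \<le> (LINT x|lebesgue_on D. exp (- c) * cmod (\<rho> x))"
  proof (rule order_trans[OF integral_norm_bound Bochner_Integration.integral_mono])
    show "integrable (lebesgue_on D) (\<lambda>x. cmod (indicator A x *\<^sub>R (\<rho> x * exp (clin \<zeta> (x - p)))))"
    proof (intro integrable_norm Bochner_Integration.integrable_bound[OF int])
      show "(\<lambda>x. indicator A x *\<^sub>R (\<rho> x * exp (clin \<zeta> (x - p)))) \<in> borel_measurable (lebesgue_on D)"
        using A by (intro borel_measurable_scaleR borel_measurable_integrable[OF int] measurable_restrict_space1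
            measurable_completion borel_measurable_indicator) auto
    qed (auto simp: indicator_def)
    fix x assume "x \<in> space (lebesgue_on D)"
    then have "x \<in> D" by (simp add: space_restrict_space)
    then show "cmod (indicator A x *\<^sub>R (\<rho> x * exp (clin \<zeta> (x - p)))) \<le> exp (- c) * cmod (\<rho> x)"
      using b[of x] by (auto simp: indicator_def norm_mult mult.commute intro!: mult_left_mono)
  qed (use \<rho> in auto)
  then show "cmod (LINT x|lebesgue_on D. indicator A x *\<^sub>R (\<rho> x * exp (clin \<zeta> (x - p)))) \<le> exp (- c) * (LINT x|lebesgue_on D. cmod (\<rho> x))"
    by simp
qed

text \<open>The exponents of complex geometric optics solutions, with $d^\perp = (-d_2, d_1)$ and $\zeta = \tau d + i \sqrt{\tau^2 + k^2}\, d^\perp$.\<close>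
definition cgo :: "real \<Rightarrow> real^2 \<Rightarrow> real \<Rightarrow> complex^2" where
  "cgo k d \<tau> = vector [Complex (\<tau> * d $ 1) (- sqrt (\<tau>\<^sup>2 + k\<^sup>2) * d $ 2), Complex (\<tau> * d $ 2) (sqrt (\<tau>\<^sup>2 + k\<^sup>2) * d $ 1)]"

lemma clin_cgo: "clin (cgo k d \<tau>) x = Complex (\<tau> * (x \<bullet> d)) (sqrt (\<tau>\<^sup>2 + k\<^sup>2) * cross2 d x)"
  by (simp add: clin_def cgo_def sum_2 complex_eq_iff inner_vec_def cross2_def algebra_simps)

lemma bdot_cgo:
  assumes "norm d = 1"
  shows "bdot (cgo k d \<tau>) (cgo k d \<tau>) = - complex_of_real (k\<^sup>2)"
proof -
  have d: "d $ 1 * d $ 1 + d $ 2 * d $ 2 = 1" using assms by (simp add: norm_eq_1 inner_vec_def sum_2)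
  define S where "S = sqrt (\<tau>\<^sup>2 + k\<^sup>2)"
  have S: "S * S = \<tau>\<^sup>2 + k\<^sup>2" by (simp add: S_def)
  \<comment> \<open>This is the real part of the product; the imaginary part cancels because d is
    orthogonal to its rotation.\<close>
  have "\<tau> * d $ 1 * (\<tau> * d $ 1) - S * d $ 2 * (S * d $ 2) + (\<tau> * d $ 2 * (\<tau> * d $ 2) - S * d $ 1 * (S * d $ 1))
     = (\<tau>\<^sup>2 - S * S) * (d $ 1 * d $ 1 + d $ 2 * d $ 2)"
    by (simp add: algebra_simps power2_eq_square)
  also have "\<dots> = - k\<^sup>2" by (simp add: d S)
  finally show ?thesis
    unfolding bdot_def cgo_def sum_2 S_def[symmetric] by (simp add: complex_eq_iff)
qed

text \<open>Since x . d and \<open>cross2 d x\<close> are orthonormal coordinates of x, the squared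
  modulus is \<tau>^2 |x|^2 + k^2 (\<open>cross2 d x\<close>)^2, which k \<le> \<tau> bounds by 2
  \<tau>^2 |x|^2.\<close>

lemma norm_clin_cgo:
  assumes d: "norm d = 1" and "\<tau> > 0" "k \<ge> 0" "k \<le> \<tau>"
  shows "\<tau> * norm x \<le> cmod (clin (cgo k d \<tau>) x)" "cmod (clin (cgo k d \<tau>) x) \<le> 2 * \<tau> * norm x"
proof -
  have dd: "d $ 1 * d $ 1 + d $ 2 * d $ 2 = 1" using d by (simp add: norm_eq_1 inner_vec_def sum_2)
  have id: "(x \<bullet> d)\<^sup>2 + (cross2 d x)\<^sup>2 = (norm x)\<^sup>2"
  proof -
    have "(x \<bullet> d)\<^sup>2 + (cross2 d x)\<^sup>2 = (d $ 1 * d $ 1 + d $ 2 * d $ 2) * (x $ 1 * x $ 1 + x $ 2 * x $ 2)"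
      by (simp add: inner_vec_def sum_2 cross2_def power2_eq_square algebra_simps)
    then show ?thesis by (simp add: dd power2_norm_eq_inner inner_vec_def sum_2)
  qed
  have eq: "(cmod (clin (cgo k d \<tau>) x))\<^sup>2 = \<tau>\<^sup>2 * (norm x)\<^sup>2 + k\<^sup>2 * (cross2 d x)\<^sup>2"
    unfolding clin_cgo cmod_power2 id[symmetric] by (simp add: power_mult_distrib algebra_simps)
  have "(\<tau> * norm x)\<^sup>2 \<le> (cmod (clin (cgo k d \<tau>) x))\<^sup>2" unfolding eq by (simp add: power_mult_distrib)
  then show "\<tau> * norm x \<le> cmod (clin (cgo k d \<tau>) x)" by (rule power2_le_imp_le) simp
  have "k\<^sup>2 * (cross2 d x)\<^sup>2 \<le> \<tau>\<^sup>2 * (norm x)\<^sup>2"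
  proof (rule mult_mono)
    show "k\<^sup>2 \<le> \<tau>\<^sup>2" using assms by (intro power_mono) auto
    show "(cross2 d x)\<^sup>2 \<le> (norm x)\<^sup>2" using id zero_le_power2[of "x \<bullet> d"] by linarith
  qed auto
  moreover have "0 \<le> \<tau>\<^sup>2 * (norm x)\<^sup>2" by simp
  moreover have "(2 * \<tau> * norm x)\<^sup>2 = 4 * (\<tau>\<^sup>2 * (norm x)\<^sup>2)" by (simp add: power_mult_distrib)
  ultimately have "(cmod (clin (cgo k d \<tau>) x))\<^sup>2 \<le> (2 * \<tau> * norm x)\<^sup>2" unfolding eq by linarith
  then show "cmod (clin (cgo k d \<tau>) x) \<le> 2 * \<tau> * norm x" by (rule power2_le_imp_le) (use assms in simp)
qed

text \<open>The error term involves only the modulus of the exponential, whose exponent is the real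
  vector \<tau> d. The exact formula applies to it, and each interval factor is at most 1 / (\<tau>
  |u . d|).\<close>

lemma parallelogram_real_bound:
  fixes v w p d :: "real^2"
  assumes J: "cross2 v w \<noteq> 0" and \<delta>: "\<delta> > 0" and \<tau>: "\<tau> > 0" and vd: "v \<bullet> d < 0" "w \<bullet> d < 0"
    and P: "P = (\<lambda>(s, t). p + s *\<^sub>R v + t *\<^sub>R w) ` ({0..\<delta>} \<times> {0..\<delta>})"
  shows "integrable lborel (\<lambda>x. indicator P x * exp (\<tau> * ((x - p) \<bullet> d)))"
    and "(\<integral>x. indicator P x * exp (\<tau> * ((x - p) \<bullet> d)) \<partial>lborel) \<le> \<bar>cross2 v w\<bar> / (\<tau>\<^sup>2 * (v \<bullet> d) * (w \<bullet> d))"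
proof -
  define \<zeta> :: "complex^2" where "\<zeta> = (\<chi> i. complex_of_real (\<tau> * d $ i))"
  have cl: "clin \<zeta> x = complex_of_real (\<tau> * (x \<bullet> d))" for x
    by (simp add: clin_def \<zeta>_def sum_2 inner_vec_def algebra_simps)
  have nz: "clin \<zeta> v \<noteq> 0" "clin \<zeta> w \<noteq> 0" using vd \<tau> by (auto simp: cl)
  have eq: "complex_of_real (indicator P x * exp (\<tau> * ((x - p) \<bullet> d))) = indicator P x *\<^sub>R exp (clin \<zeta> (x - p))" for x
    unfolding cl exp_of_real by (simp add: indicator_def)
  have int: "integrable lborel (\<lambda>x. complex_of_real (indicator P x * exp (\<tau> * ((x - p) \<bullet> d))))"
    unfolding eq by (rule integral_exp_parallelogram(1)[OF J \<delta> nz P])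
  then show "integrable lborel (\<lambda>x. indicator P x * exp (\<tau> * ((x - p) \<bullet> d)))"
    by (simp only: complex_of_real_integrable_eq)
  define E where "E u = (exp (\<delta> * (\<tau> * (u \<bullet> d))) - 1) / (\<tau> * (u \<bullet> d))" for u :: "real^2"
  have E: "0 \<le> E u" "E u \<le> 1 / (\<tau> * (- (u \<bullet> d)))" if "u \<bullet> d < 0" for u
  proof -
    have neg: "\<tau> * (u \<bullet> d) < 0" using that \<tau> by (simp add: mult_pos_neg)
    have "exp (\<delta> * (\<tau> * (u \<bullet> d))) \<le> 1" using neg \<delta> by (simp add: mult_pos_neg less_imp_le)
    then show "0 \<le> E u" unfolding E_def using neg by (intro divide_nonpos_neg) auto
    show "E u \<le> 1 / (\<tau> * (- (u \<bullet> d)))" unfolding E_def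
      using neg mult_nonpos_nonneg[of "\<tau> * (u \<bullet> d)" "exp (\<delta> * (\<tau> * (u \<bullet> d)))"] by (simp add: field_simps)
  qed
  have "complex_of_real (\<integral>x. indicator P x * exp (\<tau> * ((x - p) \<bullet> d)) \<partial>lborel) = (\<integral>x. complex_of_real (indicator P x * exp (\<tau> * ((x - p) \<bullet> d))) \<partial>lborel)"
    by (rule integral_complex_of_real[symmetric])
  also have "\<dots> = (\<integral>x. indicator P x *\<^sub>R exp (clin \<zeta> (x - p)) \<partial>lborel)" by (simp only: eq)
  also have "\<dots> = complex_of_real (\<bar>cross2 v w\<bar> * E v * E w)"
    unfolding integral_exp_parallelogram(2)[OF J \<delta> nz P] unfolding cl E_def by (simp add: exp_of_real[symmetric])
  finally have "(\<integral>x. indicator P x * exp (\<tau> * ((x - p) \<bullet> d)) \<partial>lborel) = \<bar>cross2 v w\<bar> * (E v * E w)"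
    by (simp only: of_real_eq_iff mult.assoc)
  also have "\<dots> \<le> \<bar>cross2 v w\<bar> * (1 / (\<tau> * (- (v \<bullet> d))) * (1 / (\<tau> * (- (w \<bullet> d)))))"
    using E[OF vd(1)] E[OF vd(2)] vd \<tau> by (intro mult_left_mono mult_mono) (auto simp: mult_nonneg_nonpos less_imp_le)
  also have "\<dots> = \<bar>cross2 v w\<bar> / (\<tau>\<^sup>2 * (v \<bullet> d) * (w \<bullet> d))" by (simp add: power2_eq_square field_simps)
  finally show "(\<integral>x. indicator P x * exp (\<tau> * ((x - p) \<bullet> d)) \<partial>lborel) \<le> \<bar>cross2 v w\<bar> / (\<tau>\<^sup>2 * (v \<bullet> d) * (w \<bullet> d))" .
qed

section \<open>The lower bound for the integral at a corner\<close>

lemma negligible_parallel_line: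
  fixes v p :: "real^2"
  assumes "v \<noteq> 0"
  shows "negligible {x. cross2 v (x - p) = 0}"
proof -
  define a :: "real^2" where "a = vector [- (v $ 2), v $ 1]"
  have "a \<noteq> 0" using assms by (auto simp: a_def vec_eq_iff forall_2)
  moreover have "{x. cross2 v (x - p) = 0} = {x. a \<bullet> x = a \<bullet> p}"
    by (auto simp: cross2_def a_def inner_vec_def sum_2 algebra_simps)
  ultimately show ?thesis using negligible_hyperplane[of a "a \<bullet> p"] by simp
qed

text \<open>Meant for the closed corner parallelogram, which leaves the open set \<open>D\<close>
  only along its two edges at the corner; the integral may then be computed in the whole
  plane.\<close>

lemma integral_lebesgue_on_almost_subset:
  fixes g :: "real^2 \<Rightarrow> 'b :: {banach, second_countable_topology}"
  assumes D: "open D" and P: "P \<in> sets borel" "negligible (P - D)" and g: "g \<in> borel_measurable borel"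
  shows "(LINT x|lebesgue_on D. indicator P x *\<^sub>R g x) = (\<integral>x. indicator P x *\<^sub>R g x \<partial>lborel)"
proof -
  have "(LINT x|lebesgue_on D. indicator P x *\<^sub>R g x) = (LINT x|lebesgue. indicator D x *\<^sub>R (indicator P x *\<^sub>R g x))"
    using D by (subst integral_restrict_space) auto
  also have "\<dots> = (LINT x|lebesgue. indicator P x *\<^sub>R g x)"
  proof (rule integral_cong_AE)
    have "AE x in lebesgue. x \<notin> P - D" using P(2) by (intro AE_not_in) (simp add: negligible_iff_null_sets)
    then show "AE x in lebesgue. indicator D x *\<^sub>R (indicator P x *\<^sub>R g x) = indicator P x *\<^sub>R g x"
      by eventually_elim (auto simp: indicator_def)
    show "(\<lambda>x. indicator D x *\<^sub>R indicator P x *\<^sub>R g x) \<in> borel_measurable lebesgue"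
      "(\<lambda>x. indicator P x *\<^sub>R g x) \<in> borel_measurable lebesgue"
      using D P g by (auto intro!: measurable_completion borel_measurable_scaleR borel_measurable_indicator)
  qed
  also have "\<dots> = (\<integral>x. indicator P x *\<^sub>R g x \<partial>lborel)"
    using P g by (intro integral_completion) auto
  finally show ?thesis .
qed

text \<open>In the variable \<tau> \<kappa> this is the decay of x^2 / exp x.\<close>

lemma eventually_exp_bound:
  fixes \<kappa> N \<epsilon> :: real
  assumes "\<kappa> > 0" "\<epsilon> > 0"
  shows "\<forall>\<^sub>F \<tau> in at_top. N * exp (- (\<tau> * \<kappa>)) \<le> \<epsilon> / \<tau>\<^sup>2"
proof -
  have "filterlim (\<lambda>\<tau>. \<tau> * \<kappa>) at_top at_top"
    using assms(1) by (intro filterlim_at_top_mult_tendsto_pos[OF tendsto_const] filterlim_ident)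
  with tendsto_power_div_exp_0[of 2] have "((\<lambda>\<tau>. (\<tau> * \<kappa>)\<^sup>2 / exp (\<tau> * \<kappa>)) \<longlongrightarrow> 0) at_top"
    by (rule filterlim_compose)
  then have "((\<lambda>\<tau>. N / \<kappa>\<^sup>2 * ((\<tau> * \<kappa>)\<^sup>2 / exp (\<tau> * \<kappa>))) \<longlongrightarrow> N / \<kappa>\<^sup>2 * 0) at_top"
    by (intro tendsto_mult tendsto_const)
  then have "\<forall>\<^sub>F \<tau> in at_top. N / \<kappa>\<^sup>2 * ((\<tau> * \<kappa>)\<^sup>2 / exp (\<tau> * \<kappa>)) < \<epsilon>"
    using assms(2) by (intro order_tendstoD(2)[of _ "N / \<kappa>\<^sup>2 * 0"]) auto
  then show ?thesis using eventually_gt_at_top[of 0]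
  proof eventually_elim
    case (elim \<tau>)
    have "N / \<kappa>\<^sup>2 * ((\<tau> * \<kappa>)\<^sup>2 / exp (\<tau> * \<kappa>)) = N * exp (- (\<tau> * \<kappa>)) * \<tau>\<^sup>2"
      using assms(1) by (simp add: power_mult_distrib exp_minus field_simps)
    then show ?case using elim by (simp add: pos_le_divide_eq)
  qed
qed

text \<open>
  On a small parallelogram \<open>P\<close> at the corner \<open>\<rho>\<close> is nearly constant, and the integral of the exponential over
  \<open>P\<close> is explicit of order $\tau^{-2}$; off \<open>P\<close> the integrand is exponentially small.
\<close>
lemma corner_integral_lower_bound:
  fixes \<rho> \<rho>' :: "real^2 \<Rightarrow> complex"
  assumes poly: "open_polygon ps D" and \<rho>: "square_integrable (lebesgue_on D) \<rho>"
    and p: "p \<in> set ps" and max: "\<And>q. q \<in> set ps \<Longrightarrow> q \<noteq> p \<Longrightarrow> q \<bullet> d < p \<bullet> d" and d: "norm d = 1" and k: "k \<ge> 0"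
    and \<eta>: "\<eta> > 0" "AE x in lebesgue. x \<in> ball p \<eta> \<inter> closure D \<longrightarrow> \<rho> x = \<rho>' x"
    and cont: "\<And>\<omega>. \<omega> > 0 \<Longrightarrow> \<exists>r>0. \<forall>x\<in>ball p r. cmod (\<rho>' x - \<rho>' p) \<le> \<omega>" and nz: "\<rho>' p \<noteq> 0"
  shows "\<exists>c>0. \<forall>\<^sub>F \<tau> in at_top. c / \<tau>\<^sup>2 \<le> cmod (LINT x|lebesgue_on D. \<rho> x * exp (clin (cgo k d \<tau>) (x - p)))"
proof -
  let ?M = "lebesgue_on D"
  have opD: "open D" "bounded D" and hull: "D \<subseteq> convex hull (set ps)" using open_polygon_subset_hull[OF poly] by auto
  obtain v w \<delta>0 where J: "cross2 v w \<noteq> 0" and vd: "v \<bullet> d < 0" "w \<bullet> d < 0" and \<delta>0: "\<delta>0 > 0"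
    and loc: "\<And>s t. \<bar>s\<bar> < \<delta>0 \<Longrightarrow> \<bar>t\<bar> < \<delta>0 \<Longrightarrow> p + s *\<^sub>R v + t *\<^sub>R w \<in> D \<longleftrightarrow> 0 < s \<and> 0 < t"
    using open_polygon_corner[OF poly p max] by blast
  have vw0: "v \<noteq> 0" "w \<noteq> 0" using vd by auto
  define c0 where "c0 = \<rho>' p"
  \<comment> \<open>The main term will have modulus at least \<open>A / \<tau>\<^sup>2\<close>: each
    edge \<open>u\<close> contributes a factor 1 / (4 \<tau> |u|), whence 16.\<close>
  define A where "A = cmod c0 * \<bar>cross2 v w\<bar> / (16 * norm v * norm w)"
  have A: "A > 0" using nz J vw0 by (simp add: A_def c0_def)
  \<comment> \<open>Solved from the requirement that the error caused by the variation of \<rho>,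
    namely \<omega> times the bound for the integral of the modulus, is half of
    \<open>A / \<tau>\<^sup>2\<close>.\<close>
  define \<omega> where "\<omega> = A / 2 * ((v \<bullet> d) * (w \<bullet> d)) / \<bar>cross2 v w\<bar>"
  have \<omega>: "\<omega> > 0" unfolding \<omega>_def using A vd J by (intro divide_pos_pos mult_pos_pos mult_neg_neg) auto
  obtain r where r: "r > 0" "\<And>x. x \<in> ball p r \<Longrightarrow> cmod (\<rho>' x - c0) \<le> \<omega>" using cont[OF \<omega>] by (auto simp: c0_def)
  define m where "m = min r \<eta>"
  have m: "m > 0" using r \<eta> by (simp add: m_def)
  \<comment> \<open>Small enough for the description of \<open>D\<close> near the corner and for
    \<open>P\<close> to stay in the ball where \<rho> is within \<omega> of
    \<open>c0\<close>.\<close>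
  define \<delta> where "\<delta> = min (\<delta>0 / 2) (m / (2 * (norm v + norm w)))"
  have nvw: "norm v + norm w > 0" using vw0 by (simp add: add_pos_pos)
  have \<delta>: "\<delta> > 0" "\<delta> < \<delta>0" "\<delta> * (norm v + norm w) < m"
  proof -
    show "\<delta> > 0" "\<delta> < \<delta>0" using \<delta>0 m nvw by (auto simp: \<delta>_def min_less_iff_disj)
    have "\<delta> * (norm v + norm w) \<le> m / (2 * (norm v + norm w)) * (norm v + norm w)"
      using nvw by (intro mult_right_mono) (auto simp: \<delta>_def)
    also have "\<dots> = m / 2" using vw0 nvw by (simp add: field_simps)
    also have "\<dots> < m" using m by simp
    finally show "\<delta> * (norm v + norm w) < m" .
  qed
  define P where "P = (\<lambda>(s, t). p + s *\<^sub>R v + t *\<^sub>R w) ` ({0..\<delta>} \<times> {0..\<delta>})"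
  have "compact P" unfolding P_def case_prod_beta
    by (intro compact_continuous_image compact_Times continuous_intros) auto
  then have Pb: "P \<in> sets borel" by (simp add: borel_compact)
  have Pball: "P \<subseteq> ball p m"
  proof
    fix x assume "x \<in> P"
    then obtain s t where st: "0 \<le> s" "s \<le> \<delta>" "0 \<le> t" "t \<le> \<delta>" "x = p + s *\<^sub>R v + t *\<^sub>R w" by (auto simp: P_def)
    have "norm (s *\<^sub>R v + t *\<^sub>R w) \<le> s * norm v + t * norm w" using norm_triangle_ineq[of "s *\<^sub>R v" "t *\<^sub>R w"] st by simp
    also have "\<dots> \<le> \<delta> * norm v + \<delta> * norm w" using st by (intro add_mono mult_right_mono) auto
    also have "\<dots> < m" using \<delta>(3) by (simp add: distrib_left)
    finally show "x \<in> ball p m" by (simp add: st dist_norm norm_minus_commute add.assoc add.commute[of "t *\<^sub>R w"])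
  qed
  have Pneg: "negligible (P - D)"
  proof (rule negligible_subset)
    show "negligible ({x. cross2 v (x - p) = 0} \<union> {x. cross2 w (x - p) = 0})"
      by (intro negligible_Un negligible_parallel_line vw0)
    show "P - D \<subseteq> {x. cross2 v (x - p) = 0} \<union> {x. cross2 w (x - p) = 0}"
    proof
      fix x assume "x \<in> P - D"
      then obtain s t where st: "0 \<le> s" "s \<le> \<delta>" "0 \<le> t" "t \<le> \<delta>" "x = p + s *\<^sub>R v + t *\<^sub>R w" "x \<notin> D" by (auto simp: P_def)
      then have "\<not> (0 < s \<and> 0 < t)" using loc[of s t] \<delta> by auto
      then have "s = 0 \<or> t = 0" using st by auto
      then show "x \<in> {x. cross2 v (x - p) = 0} \<union> {x. cross2 w (x - p) = 0}" by (auto simp: st cross2_def)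
    qed
  qed
  \<comment> \<open>\<open>P\<close> is no neighbourhood of \<open>p\<close>. Removing the open set
    \<open>N\<close> instead leaves a compact part of the closure of \<open>D\<close> that misses
    \<open>p\<close>, so the functional stays a fixed \<kappa> below its maximum there.\<close>
  define N where "N = {x. \<bar>cross2 (x - p) w / cross2 v w\<bar> < \<delta> \<and> \<bar>cross2 v (x - p) / cross2 v w\<bar> < \<delta>}"
  have "open N" unfolding N_def cross2_def
    by (intro open_Collect_conj open_Collect_less continuous_intros) (use J in \<open>auto simp: cross2_def\<close>)
  have pN: "p \<in> N" using \<delta>(1) by (simp add: N_def cross2_def)
  have DP: "D - P \<subseteq> closure D - N"
  proof
    fix x assume x: "x \<in> D - P"
    have "x \<notin> N"
    proof
      assume xN: "x \<in> N"
      define s t where "s = cross2 (x - p) w / cross2 v w" and "t = cross2 v (x - p) / cross2 v w"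
      have xe: "x = p + s *\<^sub>R v + t *\<^sub>R w" using cross2_solve[OF J, of "x - p"] by (simp add: s_def t_def algebra_simps)
      have st: "\<bar>s\<bar> < \<delta>" "\<bar>t\<bar> < \<delta>" using xN by (auto simp: N_def s_def t_def)
      then have "0 < s \<and> 0 < t" using loc[of s t] \<delta> x xe by auto
      then have "x \<in> P" unfolding P_def using st xe by (auto intro!: image_eqI[of _ _ "(s, t)"])
      then show False using x by simp
    qed
    then show "x \<in> closure D - N" using x closure_subset[of D] by auto
  qed
  have "\<exists>\<kappa>>0. \<forall>x\<in>closure D - N. (x - p) \<bullet> d \<le> - \<kappa>"
  proof (cases "closure D - N = {}")
    case True
    then show ?thesis by (intro exI[of _ 1]) auto
  next
    case False
    have "compact (closure D - N)" using opD \<open>open N\<close> by (intro compact_diff) auto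
    then obtain y where y: "y \<in> closure D - N" "\<And>x. x \<in> closure D - N \<Longrightarrow> x \<bullet> d \<le> y \<bullet> d"
      using continuous_attains_sup[OF _ False continuous_on_inner[OF continuous_on_id continuous_on_const[of _ d]]] by blast
    have "closed (convex hull (set ps))" by (intro compact_imp_closed finite_imp_compact_convex_hull) simp
    then have "closure D \<subseteq> convex hull (set ps)" using hull by (rule closure_minimal[rotated])
    moreover have "y \<noteq> p" using y pN by auto
    ultimately have "y \<bullet> d < p \<bullet> d" using convex_hull_unique_max[OF p max] y(1) by blast
    then show ?thesis using y(2) by (intro exI[of _ "p \<bullet> d - y \<bullet> d"]) (auto simp: inner_diff_left)
  qed
  then obtain \<kappa> where \<kappa>: "\<kappa> > 0" "\<And>x. x \<in> closure D - N \<Longrightarrow> (x - p) \<bullet> d \<le> - \<kappa>" by blast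
  have \<rho>i: "integrable ?M \<rho>"
    by (rule square_integrable_imp_integrable[OF finite_measure_lebesgue_on[OF opD] \<rho>])
  define R where "R = (LINT x|?M. cmod (\<rho> x))"
  have ev: "\<forall>\<^sub>F \<tau> in at_top. R * exp (- (\<tau> * \<kappa>)) \<le> (A / 4) / \<tau>\<^sup>2"
    by (rule eventually_exp_bound) (use \<kappa> A in auto)
  \<comment> \<open>This keeps the numerators in the exact formula, exponential minus 1, away from
    0.\<close>
  have ev2: "\<forall>\<^sub>F \<tau> in at_top. exp (\<delta> * (\<tau> * (u \<bullet> d))) \<le> 1/2" if "u \<bullet> d < 0" for u
  proof -
    have "\<forall>\<^sub>F \<tau> in at_top. \<tau> \<ge> 1 / (\<delta> * (- (u \<bullet> d)))" by (rule eventually_ge_at_top)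
    then show ?thesis
    proof eventually_elim
      case (elim \<tau>)
      have "\<delta> * (- (u \<bullet> d)) > 0" using that \<delta> by (simp add: mult_pos_neg)
      then have "1 \<le> \<tau> * (\<delta> * (- (u \<bullet> d)))" using elim by (simp only: pos_divide_le_eq)
      then have "2 \<le> exp (- (\<delta> * (\<tau> * (u \<bullet> d))))"
        using exp_ge_add_one_self[of "- (\<delta> * (\<tau> * (u \<bullet> d)))"] by (simp add: algebra_simps)
      then show ?case by (simp add: exp_minus field_simps)
    qed
  qed
  have "\<forall>\<^sub>F \<tau> in at_top. (A / 4) / \<tau>\<^sup>2 \<le> cmod (LINT x|?M. \<rho> x * exp (clin (cgo k d \<tau>) (x - p)))"
    using ev ev2[OF vd(1)] ev2[OF vd(2)] eventually_gt_at_top[of 0] eventually_ge_at_top[of k]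
  proof eventually_elim
    case (elim \<tau>)
    define \<zeta> where "\<zeta> = cgo k d \<tau>"
    define e where "e x = exp (clin \<zeta> (x - p))" for x
    have Re\<zeta>: "Re (clin \<zeta> x) = \<tau> * (x \<bullet> d)" for x by (simp add: \<zeta>_def clin_cgo)
    have ne: "cmod (e x) = exp (\<tau> * ((x - p) \<bullet> d))" for x by (simp add: e_def Re\<zeta>)
    have nz\<zeta>: "clin \<zeta> v \<noteq> 0" "clin \<zeta> w \<noteq> 0" using Re\<zeta>[of v] Re\<zeta>[of w] vd elim by auto
    have ce: "continuous_on UNIV e" unfolding e_def
      by (intro continuous_intros continuous_on_compose2[OF continuous_clin[of UNIV]]) auto
    have me: "e \<in> borel_measurable borel" using ce by (rule borel_measurable_continuous_onI)
    have int\<rho>e: "integrable ?M (\<lambda>x. \<rho> x * e x)"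
      unfolding e_def by (rule norm_integral_exp_le(1)[OF opD \<rho>i, of "{}"]) auto
    have inte: "integrable ?M e" using ce opD by (rule integrable_continuous_bounded)
    have mI: "indicator B \<in> borel_measurable ?M" if "B \<in> sets borel" for B :: "(real^2) set"
      using that by (intro measurable_restrict_space1 measurable_completion borel_measurable_indicator) auto
    have intI: "integrable ?M (\<lambda>x. indicator B x *\<^sub>R f x)" if "B \<in> sets borel" "integrable ?M f" for B and f :: "real^2 \<Rightarrow> complex"
    proof (rule Bochner_Integration.integrable_bound[OF that(2)])
      show "(\<lambda>x. indicator B x *\<^sub>R f x) \<in> borel_measurable ?M"
        by (intro borel_measurable_scaleR mI that(1) borel_measurable_integrable[OF that(2)])
    qed (auto simp: indicator_def)
    have rest: "cmod (LINT x|?M. indicator (- P) x *\<^sub>R (\<rho> x * e x)) \<le> exp (- (\<tau> * \<kappa>)) * R"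
      unfolding e_def R_def
    proof (rule norm_integral_exp_le(2)[OF opD \<rho>i])
      fix x assume "x \<in> D" "x \<in> - P"
      then have "(x - p) \<bullet> d \<le> - \<kappa>" using DP by (intro \<kappa>(2)) auto
      then show "Re (clin \<zeta> (x - p)) \<le> - (\<tau> * \<kappa>)" unfolding Re\<zeta> using elim(4) mult_left_mono[of "(x - p) \<bullet> d" "- \<kappa>" \<tau>] by simp
    qed (use Pb in auto)
    have main: "(LINT x|?M. indicator P x *\<^sub>R e x) = of_real \<bar>cross2 v w\<bar> * ((exp (of_real \<delta> * clin \<zeta> v) - 1) / clin \<zeta> v) * ((exp (of_real \<delta> * clin \<zeta> w) - 1) / clin \<zeta> w)"
      unfolding integral_lebesgue_on_almost_subset[OF opD(1) Pb Pneg me]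
      using integral_exp_parallelogram(2)[OF J \<delta>(1) nz\<zeta> P_def] by (simp add: e_def)
    \<comment> \<open>The numerator has modulus at least 1/2, the denominator at most 2 \<tau>
      |u|.\<close>
    have fac: "1 / (4 * \<tau> * norm u) \<le> cmod ((exp (of_real \<delta> * clin \<zeta> u) - 1) / clin \<zeta> u)"
      if "exp (\<delta> * (\<tau> * (u \<bullet> d))) \<le> 1/2" "u \<noteq> 0" "clin \<zeta> u \<noteq> 0" for u
    proof -
      have "cmod (exp (of_real \<delta> * clin \<zeta> u)) \<le> 1/2" using that(1) by (simp add: Re\<zeta>)
      then have "1/2 \<le> cmod (exp (of_real \<delta> * clin \<zeta> u) - 1)"
        using norm_triangle_ineq2[of 1 "exp (of_real \<delta> * clin \<zeta> u)"] by (simp add: norm_minus_commute)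
      moreover have "cmod (clin \<zeta> u) \<le> 2 * \<tau> * norm u" unfolding \<zeta>_def using elim k by (intro norm_clin_cgo(2)[OF d]) auto
      ultimately have "(1/2) / (2 * \<tau> * norm u) \<le> cmod (exp (of_real \<delta> * clin \<zeta> u) - 1) / cmod (clin \<zeta> u)"
        using that elim by (intro frac_le) auto
      then show ?thesis by (simp add: norm_divide)
    qed
    have "\<bar>cross2 v w\<bar> * (1 / (4 * \<tau> * norm v)) * (1 / (4 * \<tau> * norm w)) \<le> cmod (LINT x|?M. indicator P x *\<^sub>R e x)"
      unfolding main norm_mult norm_of_real abs_abs
      using elim fac[OF elim(2) vw0(1) nz\<zeta>(1)] fac[OF elim(3) vw0(2) nz\<zeta>(2)] by (intro mult_mono) auto
    then have "cmod c0 * (\<bar>cross2 v w\<bar> * (1 / (4 * \<tau> * norm v)) * (1 / (4 * \<tau> * norm w))) \<le> cmod (c0 * (LINT x|?M. indicator P x *\<^sub>R e x))"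
      unfolding norm_mult by (rule mult_left_mono) simp
    moreover have "cmod c0 * (\<bar>cross2 v w\<bar> * (1 / (4 * \<tau> * norm v)) * (1 / (4 * \<tau> * norm w))) = A / \<tau>\<^sup>2"
      by (simp add: A_def power2_eq_square)
    ultimately have lower: "A / \<tau>\<^sup>2 \<le> cmod (c0 * (LINT x|?M. indicator P x *\<^sub>R e x))" by simp
    have err: "cmod (LINT x|?M. indicator P x *\<^sub>R ((\<rho> x - c0) * e x)) \<le> (A / 2) / \<tau>\<^sup>2"
    proof -
      have mg: "(\<lambda>x. exp (\<tau> * ((x - p) \<bullet> d))) \<in> borel_measurable borel"
        by (intro borel_measurable_continuous_onI continuous_intros)
      have "AE x in lebesgue_on D. x \<in> ball p \<eta> \<inter> closure D \<longrightarrow> \<rho> x = \<rho>' x"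
        using \<eta>(2) opD(1) by (subst AE_restrict_space_iff) (auto elim!: eventually_mono)
      then have AE: "AE x in ?M. cmod (indicator P x *\<^sub>R ((\<rho> x - c0) * e x)) \<le> \<omega> * (indicator P x * exp (\<tau> * ((x - p) \<bullet> d)))"
        using AE_space
      proof eventually_elim
        case (elim x)
        show ?case
        proof (cases "x \<in> P")
          case True
          then have "x \<in> ball p r" "x \<in> ball p \<eta>" using Pball by (auto simp: m_def)
          moreover have "x \<in> closure D" using elim(2) closure_subset[of D] by (auto simp: space_restrict_space)
          ultimately have "cmod (\<rho> x - c0) \<le> \<omega>" using elim(1) r(2) by auto
          then show ?thesis using True by (simp add: norm_mult ne mult_right_mono)
        qed simp
      qed
      have intg: "integrable ?M (\<lambda>x. \<omega> * (indicator P x * exp (\<tau> * ((x - p) \<bullet> d))))"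
      proof -
        have "integrable ?M (\<lambda>x. norm (indicator P x *\<^sub>R e x))" using intI[OF Pb inte] by (rule integrable_norm)
        then show ?thesis by (simp add: ne)
      qed
      have "cmod (LINT x|?M. indicator P x *\<^sub>R ((\<rho> x - c0) * e x)) \<le> (LINT x|?M. \<omega> * (indicator P x * exp (\<tau> * ((x - p) \<bullet> d))))"
      proof (rule order_trans[OF integral_norm_bound integral_mono_AE[OF _ intg AE]])
        have "integrable ?M (\<lambda>x. (\<rho> x - c0) * e x)" unfolding left_diff_distrib using int\<rho>e inte by auto
        then show "integrable ?M (\<lambda>x. cmod (indicator P x *\<^sub>R ((\<rho> x - c0) * e x)))" by (intro integrable_norm intI[OF Pb])
      qed
      also have "\<dots> = \<omega> * (\<integral>x. indicator P x * exp (\<tau> * ((x - p) \<bullet> d)) \<partial>lborel)"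
        using integral_lebesgue_on_almost_subset[OF opD(1) Pb Pneg mg] by simp
      also have "\<dots> \<le> \<omega> * (\<bar>cross2 v w\<bar> / (\<tau>\<^sup>2 * (v \<bullet> d) * (w \<bullet> d)))"
        using \<omega> by (intro mult_left_mono parallelogram_real_bound(2)[OF J \<delta>(1) elim(4) vd P_def]) auto
      also have "\<dots> = (A / 2) / \<tau>\<^sup>2" using J vd elim(4) by (simp add: \<omega>_def)
      finally show ?thesis .
    qed
    have split: "(LINT x|?M. \<rho> x * e x) = c0 * (LINT x|?M. indicator P x *\<^sub>R e x) + (LINT x|?M. indicator P x *\<^sub>R ((\<rho> x - c0) * e x))
        + (LINT x|?M. indicator (- P) x *\<^sub>R (\<rho> x * e x))"
    proof -
      have i1: "integrable ?M (\<lambda>x. c0 * (indicator P x *\<^sub>R e x))" by (intro integrable_mult_right intI[OF Pb inte])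
      have "integrable ?M (\<lambda>x. (\<rho> x - c0) * e x)" unfolding left_diff_distrib using int\<rho>e inte by auto
      then have i2: "integrable ?M (\<lambda>x. indicator P x *\<^sub>R ((\<rho> x - c0) * e x))" by (rule intI[OF Pb])
      have i3: "integrable ?M (\<lambda>x. indicator (- P) x *\<^sub>R (\<rho> x * e x))" by (rule intI[OF _ int\<rho>e]) (use Pb in auto)
      have "(LINT x|?M. \<rho> x * e x) = (LINT x|?M. c0 * (indicator P x *\<^sub>R e x) + indicator P x *\<^sub>R ((\<rho> x - c0) * e x) + indicator (- P) x *\<^sub>R (\<rho> x * e x))"
        by (intro Bochner_Integration.integral_cong) (auto simp: indicator_def algebra_simps)
      then show ?thesis
        unfolding Bochner_Integration.integral_add[OF Bochner_Integration.integrable_add[OF i1 i2] i3]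
          Bochner_Integration.integral_add[OF i1 i2] integral_mult_right_zero .
    qed
    \<comment> \<open>Main term, variation of \<rho> on \<open>P\<close>, and remainder off
      \<open>P\<close>: of \<open>A\<close> the last two consume at most A/2 and A/4, so A/4
      survives.\<close>
    define X Y Z where "X = c0 * (LINT x|?M. indicator P x *\<^sub>R e x)" and "Y = (LINT x|?M. indicator P x *\<^sub>R ((\<rho> x - c0) * e x))"
      and "Z = (LINT x|?M. indicator (- P) x *\<^sub>R (\<rho> x * e x))"
    have "cmod X \<le> cmod (X + Y + Z) + cmod Y + cmod Z"
      using norm_triangle_ineq4[of "X + Y + Z" "Y + Z"] norm_triangle_ineq[of Y Z] by simp
    moreover have "cmod Z \<le> (A / 4) / \<tau>\<^sup>2" using rest elim(1) by (simp add: Z_def mult.commute)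
    moreover have "A / \<tau>\<^sup>2 = (A / 2) / \<tau>\<^sup>2 + (A / 4) / \<tau>\<^sup>2 + (A / 4) / \<tau>\<^sup>2" by (simp add: field_simps)
    ultimately have "(A / 4) / \<tau>\<^sup>2 \<le> cmod (X + Y + Z)" using lower err unfolding X_def[symmetric] Y_def[symmetric] by linarith
    also have "X + Y + Z = (LINT x|?M. \<rho> x * exp (clin (cgo k d \<tau>) (x - p)))"
      using split by (simp add: X_def Y_def Z_def e_def \<zeta>_def)
    finally show ?case .
  qed
  then show ?thesis using A by (intro exI[of _ "A / 4"]) auto
qed

section \<open>Convex hulls\<close>

text \<open>A hyperplane separates \<open>x\<close> from \<open>D2\<close>, and some point
  \<open>q0\<close> of \<open>S\<close> lies strictly beyond it because the hull of
  \<open>D1\<close> is open. Its normal is then tilted, at the cost of half the gap, off the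
  finitely many lines of directions in which two points of \<open>S\<close> tie.\<close>

lemma generic_separating_direction:
  fixes D1 D2 :: "(real^2) set"
  assumes D1: "open D1" "D1 \<subseteq> convex hull S" and S: "finite S"
    and D2: "open D2" "bounded D2" "D2 \<noteq> {}" and x: "x \<in> convex hull D1" "x \<notin> convex hull D2"
  obtains d p \<kappa> where "norm d = 1" "p \<in> S" "\<And>q. q \<in> S \<Longrightarrow> q \<noteq> p \<Longrightarrow> q \<bullet> d < p \<bullet> d" "\<kappa> > 0"
    "\<And>y. y \<in> D2 \<Longrightarrow> (y - p) \<bullet> d \<le> - \<kappa>"
proof -
  obtain a b where a: "a \<noteq> 0" "\<And>y. y \<in> convex hull D2 \<Longrightarrow> a \<bullet> y \<le> b" "a \<bullet> x \<ge> b"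
    using separating_hyperplane_sets[of "convex hull D2" "{x}"] D2 x by auto
  have "\<exists>q0\<in>S. b < a \<bullet> q0"
  proof (rule ccontr)
    assume "\<not> ?thesis"
    then have "S \<subseteq> {y. a \<bullet> y \<le> b}" by auto
    then have "convex hull S \<subseteq> {y. a \<bullet> y \<le> b}" by (intro hull_minimal convex_halfspace_le)
    then have "convex hull D1 \<subseteq> {y. a \<bullet> y \<le> b}" using D1(2) by (intro hull_minimal convex_halfspace_le) auto
    moreover obtain e where e: "e > 0" "ball x e \<subseteq> convex hull D1"
      using open_convex_hull[OF D1(1)] x(1) open_contains_ball by blast
    \<comment> \<open>A step of length e/2 along \<open>a\<close> stays in the hull of
      \<open>D1\<close> but passes beyond the level \<open>b\<close>.\<close>
    moreover have "x + (e / (2 * norm a)) *\<^sub>R a \<in> ball x e" using e a(1) by (simp add: dist_norm)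
    ultimately have "a \<bullet> (x + (e / (2 * norm a)) *\<^sub>R a) \<le> b" by blast
    moreover have "(e / (2 * norm a)) * (a \<bullet> a) > 0" using e(1) a(1) by simp
    ultimately show False using a(3) by (simp add: inner_add_right)
  qed
  then obtain q0 where q0: "q0 \<in> S" "b < a \<bullet> q0" by blast
  obtain R where R: "\<And>y. y \<in> D2 \<Longrightarrow> norm y \<le> R" using D2(2) by (auto simp: bounded_iff)
  \<comment> \<open>As |q0 - y| is at most \<open>norm q0 + \<bar>R\<bar> + 1\<close> for y in
    \<open>D2\<close>, tilting \<open>a\<close> by at most \<epsilon> changes the product with q0 -
    y by no more than half the gap.\<close>
  define \<epsilon> where "\<epsilon> = (a \<bullet> q0 - b) / (2 * (norm q0 + \<bar>R\<bar> + 1))"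
  have pos: "norm q0 + \<bar>R\<bar> + 1 > 0" by (simp add: add_nonneg_pos)
  have \<epsilon>: "\<epsilon> > 0" using q0 pos by (simp add: \<epsilon>_def)
  \<comment> \<open>A finite union of lines through the origin has measure zero, so no ball around
    \<open>a\<close> is contained in it.\<close>
  define Bad where "Bad = (\<Union>(q, q')\<in>{(q, q'). q \<in> S \<and> q' \<in> S \<and> q \<noteq> q'}. {z. (q - q') \<bullet> z = 0})"
  have "negligible Bad" unfolding Bad_def
  proof (rule negligible_Union)
    have "finite {(q, q'). q \<in> S \<and> q' \<in> S \<and> q \<noteq> q'}"
      by (rule finite_subset[of _ "S \<times> S"]) (use S in auto)
    then show "finite ((\<lambda>(q, q'). {z. (q - q') \<bullet> z = 0}) ` {(q, q'). q \<in> S \<and> q' \<in> S \<and> q \<noteq> q'})" by simp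
  qed (auto intro!: negligible_hyperplane)
  moreover have "\<not> negligible (ball a \<epsilon>)" using \<epsilon> by (intro open_not_negligible) auto
  ultimately have "\<not> ball a \<epsilon> \<subseteq> Bad" using negligible_subset by blast
  then obtain d0 where d0: "d0 \<in> ball a \<epsilon>" "d0 \<notin> Bad" by blast
  have gen: "q \<bullet> d0 \<noteq> q' \<bullet> d0" if "q \<in> S" "q' \<in> S" "q \<noteq> q'" for q q'
  proof
    assume "q \<bullet> d0 = q' \<bullet> d0"
    then have "(q - q') \<bullet> d0 = 0" by (simp add: inner_diff_left)
    then show False using d0(2) that unfolding Bad_def by blast
  qed
  define \<kappa>0 where "\<kappa>0 = (a \<bullet> q0 - b) / 2"
  have \<kappa>0: "\<kappa>0 > 0" using q0 by (simp add: \<kappa>0_def)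
  have sep: "y \<bullet> d0 \<le> q0 \<bullet> d0 - \<kappa>0" if "y \<in> D2" for y
  proof -
    have "\<bar>(q0 - y) \<bullet> (d0 - a)\<bar> \<le> norm (q0 - y) * norm (d0 - a)" by (rule Cauchy_Schwarz_ineq2)
    also have "\<dots> \<le> (norm q0 + \<bar>R\<bar> + 1) * \<epsilon>"
    proof (rule mult_mono)
      show "norm (q0 - y) \<le> norm q0 + \<bar>R\<bar> + 1" using norm_triangle_ineq4[of q0 y] R[OF that] by linarith
      show "norm (d0 - a) \<le> \<epsilon>" using d0(1) by (simp add: dist_norm norm_minus_commute)
    qed (use pos in auto)
    also have "\<dots> = \<kappa>0"
    proof -
      have "m * (X / (2 * m)) = X / 2" if "m > 0" for m X :: real using that by simp
      then show ?thesis unfolding \<epsilon>_def \<kappa>0_def using pos by blast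
    qed
    finally have "(q0 - y) \<bullet> d0 \<ge> (q0 - y) \<bullet> a - \<kappa>0" by (simp add: inner_diff_right abs_le_iff)
    moreover have "a \<bullet> y \<le> b" using that by (intro a(2)) (simp add: hull_inc)
    ultimately show ?thesis by (simp add: inner_diff_left inner_diff_right inner_commute[of _ a] \<kappa>0_def field_simps)
  qed
  have fin: "finite ((\<lambda>q. q \<bullet> d0) ` S)" "(\<lambda>q. q \<bullet> d0) ` S \<noteq> {}" using S q0 by auto
  obtain p where p: "p \<in> S" "p \<bullet> d0 = Max ((\<lambda>q. q \<bullet> d0) ` S)" using Max_in[OF fin] by auto
  have pmax: "q \<bullet> d0 \<le> p \<bullet> d0" if "q \<in> S" for q unfolding p(2) using fin that by (intro Max_ge) auto
  have "d0 \<noteq> 0"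
  proof
    assume "d0 = 0"
    obtain y where "y \<in> D2" using D2(3) by blast
    then show False using sep[of y] \<kappa>0 \<open>d0 = 0\<close> by simp
  qed
  define d where "d = (1 / norm d0) *\<^sub>R d0"
  show thesis
  proof (rule that)
    show "norm d = 1" using \<open>d0 \<noteq> 0\<close> by (simp add: d_def)
    show "p \<in> S" by (rule p(1))
    show "q \<bullet> d < p \<bullet> d" if "q \<in> S" "q \<noteq> p" for q
      using pmax[OF that(1)] gen[OF that(1) p(1) that(2)] \<open>d0 \<noteq> 0\<close> by (simp add: d_def divide_strict_right_mono)
    show "\<kappa>0 / norm d0 > 0" using \<kappa>0 \<open>d0 \<noteq> 0\<close> by simp
    show "(y - p) \<bullet> d \<le> - (\<kappa>0 / norm d0)" if "y \<in> D2" for y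
    proof -
      have "(y - p) \<bullet> d0 \<le> - \<kappa>0" using sep[OF that] pmax[OF q0(1)] by (simp add: inner_diff_left)
      then have "(y - p) \<bullet> d0 / norm d0 \<le> (- \<kappa>0) / norm d0" by (intro divide_right_mono) auto
      then show ?thesis by (simp add: d_def)
    qed
  qed
qed

section \<open>From equal Cauchy data to inclusion of the hulls\<close>

lemma open_polygon_nonempty:
  assumes "open_polygon ps D"
  shows "D \<noteq> {}"
proof -
  have ps: "ps \<noteq> []" "simple_path (closed_polyline ps)" "D = inside (path_image (closed_polyline ps))"
    using assms by (auto simp: open_polygon_def)
  then have "path_image (closed_polyline ps) \<subseteq> closure D"
    using Jordan_curve_subset_closure_inside closed_polyline_ends by metis
  moreover have "path_image (closed_polyline ps) \<noteq> {}" by (rule path_image_nonempty)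
  ultimately show ?thesis by auto
qed

text \<open>The radius solves \<open>(\<bar>C\<bar> + 1) * r powr \<alpha> = \<omega>\<close>, cut
  off at \<eta>; the summand 1 excludes division by 0.\<close>

lemma holder_on_continuous_at_centre:
  assumes "holder_on \<alpha> (cball p \<eta>) f" "\<alpha> > 0" "\<eta> > 0" "\<omega> > 0"
  shows "\<exists>r>0. \<forall>x\<in>ball p r. cmod (f x - f p) \<le> \<omega>"
proof -
  obtain C where C: "\<And>x y. x \<in> cball p \<eta> \<Longrightarrow> y \<in> cball p \<eta> \<Longrightarrow> cmod (f x - f y) \<le> C * dist x y powr \<alpha>"
    using assms(1) unfolding holder_on_def by blast
  define r where "r = min \<eta> ((\<omega> / (\<bar>C\<bar> + 1)) powr (1 / \<alpha>))"
  have r: "r > 0" using assms by (simp add: r_def)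
  have "cmod (f x - f p) \<le> \<omega>" if x: "x \<in> ball p r" for x
  proof -
    have "dist x p < r" "r \<le> \<eta>" using x by (auto simp: dist_commute r_def)
    then have "cmod (f x - f p) \<le> C * dist x p powr \<alpha>" using assms(3) by (intro C) (auto simp: dist_commute)
    also have "\<dots> \<le> (\<bar>C\<bar> + 1) * dist x p powr \<alpha>" by (intro mult_right_mono) auto
    also have "\<dots> \<le> (\<bar>C\<bar> + 1) * ((\<omega> / (\<bar>C\<bar> + 1)) powr (1 / \<alpha>)) powr \<alpha>"
      using \<open>dist x p < r\<close> assms(2) by (intro mult_left_mono powr_mono2) (auto simp: r_def)
    also have "((\<omega> / (\<bar>C\<bar> + 1)) powr (1 / \<alpha>)) powr \<alpha> = \<omega> / (\<bar>C\<bar> + 1)"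
      using assms by (simp add: powr_powr)
    finally show ?thesis by simp
  qed
  then show ?thesis using r by blast
qed

lemma admissible_polygon:
  assumes "admissible \<Omega> D \<rho>"
  obtains ps where "open_polygon ps D" "open D" "bounded D" "closure D \<subseteq> \<Omega>" "square_integrable (lebesgue_on D) \<rho>"
    "\<And>p. p \<in> set ps \<Longrightarrow> \<exists>\<eta> \<rho>'. \<eta> > 0 \<and> (AE x in lebesgue. x \<in> ball p \<eta> \<inter> closure D \<longrightarrow> \<rho> x = \<rho>' x) \<and> \<rho>' p \<noteq> 0
        \<and> (\<forall>\<omega>>0. \<exists>r>0. \<forall>x\<in>ball p r. cmod (\<rho>' x - \<rho>' p) \<le> \<omega>)"
proof -
  obtain ps where ps: "open_polygon ps D" "closure D \<subseteq> \<Omega>" "square_integrable (lebesgue_on D) \<rho>"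
    and v: "\<forall>p\<in>set ps. \<exists>\<eta> \<alpha> \<rho>'. \<eta> > 0 \<and> 0 < \<alpha> \<and> \<alpha> \<le> 1 \<and> holder_on \<alpha> (cball p \<eta>) \<rho>' \<and>
          (AE x in lebesgue. x \<in> ball p \<eta> \<inter> closure D \<longrightarrow> \<rho> x = \<rho>' x) \<and> \<rho>' p \<noteq> 0"
    using assms unfolding admissible_def by blast
  show thesis
  proof (rule that[OF ps(1) open_polygon_subset_hull(2,3)[OF ps(1)] ps(2,3)])
    fix p assume "p \<in> set ps"
    then obtain \<eta> \<alpha> \<rho>' where *: "\<eta> > 0" "0 < \<alpha>" "holder_on \<alpha> (cball p \<eta>) \<rho>'"
        "AE x in lebesgue. x \<in> ball p \<eta> \<inter> closure D \<longrightarrow> \<rho> x = \<rho>' x" "\<rho>' p \<noteq> 0"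
      using v by blast
    then show "\<exists>\<eta> \<rho>'. \<eta> > 0 \<and> (AE x in lebesgue. x \<in> ball p \<eta> \<inter> closure D \<longrightarrow> \<rho> x = \<rho>' x) \<and> \<rho>' p \<noteq> 0
        \<and> (\<forall>\<omega>>0. \<exists>r>0. \<forall>x\<in>ball p r. cmod (\<rho>' x - \<rho>' p) \<le> \<omega>)"
      using holder_on_continuous_at_centre[OF *(3,2,1)] by blast
  qed
qed

text \<open>If the inclusion fails, then |a1| c / \<tau> \<le> 2 \<tau> |a2| R exp (- \<tau>
  \<kappa>) for all large \<tau>, which is absurd. Exchanging the two sources gives the reverse
  inclusion.\<close>

lemma convex_hull_subset_of_cauchy_data:
  assumes \<Omega>: "lipschitz_domain \<Omega>" and k: "k \<ge> 0"
    and adm: "admissible \<Omega> D1 \<rho>1" "admissible \<Omega> D2 \<rho>2" and a1: "a1 \<noteq> 0"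
    and c1: "has_cauchy_data \<Omega> k (div_source \<Omega> D1 \<rho>1 a1) u1 g h"
    and c2: "has_cauchy_data \<Omega> k (div_source \<Omega> D2 \<rho>2 a2) u2 g h"
  shows "convex hull D1 \<subseteq> convex hull D2"
proof (rule ccontr)
  assume "\<not> ?thesis"
  then obtain x where x: "x \<in> convex hull D1" "x \<notin> convex hull D2" by blast
  obtain ps1 where poly1: "open_polygon ps1 D1" and D1: "open D1" "bounded D1" "closure D1 \<subseteq> \<Omega>" and \<rho>1: "square_integrable (lebesgue_on D1) \<rho>1"
    and corner: "\<And>p. p \<in> set ps1 \<Longrightarrow> \<exists>\<eta> \<rho>'. \<eta> > 0 \<and> (AE x in lebesgue. x \<in> ball p \<eta> \<inter> closure D1 \<longrightarrow> \<rho>1 x = \<rho>' x) \<and> \<rho>' p \<noteq> 0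
        \<and> (\<forall>\<omega>>0. \<exists>r>0. \<forall>x\<in>ball p r. cmod (\<rho>' x - \<rho>' p) \<le> \<omega>)"
    by (rule admissible_polygon[OF adm(1)]) blast
  obtain ps2 where poly2: "open_polygon ps2 D2" and D2: "open D2" "bounded D2" "closure D2 \<subseteq> \<Omega>" and \<rho>2: "square_integrable (lebesgue_on D2) \<rho>2"
    by (rule admissible_polygon[OF adm(2)]) blast
  obtain d p \<kappa> where d: "norm d = 1" and p: "p \<in> set ps1" "\<And>q. q \<in> set ps1 \<Longrightarrow> q \<noteq> p \<Longrightarrow> q \<bullet> d < p \<bullet> d"
    and \<kappa>: "\<kappa> > 0" "\<And>y. y \<in> D2 \<Longrightarrow> (y - p) \<bullet> d \<le> - \<kappa>"
    using generic_separating_direction[OF D1(1) open_polygon_subset_hull(1)[OF poly1] finite_set D2(1,2) open_polygon_nonempty[OF poly2] x] by blast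
  obtain \<eta> \<rho>' where \<eta>: "\<eta> > 0" "AE x in lebesgue. x \<in> ball p \<eta> \<inter> closure D1 \<longrightarrow> \<rho>1 x = \<rho>' x" "\<rho>' p \<noteq> 0"
     "\<And>\<omega>. \<omega> > 0 \<Longrightarrow> \<exists>r>0. \<forall>x\<in>ball p r. cmod (\<rho>' x - \<rho>' p) \<le> \<omega>"
    using corner[OF p(1)] by blast
  define I1 where "I1 \<tau> = (LINT x|lebesgue_on D1. \<rho>1 x * exp (clin (cgo k d \<tau>) (x - p)))" for \<tau>
  define I2 where "I2 \<tau> = (LINT x|lebesgue_on D2. \<rho>2 x * exp (clin (cgo k d \<tau>) (x - p)))" for \<tau>
  obtain c where c: "c > 0" "\<forall>\<^sub>F \<tau> in at_top. c / \<tau>\<^sup>2 \<le> cmod (I1 \<tau>)"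
    using corner_integral_lower_bound[OF poly1 \<rho>1 p d k \<eta>(1,2,4,3)] unfolding I1_def by blast
  define R where "R = (LINT x|lebesgue_on D2. cmod (\<rho>2 x))"
  \<comment> \<open>Half of the lower bound is taken, so that the final inequality has the form y
    \<le> y / 2 with y > 0.\<close>
  have ev: "\<forall>\<^sub>F \<tau> in at_top. (2 * norm a2 * R) * exp (- (\<tau> * \<kappa>)) \<le> (norm a1 * c / 2) / \<tau>\<^sup>2"
    by (rule eventually_exp_bound) (use \<kappa> c a1 in auto)
  \<comment> \<open>A statement that is false for every \<tau>; it cannot hold eventually because
    \<open>at_top\<close> is not the trivial filter.\<close>
  have "\<forall>\<^sub>F \<tau> in at_top. \<tau> \<noteq> (\<tau> :: real)"
    using c(2) ev eventually_gt_at_top[of 0] eventually_ge_at_top[of k]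
  proof eventually_elim
    case (elim \<tau>)
    define \<zeta> where "\<zeta> = cgo k d \<tau>"
    have id: "clin \<zeta> a1 * I1 \<tau> = clin \<zeta> a2 * I2 \<tau>"
    proof -
      \<comment> \<open>Moving the base point to \<open>p\<close> costs the non-zero factor exp
        (\<zeta> . p), the same for both sources.\<close>
      have sh: "(LINT x|M. \<rho> x * exp (clin \<zeta> x)) = exp (clin \<zeta> p) * (LINT x|M. \<rho> x * exp (clin \<zeta> (x - p)))" for M \<rho>
      proof -
        have "\<rho> x * exp (clin \<zeta> x) = exp (clin \<zeta> p) * (\<rho> x * exp (clin \<zeta> (x - p)))" for x
          by (simp add: clin_diff exp_diff)
        then have "(LINT x|M. \<rho> x * exp (clin \<zeta> x)) = (LINT x|M. exp (clin \<zeta> p) * (\<rho> x * exp (clin \<zeta> (x - p))))"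
          by (rule Bochner_Integration.integral_cong[OF refl])
        then show ?thesis by simp
      qed
      have "clin \<zeta> a1 * (LINT x|lebesgue_on D1. \<rho>1 x * exp (clin \<zeta> x)) = clin \<zeta> a2 * (LINT x|lebesgue_on D2. \<rho>2 x * exp (clin \<zeta> x))"
        using source_identity[OF \<Omega> D1(1,3) \<rho>1 D2(1,3) \<rho>2 c1 c2, of \<zeta>] bdot_cgo[OF d, of k \<tau>]
        by (simp add: clin_def \<zeta>_def mult.commute)
      then show ?thesis unfolding sh I1_def I2_def \<zeta>_def[symmetric] by simp
    qed
    have "cmod (I2 \<tau>) = cmod (LINT x|lebesgue_on D2. indicator UNIV x *\<^sub>R (\<rho>2 x * exp (clin \<zeta> (x - p))))"
      by (simp add: I2_def \<zeta>_def)
    also have "\<dots> \<le> exp (- (\<tau> * \<kappa>)) * R"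
      unfolding R_def
    proof (rule norm_integral_exp_le(2)[OF D2(1,2)])
      show "integrable (lebesgue_on D2) \<rho>2" by (rule square_integrable_imp_integrable[OF finite_measure_lebesgue_on[OF D2(1,2)] \<rho>2])
      fix x assume "x \<in> D2"
      then show "Re (clin \<zeta> (x - p)) \<le> - (\<tau> * \<kappa>)"
        using mult_left_mono[OF \<kappa>(2), of x \<tau>] elim(3) by (simp add: \<zeta>_def clin_cgo)
    qed auto
    finally have I2: "cmod (I2 \<tau>) \<le> exp (- (\<tau> * \<kappa>)) * R" .
    have "(\<tau> * norm a1) * (c / \<tau>\<^sup>2) \<le> cmod (clin \<zeta> a1) * cmod (I1 \<tau>)"
      unfolding \<zeta>_def using elim c k by (intro mult_mono norm_clin_cgo(1)[OF d]) auto
    also have "\<dots> = cmod (clin \<zeta> a2) * cmod (I2 \<tau>)" by (simp only: norm_mult[symmetric] id)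
    also have "\<dots> \<le> (2 * \<tau> * norm a2) * (exp (- (\<tau> * \<kappa>)) * R)"
      unfolding \<zeta>_def using elim k I2 by (intro mult_mono norm_clin_cgo(2)[OF d]) auto
    also have "\<dots> = \<tau> * ((2 * norm a2 * R) * exp (- (\<tau> * \<kappa>)))" by simp
    also have "\<dots> \<le> \<tau> * ((norm a1 * c / 2) / \<tau>\<^sup>2)" using elim by (intro mult_left_mono) auto
    finally have "\<tau> * (norm a1 * c / \<tau>\<^sup>2) \<le> \<tau> * (norm a1 * c / \<tau>\<^sup>2) / 2" by simp
    moreover have "\<tau> * (norm a1 * c / \<tau>\<^sup>2) > 0" using elim a1 c by simp
    moreover have "\<not> y \<le> y / 2" if "y > 0" for y :: real using that by simp
    ultimately have False by blast
    then show ?case ..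
  qed
  then show False by simp
qed

theorem corollary2:
  fixes \<Omega> D1 D2 :: "(real^2) set" and k :: real
    and \<rho>1 \<rho>2 u1 u2 g :: "real^2 \<Rightarrow> complex" and a1 a2 :: "real^2"
    and h :: "(real^2 \<Rightarrow> complex) \<Rightarrow> complex"
  assumes "lipschitz_domain \<Omega>" and "k \<ge> 0"
    and "admissible \<Omega> D1 \<rho>1" and "admissible \<Omega> D2 \<rho>2"
    and "a1 \<noteq> 0" and "a2 \<noteq> 0"
    and "weak_solution \<Omega> k (div_source \<Omega> D1 \<rho>1 a1) u1"
    and "weak_solution \<Omega> k (div_source \<Omega> D2 \<rho>2 a2) u2"
    and "has_cauchy_data \<Omega> k (div_source \<Omega> D1 \<rho>1 a1) u1 g h"
    and "has_cauchy_data \<Omega> k (div_source \<Omega> D2 \<rho>2 a2) u2 g h"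
  shows "convex hull D1 = convex hull D2"
  \<comment> \<open>Each inclusion draws on the non-vanishing of the vector that belongs to the
    polygon on its left.\<close>
  using convex_hull_subset_of_cauchy_data[OF assms(1,2,3,4,5,9,10)]
    convex_hull_subset_of_cauchy_data[OF assms(1,2,4,3,6,10,9)]
  by (rule equalityI)

end
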